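(* Let $\mathcal H$ be a Hilbert space and let $\mathbb W\in\mathbb B(\mathcal H\otimes\mathcal H)$ be a modular multiplicative unitary. If $a,b\in\mathbb B(\mathcal H)$ satisfy $\mathbb W(a\otimes 1)=(1\otimes b)\mathbb W$, then $a=b=\lambda 1$ for some $\lambda\in\mathbb C$. More generally, if $D$ is a $C^*$-algebra and $a,b\in\mathcal M(\mathbb K(\mathcal H)\otimes D)$ satisfy $\mathbb W_{12}a_{13}=b_{23}\mathbb W_{12}$ in $\mathcal M(\mathbb K(\mathcal H\otimes\mathcal H)\otimes D)$, then $a=b\in\mathbb C\cdot 1_{\mathcal H}\otimes\mathcal M(D)$.
   Context: $\mathbb B(\mathcal H)$ and $\mathbb K(\mathcal H)$ are the bounded and compact operators on $\mathcal H$; $\mathcal M(A)$ is the multiplier algebra of a $C^*$-algebra $A$; tensor products of $C^*$-algebras are spatial; subscripts such as $a_{13}$ are leg numbering notation. Inner products are linear in the second variable and $(x\mid T\mid y):=(x\mid Ty)$. A unitary $\mathbb W$ on $\mathcal H\otimes\mathcal H$ is multiplicative if $\mathbb W_{23}\mathbb W_{12}=\mathbb W_{12}\mathbb W_{13}\mathbb W_{23}$. It is modular if there are positive self-adjoint (possibly unbounded) operators $\hat Q,Q$ on $\mathcal H$ with trivial kernels and a unitary $\widetilde{\mathbb W}$ on $\overline{\mathcal H}\otimes\mathcal H$ ($\overline{\mathcal H}$ is the complex-conjugate Hilbert space, $\xi\mapsto\overline\xi$ the canonical antiunitary) such that $\mathbb W^*(\hat Q\otimes Q)\mathbb W=\hat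 Q\otimes Q$ and $(x\otimes y\mid\mathbb W\mid z\otimes u)=(\overline z\otimes Qy\mid\widetilde{\mathbb W}\mid\overline x\otimes Q^{-1}u)$ for all $x,z\in\mathcal H$, $y\in\mathrm{dom}(Q)$, $u\in\mathrm{dom}(Q^{-1})$. *)

theory Defs
  imports "HOL-Analysis.Analysis"
begin

section \<open>Complex vector spaces, Hilbert spaces and C*-algebras\<close>

class complex_vector = real_vector +
  fixes scaleC :: "complex \<Rightarrow> 'a \<Rightarrow> 'a" (infixr "*\<^sub>C" 75)
  assumes scaleC_add_right: "c *\<^sub>C (x + y) = c *\<^sub>C x + c *\<^sub>C y"
    and scaleC_add_left: "(c + d) *\<^sub>C x = c *\<^sub>C x + d *\<^sub>C x"
    and scaleC_scaleC: "c *\<^sub>C d *\<^sub>C x = (c * d) *\<^sub>C x"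
    and scaleC_one: "1 *\<^sub>C x = x"
    and scaleR_scaleC: "r *\<^sub>R x = complex_of_real r *\<^sub>C x"

global_interpretation complex_vector: vector_space "scaleC :: complex \<Rightarrow> 'a \<Rightarrow> 'a::complex_vector"
  defines csubspace = complex_vector.subspace
    and cspan = complex_vector.span
  by unfold_locales (simp_all add: scaleC_add_right scaleC_add_left scaleC_scaleC scaleC_one)

class complex_normed_vector = complex_vector + real_normed_vector +
  assumes norm_scaleC: "norm (c *\<^sub>C x) = cmod c * norm x"

text \<open>The inner product is linear in the second variable.\<close>

class complex_inner = complex_vector + real_normed_vector +
  fixes cinner :: "'a \<Rightarrow> 'a \<Rightarrow> complex"
  assumes cinner_commute: "cinner x y = cnj (cinner y x)"
    and cinner_add_right: "cinner x (y + z) = cinner x y + cinner x z"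
    and cinner_scaleC_right: "cinner x (c *\<^sub>C y) = c * cinner x y"
    and cinner_self: "cinner x x = complex_of_real ((norm x)\<^sup>2)"

class chilbert_space = complex_inner + complete_space

subclass (in chilbert_space) banach ..

class cstar_algebra = complex_normed_vector + real_normed_algebra + banach +
  fixes star :: "'a \<Rightarrow> 'a"
  assumes mult_scaleC_left: "(c *\<^sub>C x) * y = c *\<^sub>C (x * y)"
    and mult_scaleC_right: "x * (c *\<^sub>C y) = c *\<^sub>C (x * y)"
    and star_add: "star (x + y) = star x + star y"
    and star_scaleC: "star (c *\<^sub>C x) = cnj c *\<^sub>C star x"
    and star_mult: "star (x * y) = star y * star x"
    and star_star: "star (star x) = x"
    and cstar_identity: "norm (star x * x) = (norm x)\<^sup>2"

subsection \<open>Elementary properties of the inner product\<close>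

lemma cinner_add_left: "cinner (x + y) z = cinner x z + cinner y z" for x :: "'a::complex_inner"
  by (subst (1 2 3) cinner_commute) (simp add: cinner_add_right)

lemma cinner_scaleC_left: "cinner (c *\<^sub>C x) y = cnj c * cinner x y" for x :: "'a::complex_inner"
  by (subst (1 2) cinner_commute) (simp add: cinner_scaleC_right)

lemma cinner_zero_right [simp]: "cinner x 0 = 0" for x :: "'a::complex_inner"
  using cinner_add_right[of x 0 0] by simp

lemma cinner_zero_left [simp]: "cinner 0 x = 0" for x :: "'a::complex_inner"
  using cinner_add_left[of 0 0 x] by simp

lemma cinner_minus_right: "cinner x (- y) = - cinner x y" for x :: "'a::complex_inner"
  using cinner_add_right[of x y "- y"] by (simp add: eq_neg_iff_add_eq_0 add.commute)

lemma cinner_minus_left: "cinner (- x) y = - cinner x y" for x :: "'a::complex_inner"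
  using cinner_add_left[of x "- x" y] by (simp add: eq_neg_iff_add_eq_0 add.commute)

lemma cinner_diff_right: "cinner x (y - z) = cinner x y - cinner x z" for x :: "'a::complex_inner"
  using cinner_add_right[of x y "- z"] by (simp add: cinner_minus_right)

lemma cinner_diff_left: "cinner (x - y) z = cinner x z - cinner y z" for x :: "'a::complex_inner"
  using cinner_add_left[of x "- y" z] by (simp add: cinner_minus_left)

lemma cinner_eq_zero_iff: "cinner x x = 0 \<longleftrightarrow> x = 0" for x :: "'a::complex_inner"
  by (simp add: cinner_self)

subclass (in complex_inner) complex_normed_vector
proof
  fix c x
  have "complex_of_real ((norm (c *\<^sub>C x))\<^sup>2) = c * cinner (c *\<^sub>C x) x"
    by (simp only: cinner_self [symmetric] cinner_scaleC_right)
  also have "\<dots> = c * cnj (c * cinner x x)"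
    by (subst cinner_commute) (simp only: cinner_scaleC_right)
  also have "\<dots> = complex_of_real ((cmod c * norm x)\<^sup>2)"
    by (simp only: cinner_self complex_cnj_mult complex_cnj_power complex_cnj_complex_of_real mult.assoc [symmetric]
        complex_norm_square [symmetric] power_mult_distrib of_real_mult of_real_power)
  finally have "(norm (c *\<^sub>C x))\<^sup>2 = (cmod c * norm x)\<^sup>2"
    by (simp only: of_real_eq_iff)
  then show "norm (c *\<^sub>C x) = cmod c * norm x"
    by (rule power2_eq_imp_eq) simp_all
qed

text \<open>The Cauchy--Schwarz inequality is stated for semi-inner products because it is
  needed below for the construction of tensor products.\<close>

lemma semi_inner_Cauchy_Schwarz:
  fixes s :: "'a::complex_vector \<Rightarrow> 'a \<Rightarrow> complex"
  assumes comm: "\<And>x y. s x y = cnj (s y x)"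
    and add: "\<And>x y z. s x (y + z) = s x y + s x z"
    and scale: "\<And>c x y. s x (c *\<^sub>C y) = c * s x y"
    and pos: "\<And>x. 0 \<le> Re (s x x)"
  shows "(cmod (s x y))\<^sup>2 \<le> Re (s x x) * Re (s y y)"
proof -
  define a where "a = Re (s x x)"
  define b where "b = Re (s y y)"
  define c where "c = s x y"
  have add': "s (x + y) z = s x z + s y z" for x y z
    by (subst (1 2 3) comm) (simp add: add)
  have scale': "s (c *\<^sub>C x) y = cnj c * s x y" for c x y
    by (subst (1 2) comm) (simp add: scale)
  have yx: "s y x = cnj c"
    unfolding c_def by (rule comm)
  have key: "0 \<le> a + 2 * Re (t * c) + (cmod t)\<^sup>2 * b" for t
  proof -
    have "s (x + t *\<^sub>C y) (x + t *\<^sub>C y) = s x x + t * c + cnj t * cnj c + (cnj t * t) * s y y"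
      by (simp add: add add' scale scale' yx c_def [symmetric] algebra_simps)
    also have "cnj t * t = complex_of_real ((cmod t)\<^sup>2)"
      by (metis complex_norm_square mult.commute of_real_power)
    finally have "Re (s (x + t *\<^sub>C y) (x + t *\<^sub>C y)) = a + 2 * Re (t * c) + (cmod t)\<^sup>2 * b"
      by (simp add: a_def b_def)
    then show ?thesis using pos by metis
  qed
  have cc: "Re (cnj c * c) = (cmod c)\<^sup>2"
    by (metis Re_complex_of_real complex_norm_square mult.commute of_real_power)
  have main: "0 \<le> a - 2 * k * (cmod c)\<^sup>2 + k\<^sup>2 * (cmod c)\<^sup>2 * b" for k :: real
  proof -
    have "Re (- (complex_of_real k * cnj c) * c) = - (k * (cmod c)\<^sup>2)"
      unfolding cc [symmetric] by (simp add: algebra_simps)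
    moreover have "(cmod (- (complex_of_real k * cnj c)))\<^sup>2 = k\<^sup>2 * (cmod c)\<^sup>2"
      by (simp add: norm_mult power_mult_distrib)
    ultimately show ?thesis
      using key[of "- (complex_of_real k * cnj c)"] by simp
  qed
  have ab: "0 \<le> a" "0 \<le> b" using pos by (simp_all add: a_def b_def)
  show ?thesis
  proof (cases "b = 0")
    case True
    have "cmod c = 0"
    proof (rule ccontr)
      assume nz: "cmod c \<noteq> 0"
      have "0 \<le> a - 2 * ((a + 1) / (2 * (cmod c)\<^sup>2)) * (cmod c)\<^sup>2"
        using main[of "(a + 1) / (2 * (cmod c)\<^sup>2)"] True by simp
      then show False using nz by simp
    qed
    then show ?thesis using ab by (simp add: a_def b_def c_def)
  next
    case False
    then have b: "b > 0" using ab by simp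
    have "0 \<le> a - 2 * (1 / b) * (cmod c)\<^sup>2 + (1 / b)\<^sup>2 * (cmod c)\<^sup>2 * b"
      by (rule main)
    also have "\<dots> = a - (cmod c)\<^sup>2 / b"
      using b by (simp add: field_simps power2_eq_square)
    finally show ?thesis
      using b by (simp add: a_def [symmetric] b_def [symmetric] c_def [symmetric] field_simps)
  qed
qed

lemma semi_inner_triangle:
  fixes s :: "'a::complex_vector \<Rightarrow> 'a \<Rightarrow> complex"
  assumes comm: "\<And>x y. s x y = cnj (s y x)"
    and add: "\<And>x y z. s x (y + z) = s x y + s x z"
    and scale: "\<And>c x y. s x (c *\<^sub>C y) = c * s x y"
    and pos: "\<And>x. 0 \<le> Re (s x x)"
  shows "sqrt (Re (s (x + y) (x + y))) \<le> sqrt (Re (s x x)) + sqrt (Re (s y y))"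
proof (rule real_le_lsqrt)
  have add': "s (x + y) z = s x z + s y z" for x y z
    by (subst (1 2 3) comm) (simp add: add)
  have "Re (s x y) \<le> cmod (s x y)" by (rule complex_Re_le_cmod)
  also have "\<dots> \<le> sqrt (Re (s x x) * Re (s y y))"
    by (rule real_le_rsqrt, rule semi_inner_Cauchy_Schwarz [of s, OF comm add scale pos])
  finally have "Re (s x y) \<le> sqrt (Re (s x x)) * sqrt (Re (s y y))"
    by (simp add: real_sqrt_mult)
  moreover have "Re (s y x) = Re (s x y)"
    by (subst comm) simp
  ultimately show "Re (s (x + y) (x + y)) \<le> (sqrt (Re (s x x)) + sqrt (Re (s y y)))\<^sup>2"
    using pos[of x] pos[of y] by (simp add: add add' power2_sum)
qed (use pos in \<open>simp add: add_nonneg_nonneg\<close>)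

lemma cinner_Cauchy_Schwarz: "cmod (cinner x y) \<le> norm x * norm y" for x :: "'a::complex_inner"
proof -
  have "(cmod (cinner x y))\<^sup>2 \<le> Re (cinner x x) * Re (cinner y y)"
    by (rule semi_inner_Cauchy_Schwarz)
      (rule cinner_commute, simp_all add: cinner_add_right cinner_scaleC_right cinner_self
        flip: of_real_power)
  then have "(cmod (cinner x y))\<^sup>2 \<le> (norm x * norm y)\<^sup>2"
    by (simp add: cinner_self power_mult_distrib flip: of_real_power)
  then show ?thesis
    by (rule power2_le_imp_le) simp
qed

lemma bounded_linear_cinner_right: "bounded_linear (\<lambda>y. cinner x y)" for x :: "'a::complex_inner"
  by (rule bounded_linear_intro[of _ "norm x"])
    (simp_all add: cinner_add_right scaleR_scaleC cinner_scaleC_right scaleR_conv_of_real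
      cinner_Cauchy_Schwarz mult.commute[of _ "norm x"])

lemma bounded_bilinear_cinner: "bounded_bilinear (cinner :: 'a::complex_inner \<Rightarrow> 'a \<Rightarrow> complex)"
proof
  show "\<exists>K. \<forall>a b::'a. norm (cinner a b) \<le> norm a * norm b * K"
    by (rule exI[of _ 1]) (simp add: cinner_Cauchy_Schwarz)
qed (simp_all add: cinner_add_left cinner_add_right scaleR_scaleC cinner_scaleC_left
    cinner_scaleC_right, simp_all add: scaleR_conv_of_real)

lemmas tendsto_cinner [tendsto_intros] = bounded_bilinear.tendsto[OF bounded_bilinear_cinner]
lemmas continuous_on_cinner [continuous_intros] =
  bounded_bilinear.continuous_on[OF bounded_bilinear_cinner]

lemma bounded_linear_scaleC: "bounded_linear (\<lambda>x::'a::complex_normed_vector. c *\<^sub>C x)"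
proof (rule bounded_linear_intro)
  show "norm (c *\<^sub>C x) \<le> norm x * cmod c" for x :: 'a
    by (simp add: norm_scaleC)
qed (simp_all add: scaleC_add_right scaleR_scaleC scaleC_scaleC mult.commute)

lemmas tendsto_scaleC [tendsto_intros] = bounded_linear.tendsto[OF bounded_linear_scaleC]
lemmas continuous_on_scaleC [continuous_intros] =
  bounded_linear.continuous_on[OF bounded_linear_scaleC]

lemma csubspace_closure:
  fixes S :: "'a::complex_normed_vector set"
  assumes "csubspace S"
  shows "csubspace (closure S)"
proof (rule complex_vector.subspaceI)
  show "0 \<in> closure S"
    using complex_vector.subspace_0[OF assms] closure_subset by blast
next
  fix x y assume "x \<in> closure S" "y \<in> closure S"
  then obtain f g where "\<And>n. f n \<in> S" "f \<longlonglongrightarrow> x" "\<And>n. g n \<in> S" "g \<longlonglongrightarrow> y"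
    by (auto simp: closure_sequential)
  then show "x + y \<in> closure S"
    unfolding closure_sequential
    by (intro exI[of _ "\<lambda>n. f n + g n"]) (auto intro: tendsto_add complex_vector.subspace_add[OF assms])
next
  fix c x assume "x \<in> closure S"
  then obtain f where "\<And>n. f n \<in> S" "f \<longlonglongrightarrow> x"
    by (auto simp: closure_sequential)
  then show "c *\<^sub>C x \<in> closure S"
    unfolding closure_sequential
    by (intro exI[of _ "\<lambda>n. c *\<^sub>C f n"]) (auto intro: tendsto_scaleC complex_vector.subspace_scale[OF assms])
qed

subsection \<open>Standard instances\<close>

instantiation complex :: chilbert_space
begin

definition scaleC_complex_def [simp]: "c *\<^sub>C x = c * x" for c x :: complex
definition cinner_complex_def: "cinner x y = cnj x * y" for x y :: complex

instance
proof
  show "cinner x x = complex_of_real ((norm x)\<^sup>2)" for x :: complex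
    by (metis cinner_complex_def complex_norm_square mult.commute of_real_power)
qed (simp_all add: cinner_complex_def distrib_left distrib_right scaleR_conv_of_real)

end

instantiation complex :: cstar_algebra
begin

definition star_complex_def: "star x = cnj x" for x :: complex

instance
  by standard (simp_all add: star_complex_def norm_mult power2_eq_square)

end

instantiation prod :: (complex_vector, complex_vector) complex_vector
begin

definition scaleC_prod_def: "c *\<^sub>C p = (c *\<^sub>C fst p, c *\<^sub>C snd p)" for p :: "'a \<times> 'b"

instance
  by standard (simp_all add: scaleC_prod_def scaleC_add_right scaleC_add_left scaleC_scaleC
      scaleC_one scaleR_scaleC prod_eq_iff)

end

instantiation blinfun :: (real_normed_vector, complex_normed_vector) complex_normed_vector
begin

lift_definition scaleC_blinfun :: "complex \<Rightarrow> ('a \<Rightarrow>\<^sub>L 'b) \<Rightarrow> ('a \<Rightarrow>\<^sub>L 'b)"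
  is "\<lambda>c f x. c *\<^sub>C f x"
  by (rule bounded_linear_compose[OF bounded_linear_scaleC])

instance
proof
  fix c d :: complex and r :: real and f g :: "'a \<Rightarrow>\<^sub>L 'b"
  show "c *\<^sub>C (f + g) = c *\<^sub>C f + c *\<^sub>C g" "(c + d) *\<^sub>C f = c *\<^sub>C f + d *\<^sub>C f"
    "c *\<^sub>C d *\<^sub>C f = (c * d) *\<^sub>C f" "1 *\<^sub>C f = f" "r *\<^sub>R f = complex_of_real r *\<^sub>C f"
    by (transfer; simp add: fun_eq_iff scaleC_add_right scaleC_add_left scaleC_scaleC scaleC_one
        scaleR_scaleC)+
  have le: "norm (c *\<^sub>C f) \<le> cmod c * norm f" for c and f :: "'a \<Rightarrow>\<^sub>L 'b"
    by (rule norm_blinfun_bound)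
      (simp_all add: scaleC_blinfun.rep_eq norm_scaleC mult.assoc mult_left_mono norm_blinfun)
  show "norm (c *\<^sub>C f) = cmod c * norm f"
  proof (cases "c = 0")
    case True
    then show ?thesis using le[of 0 f] by simp
  next
    case False
    have "inverse c *\<^sub>C c *\<^sub>C f = f"
      using False by (transfer; simp add: scaleC_scaleC scaleC_one)
    then have "norm f \<le> cmod (inverse c) * norm (c *\<^sub>C f)"
      using le[of "inverse c" "c *\<^sub>C f"] by simp
    then have "cmod c * norm f \<le> norm (c *\<^sub>C f)"
      using False by (simp add: norm_inverse norm_divide field_simps)
    with le show ?thesis by (rule antisym)
  qed
qed

end

section \<open>The complex-conjugate Hilbert space\<close>

typedef 'a conj_space = "UNIV :: 'a set"
  morphisms of_bar bar
  by simp

setup_lifting type_definition_conj_space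

lemma of_bar_bar [simp]: "of_bar (bar x) = x"
  by (simp add: bar_inverse)

instantiation conj_space :: (complex_vector) complex_vector
begin

lift_definition zero_conj_space :: "'a conj_space" is 0 .
lift_definition plus_conj_space :: "'a conj_space \<Rightarrow> 'a conj_space \<Rightarrow> 'a conj_space" is "(+)" .
lift_definition minus_conj_space :: "'a conj_space \<Rightarrow> 'a conj_space \<Rightarrow> 'a conj_space" is "(-)" .
lift_definition uminus_conj_space :: "'a conj_space \<Rightarrow> 'a conj_space" is uminus .
lift_definition scaleR_conj_space :: "real \<Rightarrow> 'a conj_space \<Rightarrow> 'a conj_space" is scaleR .
lift_definition scaleC_conj_space :: "complex \<Rightarrow> 'a conj_space \<Rightarrow> 'a conj_space"
  is "\<lambda>c x. cnj c *\<^sub>C x" .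

instance
proof
  fix x y z :: "'a conj_space" and r s :: real and c d :: complex
  show "x + y + z = x + (y + z)" "x + y = y + x" "0 + x = x" "- x + x = 0" "x - y = x + - y"
    "r *\<^sub>R (x + y) = r *\<^sub>R x + r *\<^sub>R y" "(r + s) *\<^sub>R x = r *\<^sub>R x + s *\<^sub>R x"
    "r *\<^sub>R s *\<^sub>R x = (r * s) *\<^sub>R x" "1 *\<^sub>R x = x"
    "c *\<^sub>C (x + y) = c *\<^sub>C x + c *\<^sub>C y" "(c + d) *\<^sub>C x = c *\<^sub>C x + d *\<^sub>C x"
    "c *\<^sub>C d *\<^sub>C x = (c * d) *\<^sub>C x" "1 *\<^sub>C x = x" "r *\<^sub>R x = complex_of_real r *\<^sub>C x"
    by (transfer; simp add: algebra_simps scaleC_add_right scaleC_add_left scaleC_scaleC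
        scaleR_scaleC)+
qed

end

instantiation conj_space :: (complex_inner) complex_inner
begin

lift_definition cinner_conj_space :: "'a conj_space \<Rightarrow> 'a conj_space \<Rightarrow> complex"
  is "\<lambda>x y. cinner y x" .
lift_definition norm_conj_space :: "'a conj_space \<Rightarrow> real" is norm .
lift_definition dist_conj_space :: "'a conj_space \<Rightarrow> 'a conj_space \<Rightarrow> real" is dist .
lift_definition sgn_conj_space :: "'a conj_space \<Rightarrow> 'a conj_space" is sgn .
definition uniformity_conj_space :: "('a conj_space \<times> 'a conj_space) filter"
  where "uniformity_conj_space = (INF e\<in>{0<..}. principal {(x, y). dist x y < e})"
definition open_conj_space :: "'a conj_space set \<Rightarrow> bool"
  where "open_conj_space U \<longleftrightarrow> (\<forall>x\<in>U. eventually (\<lambda>(x', y). x' = x \<longrightarrow> y \<in> U) uniformity)"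

instance
proof
  fix x y z :: "'a conj_space" and r :: real and c :: complex
  show "dist x y = norm (x - y)" "sgn x = x /\<^sub>R norm x"
    "norm x = 0 \<longleftrightarrow> x = 0" "norm (x + y) \<le> norm x + norm y" "norm (r *\<^sub>R x) = \<bar>r\<bar> * norm x"
    "cinner x (y + z) = cinner x y + cinner x z" "cinner x (c *\<^sub>C y) = c * cinner x y"
    "cinner x x = complex_of_real ((norm x)\<^sup>2)"
    by (transfer; simp add: dist_norm sgn_div_norm norm_triangle_ineq cinner_add_left
        cinner_scaleC_left cinner_self)+
  show "cinner x y = cnj (cinner y x)"
    by transfer (rule cinner_commute)
  show "(uniformity :: ('a conj_space \<times> 'a conj_space) filter)
      = (INF e\<in>{0<..}. principal {(x, y). dist x y < e})"
    by (rule uniformity_conj_space_def)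
  show "open U \<longleftrightarrow> (\<forall>x\<in>U. eventually (\<lambda>(x', y). x' = x \<longrightarrow> y \<in> U) uniformity)" for U :: "'a conj_space set"
    by (rule open_conj_space_def)
qed

end

lemma dist_bar: "dist (bar x) (bar y) = dist x y"
  by transfer rule

instance conj_space :: (chilbert_space) chilbert_space
proof
  fix X :: "nat \<Rightarrow> 'a conj_space"
  assume "Cauchy X"
  then have "Cauchy (\<lambda>n. of_bar (X n))"
    by (simp add: Cauchy_def dist_conj_space.rep_eq)
  then obtain l where l: "(\<lambda>n. of_bar (X n)) \<longlonglongrightarrow> l"
    using Cauchy_convergent convergent_def by blast
  have "X \<longlonglongrightarrow> bar l"
    using l by (simp add: lim_sequentially dist_conj_space.rep_eq)
  then show "convergent X" by (auto simp: convergent_def)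
qed

section \<open>Tensor products of Hilbert spaces\<close>

subsection \<open>The algebraic tensor product\<close>

text \<open>A list of pairs \<open>[(p\<^sub>1, q\<^sub>1), \<dots>]\<close> stands for the finite sum of the elementary tensors of
  \<open>p\<^sub>i\<close> and \<open>q\<^sub>i\<close>. For inner product spaces two such sums represent the same element
  of the algebraic tensor product iff they have the same inner product with all elementary
  tensors, i.e. iff the following sesquilinear forms coincide.\<close>

definition tform :: "('a::complex_inner \<times> 'b::complex_inner) list \<Rightarrow> 'a \<Rightarrow> 'b \<Rightarrow> complex" where
  "tform xs x y = (\<Sum>(p, q)\<leftarrow>xs. cinner x p * cinner y q)"

definition gram :: "('a::complex_inner \<times> 'b::complex_inner) list \<Rightarrow> ('a \<times> 'b) list \<Rightarrow> complex" where
  "gram xs ys = (\<Sum>(p, q)\<leftarrow>xs. tform ys p q)"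

lemma tform_simps [simp]:
  "tform [] x y = 0"
  "tform ((p, q) # xs) x y = cinner x p * cinner y q + tform xs x y"
  "tform (xs @ ys) x y = tform xs x y + tform ys x y"
  by (simp_all add: tform_def)

lemma gram_simps [simp]:
  "gram [] ys = 0"
  "gram ((p, q) # xs) ys = tform ys p q + gram xs ys"
  "gram (xs @ zs) ys = gram xs ys + gram zs ys"
  by (simp_all add: gram_def)

lemma gram_Nil_right [simp]: "gram xs [] = 0"
  by (induction xs) auto

lemma gram_Cons_right: "gram xs ((p, q) # ys) = cnj (tform xs p q) + gram xs ys"
proof (induction xs)
  case (Cons a xs)
  then show ?case
    by (cases a) (simp add: algebra_simps flip: cinner_commute)
qed simp

lemma gram_commute: "gram xs ys = cnj (gram ys xs)"
proof (induction xs)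
  case (Cons a xs)
  then show ?case
    by (cases a) (simp add: gram_Cons_right)
qed simp

lemma gram_append_right: "gram xs (ys @ zs) = gram xs ys + gram xs zs"
  by (subst (1 2 3) gram_commute) simp

lemma tform_scale:
  "tform (map (\<lambda>(p, q). (c *\<^sub>C p, q)) xs) x y = c * tform xs x y"
  by (induction xs) (auto simp: cinner_scaleC_right algebra_simps)

lemma tform_scale_right:
  "tform (map (\<lambda>(p, q). (p, c *\<^sub>C q)) xs) x y = c * tform xs x y"
  by (induction xs) (auto simp: cinner_scaleC_right algebra_simps)

lemma gram_scale_right: "gram xs (map (\<lambda>(p, q). (c *\<^sub>C p, q)) ys) = c * gram xs ys"
  by (induction xs) (auto simp: tform_scale algebra_simps)

lemma gram_cong:
  assumes "tform xs = tform xs'" and "tform ys = tform ys'"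
  shows "gram xs ys = gram xs' ys'"
proof -
  have *: "gram as ys = gram as ys'" if "tform ys = tform ys'" for as ys ys' :: "('a \<times> 'b) list"
    using that by (simp add: gram_def)
  show ?thesis
    by (subst *[OF assms(2)], subst (1 2) gram_commute, subst *[OF assms(1)], rule refl)
qed

text \<open>Gram--Schmidt: every element is represented by a list whose first components are
  pairwise orthogonal.\<close>

definition ortho :: "('a::complex_inner \<times> 'b) list \<Rightarrow> bool" where
  "ortho ys = sorted_wrt (\<lambda>p q. cinner (fst p) (fst q) = 0) ys"

lemma ortho_step:
  fixes p :: "'a::complex_inner" and q :: "'b::complex_inner"
  assumes "ortho ys"
  shows "\<exists>r ys'. map fst ys' = map fst ys \<and> (\<forall>e\<in>set (map fst ys). cinner r e = 0)
    \<and> (\<forall>x y. tform ((p, q) # ys) x y = cinner x r * cinner y q + tform ys' x y)"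
  using assms
proof (induction ys)
  case Nil
  show ?case by (intro exI[of _ p] exI[of _ "[]"]) simp
next
  case (Cons a ys)
  obtain e z where a: "a = (e, z)" by (cases a)
  from Cons.prems have o: "\<forall>w\<in>set (map fst ys). cinner e w = 0" and "ortho ys"
    by (auto simp: ortho_def a)
  then obtain r ys' where IH: "map fst ys' = map fst ys" "\<forall>w\<in>set (map fst ys). cinner r w = 0"
    "\<And>x y. tform ((p, q) # ys) x y = cinner x r * cinner y q + tform ys' x y"
    using Cons.IH by blast
  define c where "c = cinner e r / cinner e e"
  define r' where "r' = r - c *\<^sub>C e"
  have "cinner e r' = 0"
    by (cases "e = 0") (simp_all add: r'_def c_def cinner_diff_right cinner_scaleC_right
        cinner_eq_zero_iff)
  then have "cinner r' e = 0"
    by (subst cinner_commute) simp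
  moreover have "\<forall>w\<in>set (map fst ys). cinner r' w = 0"
    using IH(2) o by (simp add: r'_def cinner_diff_left cinner_scaleC_left)
  moreover have "tform ((p, q) # a # ys) x y
      = cinner x r' * cinner y q + tform ((e, z + c *\<^sub>C q) # ys') x y" for x y
    using IH(3)[of x y]
    by (simp add: a r'_def cinner_diff_right cinner_add_right cinner_scaleC_right algebra_simps)
  ultimately show ?case
    using IH(1) by (intro exI[of _ r'] exI[of _ "(e, z + c *\<^sub>C q) # ys'"]) (simp add: a)
qed

lemma ortho_map_fst: "ortho ys \<longleftrightarrow> sorted_wrt (\<lambda>x y. cinner x y = 0) (map fst ys)"
  by (simp add: ortho_def sorted_wrt_map)

lemma ortho_rep:
  fixes xs :: "('a::complex_inner \<times> 'b::complex_inner) list"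
  shows "\<exists>ys. ortho ys \<and> tform ys = tform xs"
proof (induction xs)
  case Nil
  show ?case by (intro exI[of _ "[]"]) (simp add: ortho_def)
next
  case (Cons a xs)
  obtain p q where a: "a = (p, q)" by (cases a)
  obtain ys where ys: "ortho ys" "tform ys = tform xs" using Cons.IH by blast
  from ortho_step[OF ys(1), of p q] obtain r ys' where
    *: "map fst ys' = map fst ys" "\<forall>e\<in>set (map fst ys). cinner r e = 0"
    "\<And>x y. tform ((p, q) # ys) x y = cinner x r * cinner y q + tform ys' x y"
    by blast
  have "ortho ((r, q) # ys')"
    using ys(1) * by (simp add: ortho_map_fst)
  moreover have "tform ((r, q) # ys') = tform (a # xs)"
    using *(3) ys(2) by (auto simp: fun_eq_iff a)
  ultimately show ?case by blast
qed

lemma tform_eq_0: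
  assumes "\<forall>e\<in>set (map fst ys). cinner x e = 0"
  shows "tform ys x y = 0"
  using assms by (induction ys) auto

lemma gram_ortho:
  assumes "ortho ys"
  shows "gram ys ys = complex_of_real (\<Sum>(e, z)\<leftarrow>ys. (norm e)\<^sup>2 * (norm z)\<^sup>2)"
  using assms
proof (induction ys)
  case (Cons a ys)
  obtain e z where a: "a = (e, z)" by (cases a)
  have "ortho ys" and "tform ys e z = 0"
    using Cons.prems by (auto simp: ortho_def a intro!: tform_eq_0)
  then show ?case
    using Cons.IH by (simp add: a gram_Cons_right cinner_self)
qed simp

lemma gram_pos: "0 \<le> Re (gram xs xs)"
proof -
  obtain ys where ys: "ortho ys" "tform ys = tform xs" using ortho_rep by blast
  have "gram xs xs = gram ys ys" using ys(2) by (intro gram_cong) simp_all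
  then show ?thesis
    by (auto simp: gram_ortho[OF ys(1)] intro!: sum_list_nonneg)
qed

quotient_type (overloaded) ('a, 'b) atensor =
    "('a::complex_inner \<times> 'b::complex_inner) list" / "\<lambda>xs ys. tform xs = tform ys"
  unfolding equivp_def by metis

lift_definition gram_atensor ::
  "('a::complex_inner, 'b::complex_inner) atensor \<Rightarrow> ('a, 'b) atensor \<Rightarrow> complex" is gram
  by (rule gram_cong)

lift_definition tform_atensor ::
  "('a::complex_inner, 'b::complex_inner) atensor \<Rightarrow> 'a \<Rightarrow> 'b \<Rightarrow> complex" is tform .

lemma atensor_eqI: "(\<And>p q. tform_atensor u p q = tform_atensor v p q) \<Longrightarrow> u = v"
  by transfer (simp add: fun_eq_iff)

lift_definition atens :: "'a::complex_inner \<Rightarrow> 'b::complex_inner \<Rightarrow> ('a, 'b) atensor"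
  is "\<lambda>p q. [(p, q)]" .

instantiation atensor :: (complex_inner, complex_inner) complex_vector
begin

lift_definition zero_atensor :: "('a, 'b) atensor" is "[]" .
lift_definition plus_atensor :: "('a, 'b) atensor \<Rightarrow> ('a, 'b) atensor \<Rightarrow> ('a, 'b) atensor"
  is "\<lambda>xs ys. xs @ ys" by (simp add: fun_eq_iff)
lift_definition scaleC_atensor :: "complex \<Rightarrow> ('a, 'b) atensor \<Rightarrow> ('a, 'b) atensor"
  is "\<lambda>c. map (\<lambda>(p, q). (c *\<^sub>C p, q))" by (simp add: fun_eq_iff tform_scale)
definition uminus_atensor :: "('a, 'b) atensor \<Rightarrow> ('a, 'b) atensor"
  where "uminus_atensor u = (- 1) *\<^sub>C u"
definition minus_atensor :: "('a, 'b) atensor \<Rightarrow> ('a, 'b) atensor \<Rightarrow> ('a, 'b) atensor"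
  where "minus_atensor u v = u + (- 1) *\<^sub>C v"
definition scaleR_atensor :: "real \<Rightarrow> ('a, 'b) atensor \<Rightarrow> ('a, 'b) atensor"
  where "scaleR_atensor r u = complex_of_real r *\<^sub>C u"

lemma tform_atensor_simps:
  "tform_atensor (0 :: ('a, 'b) atensor) p q = 0"
  "tform_atensor (u + v) p q = tform_atensor u p q + tform_atensor v p q"
  "tform_atensor (c *\<^sub>C u) p q = c * tform_atensor u p q" for u v :: "('a, 'b) atensor"
  by (transfer, simp add: tform_scale)+

instance
proof
  fix x y z :: "('a, 'b) atensor" and r s :: real and c d :: complex
  show "x + y + z = x + (y + z)" "x + y = y + x" "0 + x = x" "- x + x = 0" "x - y = x + - y"
    "r *\<^sub>R (x + y) = r *\<^sub>R x + r *\<^sub>R y" "(r + s) *\<^sub>R x = r *\<^sub>R x + s *\<^sub>R x"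
    "r *\<^sub>R s *\<^sub>R x = (r * s) *\<^sub>R x" "1 *\<^sub>R x = x"
    "c *\<^sub>C (x + y) = c *\<^sub>C x + c *\<^sub>C y" "(c + d) *\<^sub>C x = c *\<^sub>C x + d *\<^sub>C x"
    "c *\<^sub>C d *\<^sub>C x = (c * d) *\<^sub>C x" "1 *\<^sub>C x = x" "r *\<^sub>R x = complex_of_real r *\<^sub>C x"
    unfolding uminus_atensor_def minus_atensor_def scaleR_atensor_def
    by (rule atensor_eqI, simp add: tform_atensor_simps algebra_simps)+
qed

end

lemma gram_atensor_right:
  "gram_atensor u (v + w) = gram_atensor u v + gram_atensor u w"
  "gram_atensor u (c *\<^sub>C v) = c * gram_atensor u v"
  by (transfer; simp add: gram_append_right gram_scale_right)+

lemma gram_atensor_commute: "gram_atensor u v = cnj (gram_atensor v u)"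
  by transfer (rule gram_commute)

lemma gram_atensor_pos: "0 \<le> Re (gram_atensor u u)"
  by transfer (rule gram_pos)

lemma gram_atensor_real: "gram_atensor u u = complex_of_real (Re (gram_atensor u u))"
proof -
  have "Im (gram_atensor u u) = - Im (gram_atensor u u)"
    using arg_cong[OF gram_atensor_commute[of u u], of Im] by simp
  then show ?thesis by (simp add: complex_eq_iff)
qed

lemma gram_atensor_atens: "gram_atensor (atens p q) u = tform_atensor u p q"
  by transfer simp

lemma gram_atensor_eq_0: "Re (gram_atensor u u) = 0 \<longleftrightarrow> u = 0"
proof
  assume *: "Re (gram_atensor u u) = 0"
  have "tform_atensor u p q = 0" for p q
    using semi_inner_Cauchy_Schwarz[of gram_atensor "atens p q" u,
        OF gram_atensor_commute gram_atensor_right gram_atensor_pos] *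
    by (simp add: gram_atensor_atens)
  then show "u = 0"
    by transfer (simp add: fun_eq_iff)
next
  assume "u = 0"
  then show "Re (gram_atensor u u) = 0"
    using gram_atensor_right(2)[of u 0 u] by simp
qed

instantiation atensor :: (complex_inner, complex_inner) complex_inner
begin

definition cinner_atensor :: "('a, 'b) atensor \<Rightarrow> ('a, 'b) atensor \<Rightarrow> complex"
  where "cinner_atensor = gram_atensor"
definition norm_atensor :: "('a, 'b) atensor \<Rightarrow> real"
  where "norm_atensor u = sqrt (Re (gram_atensor u u))"
definition dist_atensor :: "('a, 'b) atensor \<Rightarrow> ('a, 'b) atensor \<Rightarrow> real"
  where "dist_atensor u v = norm (u - v)"
definition sgn_atensor :: "('a, 'b) atensor \<Rightarrow> ('a, 'b) atensor"
  where "sgn_atensor u = u /\<^sub>R norm u"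
definition uniformity_atensor :: "(('a, 'b) atensor \<times> ('a, 'b) atensor) filter"
  where "uniformity_atensor = (INF e\<in>{0<..}. principal {(x, y). dist x y < e})"
definition open_atensor :: "('a, 'b) atensor set \<Rightarrow> bool"
  where "open_atensor U \<longleftrightarrow> (\<forall>x\<in>U. eventually (\<lambda>(x', y). x' = x \<longrightarrow> y \<in> U) uniformity)"

instance
proof
  fix x y z :: "('a, 'b) atensor" and r :: real and c :: complex
  show "dist x y = norm (x - y)" by (rule dist_atensor_def)
  show "sgn x = x /\<^sub>R norm x" by (rule sgn_atensor_def)
  show "(uniformity :: (('a, 'b) atensor \<times> ('a, 'b) atensor) filter)
      = (INF e\<in>{0<..}. principal {(x, y). dist x y < e})"
    by (rule uniformity_atensor_def)
  show "open U \<longleftrightarrow> (\<forall>x\<in>U. eventually (\<lambda>(x', y). x' = x \<longrightarrow> y \<in> U) uniformity)" for U :: "('a, 'b) atensor set"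
    by (rule open_atensor_def)
  show "norm x = 0 \<longleftrightarrow> x = 0"
    by (simp add: norm_atensor_def gram_atensor_eq_0)
  show "norm (x + y) \<le> norm x + norm y"
    unfolding norm_atensor_def
    by (rule semi_inner_triangle[OF gram_atensor_commute gram_atensor_right gram_atensor_pos])
  have "gram_atensor (r *\<^sub>R x) (r *\<^sub>R x) = r * (r * gram_atensor x x)"
  proof -
    have "gram_atensor (r *\<^sub>R x) x = cnj (r * gram_atensor x x)"
      by (subst gram_atensor_commute) (simp only: scaleR_scaleC gram_atensor_right)
    also have "\<dots> = r * cnj (gram_atensor x x)" by simp
    also have "cnj (gram_atensor x x) = gram_atensor x x"
      by (rule gram_atensor_commute [symmetric])
    finally show ?thesis
      by (simp only: scaleR_scaleC gram_atensor_right)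
  qed
  then show "norm (r *\<^sub>R x) = \<bar>r\<bar> * norm x"
    by (simp add: norm_atensor_def real_sqrt_mult flip: mult.assoc)
  show "cinner x y = cnj (cinner y x)" "cinner x (y + z) = cinner x y + cinner x z"
    "cinner x (c *\<^sub>C y) = c * cinner x y"
    unfolding cinner_atensor_def by (rule gram_atensor_commute gram_atensor_right)+
  have "(norm x)\<^sup>2 = Re (gram_atensor x x)"
    using gram_atensor_pos[of x] by (simp add: norm_atensor_def)
  then show "cinner x x = complex_of_real ((norm x)\<^sup>2)"
    unfolding cinner_atensor_def by (simp only: gram_atensor_real [symmetric])
qed

end

subsection \<open>Completion of an inner product space\<close>

text \<open>The completion of \<open>V\<close> is the closure of \<open>V\<close> in the Banach space of bounded functionals
  on \<open>V\<close>, where \<open>u\<close> acts as the functional \<open>cinner _ u\<close>.\<close>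

lift_definition dual_embed :: "'a::complex_inner \<Rightarrow> ('a \<Rightarrow>\<^sub>L complex)" is "\<lambda>u w. cinner w u"
  by (rule bounded_bilinear.bounded_linear_left[OF bounded_bilinear_cinner])

lemma dual_embed_add: "dual_embed (u + v) = dual_embed u + dual_embed v"
  by transfer (simp add: cinner_add_right)

lemma dual_embed_scaleC: "dual_embed (c *\<^sub>C u) = c *\<^sub>C dual_embed u"
  by transfer (simp add: cinner_scaleC_right)

lemma norm_dual_embed: "norm (dual_embed u) = norm u"
proof (rule antisym)
  show "norm (dual_embed u) \<le> norm u"
    by (rule norm_blinfun_bound)
      (simp_all add: dual_embed.rep_eq cinner_Cauchy_Schwarz mult.commute)
  have "(norm u)\<^sup>2 = cmod (dual_embed u u)"
    by (simp add: dual_embed.rep_eq cinner_self norm_power)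
  also have "\<dots> \<le> norm (dual_embed u) * norm u"
    by (rule norm_blinfun)
  finally show "norm u \<le> norm (dual_embed u)"
    by (cases "u = 0") (simp_all add: power2_eq_square)
qed

lemma csubspace_range_dual_embed: "csubspace (range (dual_embed :: 'a::complex_inner \<Rightarrow> _))"
proof (rule complex_vector.subspaceI)
  show "0 \<in> range (dual_embed :: 'a \<Rightarrow> _)"
    by (rule range_eqI[of _ _ 0]) (transfer, simp)
next
  fix f g :: "'a \<Rightarrow>\<^sub>L complex" and c :: complex
  assume "f \<in> range dual_embed" "g \<in> range dual_embed"
  then obtain u v where "f = dual_embed u" "g = dual_embed v" by blast
  then show "f + g \<in> range dual_embed" "c *\<^sub>C f \<in> range dual_embed"
    by (metis dual_embed_add dual_embed_scaleC rangeI)+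
qed

lemma csubspace_completion: "csubspace (closure (range (dual_embed :: 'a::complex_inner \<Rightarrow> _)))"
  by (rule csubspace_closure[OF csubspace_range_dual_embed])

typedef (overloaded) 'a completion = "closure (range (dual_embed :: 'a::complex_inner \<Rightarrow> _))"
  morphisms rep_completion Abs_completion
  using complex_vector.subspace_0[OF csubspace_completion] by (rule exI)

setup_lifting type_definition_completion

instantiation completion :: (complex_inner) complex_vector
begin

lift_definition zero_completion :: "'a completion" is 0
  by (rule complex_vector.subspace_0[OF csubspace_completion])
lift_definition plus_completion :: "'a completion \<Rightarrow> 'a completion \<Rightarrow> 'a completion" is "(+)"
  by (rule complex_vector.subspace_add[OF csubspace_completion])
lift_definition minus_completion :: "'a completion \<Rightarrow> 'a completion \<Rightarrow> 'a completion" is "(-)"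
  by (rule complex_vector.subspace_diff[OF csubspace_completion])
lift_definition uminus_completion :: "'a completion \<Rightarrow> 'a completion" is uminus
  by (rule complex_vector.subspace_neg[OF csubspace_completion])
lift_definition scaleC_completion :: "complex \<Rightarrow> 'a completion \<Rightarrow> 'a completion" is scaleC
  by (rule complex_vector.subspace_scale[OF csubspace_completion])
lift_definition scaleR_completion :: "real \<Rightarrow> 'a completion \<Rightarrow> 'a completion" is scaleR
  unfolding scaleR_scaleC by (rule complex_vector.subspace_scale[OF csubspace_completion])

instance
proof
  fix x y z :: "'a completion" and r s :: real and c d :: complex
  show "x + y + z = x + (y + z)" "x + y = y + x" "0 + x = x" "- x + x = 0" "x - y = x + - y"
    "r *\<^sub>R (x + y) = r *\<^sub>R x + r *\<^sub>R y" "(r + s) *\<^sub>R x = r *\<^sub>R x + s *\<^sub>R x"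
    "r *\<^sub>R s *\<^sub>R x = (r * s) *\<^sub>R x" "1 *\<^sub>R x = x"
    "c *\<^sub>C (x + y) = c *\<^sub>C x + c *\<^sub>C y" "(c + d) *\<^sub>C x = c *\<^sub>C x + d *\<^sub>C x"
    "c *\<^sub>C d *\<^sub>C x = (c * d) *\<^sub>C x" "1 *\<^sub>C x = x" "r *\<^sub>R x = complex_of_real r *\<^sub>C x"
    by (transfer; simp add: algebra_simps scaleC_add_right scaleC_add_left scaleC_scaleC
        scaleR_scaleC)+
qed

end

lift_definition to_completion :: "'a::complex_inner \<Rightarrow> 'a completion" is dual_embed
  by (rule subsetD[OF closure_subset], rule rangeI)

lemma to_completion_add: "to_completion (u + v) = to_completion u + to_completion v"
  by transfer (rule dual_embed_add)

lemma to_completion_scaleC: "to_completion (c *\<^sub>C u) = c *\<^sub>C to_completion u"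
  by transfer (rule dual_embed_scaleC)

text \<open>The inner product is given by polarization of the norm.\<close>

definition polar :: "'a::complex_normed_vector \<Rightarrow> 'a \<Rightarrow> complex" where
  "polar x y = Complex (((norm (x + y))\<^sup>2 - (norm (x - y))\<^sup>2) / 4)
                       (((norm (x - \<i> *\<^sub>C y))\<^sup>2 - (norm (x + \<i> *\<^sub>C y))\<^sup>2) / 4)"

lemma norm_add_squared: "(norm (x + y))\<^sup>2 = (norm x)\<^sup>2 + (norm y)\<^sup>2 + 2 * Re (cinner x y)"
  for x :: "'a::complex_inner"
proof -
  have "complex_of_real ((norm (x + y))\<^sup>2) = cinner x x + cinner y y + (cinner x y + cnj (cinner x y))"
    unfolding cinner_self [symmetric] cinner_commute [of y x, symmetric]
    by (simp add: cinner_add_left cinner_add_right)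
  also have "\<dots> = complex_of_real ((norm x)\<^sup>2 + (norm y)\<^sup>2 + 2 * Re (cinner x y))"
    by (simp add: cinner_self complex_add_cnj)
  finally show ?thesis
    by (simp only: of_real_eq_iff)
qed

lemma polar_cinner: "polar x y = cinner x y" for x :: "'a::complex_inner"
proof -
  have 1: "(norm (x - y))\<^sup>2 = (norm x)\<^sup>2 + (norm y)\<^sup>2 - 2 * Re (cinner x y)" for y
    using norm_add_squared[of x "- y"] by (simp add: cinner_minus_right)
  have 2: "norm (\<i> *\<^sub>C y) = norm y" by (simp add: norm_scaleC)
  show ?thesis
    unfolding polar_def 1 norm_add_squared 2 by (simp add: cinner_scaleC_right complex_eq_iff)
qed

lemma polar_dual_embed: "polar (dual_embed u) (dual_embed v) = cinner u v"
proof -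
  have minus: "dual_embed (x - y) = dual_embed x - dual_embed y" for x y :: 'a
    using dual_embed_add[of "x - y" y] by simp
  have "polar (dual_embed u) (dual_embed v) = polar u v"
    by (simp add: polar_def norm_dual_embed flip: dual_embed_add minus dual_embed_scaleC)
  then show ?thesis by (simp add: polar_cinner)
qed

lemma tendsto_polar:
  assumes "(f \<longlongrightarrow> x) F" "(g \<longlongrightarrow> y) F"
  shows "((\<lambda>n. polar (f n) (g n)) \<longlongrightarrow> polar x y) F"
  unfolding polar_def
  by (intro tendsto_intros assms) auto

lemma completion_seq:
  obtains f where "(\<lambda>n. dual_embed (f n)) \<longlonglongrightarrow> rep_completion x"
proof -
  have "rep_completion x \<in> closure (range dual_embed)"
    by (rule rep_completion)
  then obtain g where g: "\<And>n. g n \<in> range dual_embed" "g \<longlonglongrightarrow> rep_completion x"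
    by (auto simp: closure_sequential)
  then have "\<forall>n. \<exists>u. g n = dual_embed u" by blast
  then obtain f where f: "\<And>n. g n = dual_embed (f n)" by metis
  have "g = (\<lambda>n. dual_embed (f n))" by (rule ext) (rule f)
  with g(2) have "(\<lambda>n. dual_embed (f n)) \<longlonglongrightarrow> rep_completion x" by (simp only:)
  then show ?thesis by (rule that)
qed

instantiation completion :: (complex_inner) complex_inner
begin

lift_definition cinner_completion :: "'a completion \<Rightarrow> 'a completion \<Rightarrow> complex" is polar .
lift_definition norm_completion :: "'a completion \<Rightarrow> real" is norm .
lift_definition dist_completion :: "'a completion \<Rightarrow> 'a completion \<Rightarrow> real" is dist .
definition sgn_completion :: "'a completion \<Rightarrow> 'a completion"
  where "sgn_completion x = x /\<^sub>R norm x"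
definition uniformity_completion :: "('a completion \<times> 'a completion) filter"
  where "uniformity_completion = (INF e\<in>{0<..}. principal {(x, y). dist x y < e})"
definition open_completion :: "'a completion set \<Rightarrow> bool"
  where "open_completion U \<longleftrightarrow> (\<forall>x\<in>U. eventually (\<lambda>(x', y). x' = x \<longrightarrow> y \<in> U) uniformity)"

instance
proof
  fix x y z :: "'a completion" and r :: real and c :: complex
  show "sgn x = x /\<^sub>R norm x" by (rule sgn_completion_def)
  show "dist x y = norm (x - y)"
    "norm x = 0 \<longleftrightarrow> x = 0" "norm (x + y) \<le> norm x + norm y" "norm (r *\<^sub>R x) = \<bar>r\<bar> * norm x"
    by (simp_all add: rep_completion_inject [symmetric] plus_completion.rep_eq
        zero_completion.rep_eq minus_completion.rep_eq scaleR_completion.rep_eq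
        norm_completion.rep_eq dist_completion.rep_eq dist_norm norm_triangle_ineq)
  show "(uniformity :: ('a completion \<times> 'a completion) filter)
      = (INF e\<in>{0<..}. principal {(x, y). dist x y < e})"
    by (rule uniformity_completion_def)
  show "open U \<longleftrightarrow> (\<forall>x\<in>U. eventually (\<lambda>(x', y). x' = x \<longrightarrow> y \<in> U) uniformity)" for U :: "'a completion set"
    by (rule open_completion_def)
  obtain f where f: "(\<lambda>n. dual_embed (f n)) \<longlonglongrightarrow> rep_completion x" by (rule completion_seq)
  obtain g where g: "(\<lambda>n. dual_embed (g n)) \<longlonglongrightarrow> rep_completion y" by (rule completion_seq)
  obtain h where h: "(\<lambda>n. dual_embed (h n)) \<longlonglongrightarrow> rep_completion z" by (rule completion_seq)
  have xy: "(\<lambda>n. cinner (f n) (g n)) \<longlonglongrightarrow> cinner x y"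
    using tendsto_polar[OF f g] by (simp add: polar_dual_embed cinner_completion.rep_eq)
  have yx: "(\<lambda>n. cinner (g n) (f n)) \<longlonglongrightarrow> cinner y x"
    using tendsto_polar[OF g f] by (simp add: polar_dual_embed cinner_completion.rep_eq)
  have xz: "(\<lambda>n. cinner (f n) (h n)) \<longlonglongrightarrow> cinner x z"
    using tendsto_polar[OF f h] by (simp add: polar_dual_embed cinner_completion.rep_eq)
  have xx: "(\<lambda>n. cinner (f n) (f n)) \<longlonglongrightarrow> cinner x x"
    using tendsto_polar[OF f f] by (simp add: polar_dual_embed cinner_completion.rep_eq)
  show "cinner x y = cnj (cinner y x)"
  proof (rule LIMSEQ_unique[OF xy])
    show "(\<lambda>n. cinner (f n) (g n)) \<longlonglongrightarrow> cnj (cinner y x)"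
      using tendsto_cnj[OF yx] by (simp flip: cinner_commute)
  qed
  show "cinner x (y + z) = cinner x y + cinner x z"
  proof (rule LIMSEQ_unique)
    show "(\<lambda>n. cinner (f n) (g n + h n)) \<longlonglongrightarrow> cinner x (y + z)"
      using tendsto_polar[OF f tendsto_add[OF g h]]
      by (simp add: polar_dual_embed cinner_completion.rep_eq plus_completion.rep_eq flip: dual_embed_add)
    show "(\<lambda>n. cinner (f n) (g n + h n)) \<longlonglongrightarrow> cinner x y + cinner x z"
      using tendsto_add[OF xy xz] by (simp add: cinner_add_right)
  qed
  show "cinner x (c *\<^sub>C y) = c * cinner x y"
  proof (rule LIMSEQ_unique)
    show "(\<lambda>n. cinner (f n) (c *\<^sub>C g n)) \<longlonglongrightarrow> cinner x (c *\<^sub>C y)"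
      using tendsto_polar[OF f tendsto_scaleC[OF g, of c]]
      by (simp add: polar_dual_embed cinner_completion.rep_eq scaleC_completion.rep_eq flip: dual_embed_scaleC)
    show "(\<lambda>n. cinner (f n) (c *\<^sub>C g n)) \<longlonglongrightarrow> c * cinner x y"
      using tendsto_mult_left[OF xy, of c] by (simp add: cinner_scaleC_right)
  qed
  show "cinner x x = complex_of_real ((norm x)\<^sup>2)"
  proof (rule LIMSEQ_unique[OF xx])
    have "(\<lambda>n. complex_of_real ((norm (dual_embed (f n)))\<^sup>2)) \<longlonglongrightarrow> complex_of_real ((norm x)\<^sup>2)"
      unfolding norm_completion.rep_eq by (intro tendsto_intros f)
    then show "(\<lambda>n. cinner (f n) (f n)) \<longlonglongrightarrow> complex_of_real ((norm x)\<^sup>2)"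
      by (simp add: cinner_self norm_dual_embed)
  qed
qed

end

instance completion :: (complex_inner) chilbert_space
proof
  fix X :: "nat \<Rightarrow> 'a completion"
  assume "Cauchy X"
  then have "Cauchy (\<lambda>n. rep_completion (X n))"
    by (simp add: Cauchy_def dist_completion.rep_eq)
  then obtain l where l: "(\<lambda>n. rep_completion (X n)) \<longlonglongrightarrow> l"
    using Cauchy_convergent convergent_def by blast
  have "l \<in> closure (range (dual_embed :: 'a \<Rightarrow> _))"
    using closed_sequentially[OF closed_closure rep_completion l] .
  then have "X \<longlonglongrightarrow> Abs_completion l"
    using l by (simp add: lim_sequentially dist_completion.rep_eq Abs_completion_inverse)
  then show "convergent X" by (auto simp: convergent_def)
qed

lemma cinner_to_completion [simp]: "cinner (to_completion u) (to_completion v) = cinner u v"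
  by (simp add: cinner_completion.rep_eq to_completion.rep_eq polar_dual_embed)

lemma closure_range_to_completion: "closure (range (to_completion :: 'a::complex_inner \<Rightarrow> _)) = UNIV"
proof -
  have "x \<in> closure (range to_completion)" for x :: "'a completion"
  proof -
    obtain f where f: "(\<lambda>n. dual_embed (f n)) \<longlonglongrightarrow> rep_completion x" by (rule completion_seq)
    then have "(\<lambda>n. to_completion (f n)) \<longlonglongrightarrow> x"
      by (simp add: lim_sequentially dist_completion.rep_eq to_completion.rep_eq)
    then show ?thesis
      unfolding closure_sequential by (intro exI[of _ "\<lambda>n. to_completion (f n)"]) simp
  qed
  then show ?thesis by blast
qed

subsection \<open>The Hilbert space tensor product\<close>

type_synonym ('a, 'b) hilbert_tensor = "('a, 'b) atensor completion"
  (infixr \<open>\<otimes>\<^sub>H\<close> 23)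

definition tensor :: "'a::complex_inner \<Rightarrow> 'b::complex_inner \<Rightarrow> 'a \<otimes>\<^sub>H 'b" (infixr \<open>\<otimes>\<close> 70)
  where "x \<otimes> y = to_completion (atens x y)"

text \<open>The facts \<open>cinner_tensor\<close> and \<open>closure_cspan_tensor\<close> below characterize the tensor
  product up to a unique unitary.\<close>

lemma cinner_tensor: "cinner (x \<otimes> y) (x' \<otimes> y') = cinner x x' * cinner y y'"
proof -
  have "gram_atensor (atens x y) (atens x' y') = cinner x x' * cinner y y'"
    by transfer simp
  then show ?thesis
    by (simp add: tensor_def cinner_atensor_def)
qed

lemma tensor_add_left: "(x + x') \<otimes> y = x \<otimes> y + x' \<otimes> y"
proof -
  have "atens (x + x') y = atens x y + atens x' y"
    by transfer (simp add: fun_eq_iff cinner_add_right algebra_simps)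
  then show ?thesis by (simp add: tensor_def flip: to_completion_add)
qed

lemma tensor_add_right: "x \<otimes> (y + y') = x \<otimes> y + x \<otimes> y'"
proof -
  have "atens x (y + y') = atens x y + atens x y'"
    by transfer (simp add: fun_eq_iff cinner_add_right algebra_simps)
  then show ?thesis by (simp add: tensor_def flip: to_completion_add)
qed

lemma tensor_scaleC_left: "(c *\<^sub>C x) \<otimes> y = c *\<^sub>C (x \<otimes> y)"
proof -
  have "atens (c *\<^sub>C x) y = c *\<^sub>C atens x y"
    by transfer (simp add: fun_eq_iff)
  then show ?thesis by (simp add: tensor_def flip: to_completion_scaleC)
qed

lemma tensor_scaleC_right: "x \<otimes> (c *\<^sub>C y) = c *\<^sub>C (x \<otimes> y)"
proof -
  have "atens x (c *\<^sub>C y) = c *\<^sub>C atens x y"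
    by transfer (simp add: fun_eq_iff cinner_scaleC_right)
  then show ?thesis by (simp add: tensor_def flip: to_completion_scaleC)
qed

lemma to_completion_in_cspan_tensor: "to_completion u \<in> cspan {x \<otimes> y | x y. True}"
proof -
  have *: "to_completion (abs_atensor xs) \<in> cspan {x \<otimes> y | x y. True}" for xs :: "('a \<times> 'b) list"
  proof (induction xs)
    case Nil
    have "to_completion (0 :: ('a, 'b) atensor) = 0"
      using to_completion_add[of 0 "0 :: ('a, 'b) atensor"] by simp
    then show ?case by (simp add: complex_vector.span_zero flip: zero_atensor_def)
  next
    case (Cons a xs)
    obtain p q where a: "a = (p, q)" by (cases a)
    have "abs_atensor (a # xs) = atens p q + abs_atensor xs"
      by (simp add: a atens.abs_eq plus_atensor.abs_eq)
    then have "to_completion (abs_atensor (a # xs)) = p \<otimes> q + to_completion (abs_atensor xs)"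
      by (simp add: to_completion_add tensor_def)
    moreover have "p \<otimes> q \<in> cspan {x \<otimes> y | x y. True}"
      by (rule complex_vector.span_base) blast
    ultimately show ?case
      using Cons.IH by (simp add: complex_vector.span_add)
  qed
  show ?thesis
    by (rule atensor.abs_induct) (rule *)
qed

lemma closure_cspan_tensor:
  "closure (cspan {x \<otimes> y | (x :: 'a::complex_inner) (y :: 'b::complex_inner). True}) = UNIV"
proof -
  have "range (to_completion :: ('a, 'b) atensor \<Rightarrow> _) \<subseteq> cspan {x \<otimes> y | x y. True}"
    by (rule image_subsetI) (rule to_completion_in_cspan_tensor)
  then show ?thesis
    using closure_mono[of "range to_completion"] closure_range_to_completion[where 'a = "('a, 'b) atensor"] by auto
qed

section \<open>Bounded operators\<close>

text \<open>The type of bounded linear functions of the library consists of the real-linear maps;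
  the complex-linear ones among them are singled out by the following set.\<close>

definition bounded_ops :: "('a::complex_inner \<Rightarrow>\<^sub>L 'b::complex_inner) set" where
  "bounded_ops = {T. \<forall>c x. blinfun_apply T (c *\<^sub>C x) = c *\<^sub>C blinfun_apply T x}"

definition compact_ops :: "('a::complex_inner \<Rightarrow>\<^sub>L 'b::complex_inner) set" where
  "compact_ops = {T \<in> bounded_ops. compact (closure (blinfun_apply T ` cball 0 1))}"

definition adj :: "('a::chilbert_space \<Rightarrow>\<^sub>L 'b::chilbert_space) \<Rightarrow> ('b \<Rightarrow>\<^sub>L 'a)" where
  "adj T = (THE S. S \<in> bounded_ops \<and> (\<forall>x y. cinner (blinfun_apply S x) y = cinner x (blinfun_apply T y)))"

definition unitary :: "('a::chilbert_space \<Rightarrow>\<^sub>L 'b::chilbert_space) \<Rightarrow> bool" where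
  "unitary U \<longleftrightarrow> U \<in> bounded_ops \<and> adj U o\<^sub>L U = id_blinfun \<and> U o\<^sub>L adj U = id_blinfun"

subsection \<open>Existence of adjoints\<close>

lemma cinner_eqI: "(\<And>v. cinner x v = cinner y v) \<Longrightarrow> x = y" for x :: "'a::complex_inner"
  using cinner_eq_zero_iff[of "x - y"] by (simp add: cinner_diff_left)

lemma linear_le_quadratic_zero:
  fixes r k :: real
  assumes "\<And>t. 0 \<le> 2 * t * r + t\<^sup>2 * k" and "0 \<le> k"
  shows "r = 0"
proof (rule ccontr)
  assume "r \<noteq> 0"
  define q where "q = r / (k + 1)"
  have r: "r = q * (k + 1)" using assms(2) by (simp add: q_def)
  have "0 \<le> 2 * (- q) * r + (- q)\<^sup>2 * k" by (rule assms(1))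
  also have "\<dots> = - (q\<^sup>2 * (k + 2))"
    by (simp add: r algebra_simps power2_eq_square)
  finally have "q\<^sup>2 * (k + 2) \<le> 0" by simp
  then have "q = 0"
    using assms(2) by (simp add: mult_le_0_iff)
  then show False
    using \<open>r \<noteq> 0\<close> r by simp
qed

lemma riesz_representation:
  fixes \<phi> :: "'a::chilbert_space \<Rightarrow>\<^sub>L complex"
  assumes clin: "\<And>c x. \<phi> (c *\<^sub>C x) = c * \<phi> x"
  shows "\<exists>z. \<forall>x. \<phi> x = cinner z x"
proof -
  define J where "J x = (norm x)\<^sup>2 - 2 * Re (\<phi> x)" for x
  define m where "m = Inf (range J)"
  have lower: "- (norm \<phi>)\<^sup>2 \<le> J x" for x
  proof -
    have "Re (\<phi> x) \<le> norm \<phi> * norm x"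
      using complex_Re_le_cmod norm_blinfun order_trans by blast
    moreover have "0 \<le> (norm x)\<^sup>2 + (norm \<phi>)\<^sup>2 - 2 * (norm \<phi> * norm x)"
      using zero_le_power2[of "norm x - norm \<phi>"] by (simp add: power2_diff algebra_simps)
    ultimately show ?thesis unfolding J_def by linarith
  qed
  have bdd: "bdd_below (range J)"
    using lower by (intro bdd_belowI[of _ "- (norm \<phi>)\<^sup>2"]) auto
  have m_le: "m \<le> J x" for x
    unfolding m_def by (rule cInf_lower[OF _ bdd]) simp
  have "\<exists>x. J x < m + inverse (real (Suc n))" for n
    using cInf_lessD[of "range J" "m + inverse (real (Suc n))"] by (auto simp: m_def)
  then obtain X where X: "\<And>n. J (X n) < m + inverse (real (Suc n))" by metis
  have para: "(norm (x - y))\<^sup>2 \<le> 2 * (J x - m) + 2 * (J y - m)" for x y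
  proof -
    have "J ((1 / 2) *\<^sub>R (x + y)) = (norm (x + y))\<^sup>2 / 4 - Re (\<phi> x) - Re (\<phi> y)"
      by (simp add: J_def power_mult_distrib power_divide blinfun.scaleR_right blinfun.add_right
          flip: scaleR_add_right) (simp add: algebra_simps power2_eq_square)
    moreover have "(norm (x - y))\<^sup>2 = 2 * (norm x)\<^sup>2 + 2 * (norm y)\<^sup>2 - (norm (x + y))\<^sup>2"
      using norm_add_squared[of x y] norm_add_squared[of x "- y"] by (simp add: cinner_minus_right)
    ultimately show ?thesis
      using m_le[of "(1 / 2) *\<^sub>R (x + y)"] by (simp add: J_def)
  qed
  have "Cauchy X"
  proof (rule CauchyI)
    fix e :: real
    assume "0 < e"
    then obtain N where N: "inverse (real (Suc N)) < e\<^sup>2 / 4"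
      using reals_Archimedean[of "e\<^sup>2 / 4"] by auto
    have small: "J (X n) - m < e\<^sup>2 / 4" if "n \<ge> N" for n
    proof -
      have "inverse (real (Suc n)) \<le> inverse (real (Suc N))"
        using that by (intro le_imp_inverse_le) auto
      then show ?thesis using X[of n] N by linarith
    qed
    have "norm (X i - X j) < e" if "i \<ge> N" "j \<ge> N" for i j
    proof (rule power2_less_imp_less)
      show "(norm (X i - X j))\<^sup>2 < e\<^sup>2"
      proof (rule le_less_trans[OF para])
        have "2 * (J (X i) - m) < 2 * (e\<^sup>2 / 4)" "2 * (J (X j) - m) < 2 * (e\<^sup>2 / 4)"
          using small[OF that(1)] small[OF that(2)] by (simp_all only: mult_less_cancel_left_pos zero_less_numeral)
        from add_strict_mono[OF this] show "2 * (J (X i) - m) + 2 * (J (X j) - m) < e\<^sup>2"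
          by simp
      qed
    qed (use \<open>0 < e\<close> in simp)
    then show "\<exists>N. \<forall>i\<ge>N. \<forall>j\<ge>N. norm (X i - X j) < e" by blast
  qed
  then obtain z where z: "X \<longlonglongrightarrow> z"
    using Cauchy_convergent convergent_def by blast
  have "(\<lambda>n. J (X n)) \<longlonglongrightarrow> J z"
    unfolding J_def by (intro tendsto_intros z)
  moreover have "(\<lambda>n. m + inverse (real (Suc n))) \<longlonglongrightarrow> m + 0"
    by (intro tendsto_intros LIMSEQ_inverse_real_of_nat)
  ultimately have "J z \<le> m + 0"
    by (rule LIMSEQ_le) (use X less_imp_le in blast)
  then have min: "J z \<le> J x" for x
    using m_le[of x] by simp
  have re: "Re (cinner z v - \<phi> v) = 0" for v
  proof (rule linear_le_quadratic_zero)
    fix t :: real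
    have "J (z + t *\<^sub>R v) = J z + 2 * t * Re (cinner z v - \<phi> v) + t\<^sup>2 * (norm v)\<^sup>2"
      using norm_add_squared[of z "t *\<^sub>R v"]
      by (simp add: J_def blinfun.add_right blinfun.scaleR_right scaleR_scaleC cinner_scaleC_right
          norm_scaleC power_mult_distrib clin algebra_simps)
    then show "0 \<le> 2 * t * Re (cinner z v - \<phi> v) + t\<^sup>2 * (norm v)\<^sup>2"
      using min[of "z + t *\<^sub>R v"] by simp
  qed simp
  have "\<phi> v = cinner z v" for v
    using re[of v] re[of "\<i> *\<^sub>C v"]
    by (simp add: clin cinner_scaleC_right complex_eq_iff)
  then show ?thesis by blast
qed

lemma adj_exists:
  fixes T :: "'a::chilbert_space \<Rightarrow>\<^sub>L 'b::chilbert_space"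
  assumes "T \<in> bounded_ops"
  shows "\<exists>!S. S \<in> bounded_ops \<and> (\<forall>x y. cinner (blinfun_apply S x) y = cinner x (blinfun_apply T y))"
proof -
  have "\<exists>z. \<forall>y. cinner z y = cinner x (T y)" for x
  proof -
    define \<phi> where "\<phi> = Blinfun (\<lambda>y. cinner x (T y))"
    have "bounded_linear (\<lambda>y. cinner x (T y))"
      by (rule bounded_linear_compose[OF bounded_linear_cinner_right])
        (rule blinfun.bounded_linear_right)
    then have \<phi>: "\<phi> y = cinner x (T y)" for y
      by (simp add: \<phi>_def bounded_linear_Blinfun_apply)
    have "\<phi> (c *\<^sub>C y) = c * \<phi> y" for c y
      using assms by (simp add: \<phi> bounded_ops_def cinner_scaleC_right)
    then obtain z where "\<forall>y. \<phi> y = cinner z y"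
      using riesz_representation by blast
    then show ?thesis using \<phi> by metis
  qed
  then obtain s where s: "\<And>x y. cinner (s x) y = cinner x (T y)" by metis
  have s_add: "s (x + x') = s x + s x'" for x x'
    by (rule cinner_eqI) (simp add: s cinner_add_left)
  have s_scale: "s (c *\<^sub>C x) = c *\<^sub>C s x" for c x
    by (rule cinner_eqI) (simp add: s cinner_scaleC_left)
  have "bounded_linear s"
  proof (rule bounded_linear_intro)
    show "s (r *\<^sub>R x) = r *\<^sub>R s x" for r x
      by (simp add: scaleR_scaleC s_scale)
    show "norm (s x) \<le> norm x * norm T" for x
    proof (cases "s x = 0")
      case False
      have "(norm (s x))\<^sup>2 = cmod (cinner (s x) (s x))"
        by (simp add: cinner_self norm_power)
      also have "\<dots> = cmod (cinner x (T (s x)))"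
        by (simp only: s)
      also have "\<dots> \<le> norm x * (norm T * norm (s x))"
        by (rule order_trans[OF cinner_Cauchy_Schwarz]) (simp add: mult_left_mono norm_blinfun)
      finally have "norm (s x) * norm (s x) \<le> (norm x * norm T) * norm (s x)"
        by (simp add: power2_eq_square mult.assoc)
      then show ?thesis using False by (simp only: mult_le_cancel_right) simp
    qed simp
  qed (rule s_add)
  then have app: "blinfun_apply (Blinfun s) = s"
    by (rule bounded_linear_Blinfun_apply)
  show ?thesis
  proof (rule ex1I[of _ "Blinfun s"])
    show "Blinfun s \<in> bounded_ops \<and> (\<forall>x y. cinner (Blinfun s x) y = cinner x (T y))"
      by (simp add: bounded_ops_def app s s_scale)
  next
    fix S
    assume S: "S \<in> bounded_ops \<and> (\<forall>x y. cinner (blinfun_apply S x) y = cinner x (T y))"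
    show "S = Blinfun s"
    proof (rule blinfun_eqI)
      show "blinfun_apply S x = Blinfun s x" for x
        by (rule cinner_eqI) (simp add: app s S)
    qed
  qed
qed

lemma
  fixes T :: "'a::chilbert_space \<Rightarrow>\<^sub>L 'b::chilbert_space"
  assumes "T \<in> bounded_ops"
  shows adj_bounded_ops: "adj T \<in> bounded_ops"
    and cinner_adj: "cinner (adj T x) y = cinner x (T y)"
  using theI'[OF adj_exists[OF assms]] by (simp_all add: adj_def)

section \<open>Tensor products of bounded operators and leg numbering\<close>

definition op_tensor ::
  "('a::chilbert_space \<Rightarrow>\<^sub>L 'c::chilbert_space) \<Rightarrow> ('b::chilbert_space \<Rightarrow>\<^sub>L 'd::chilbert_space)
    \<Rightarrow> ('a \<otimes>\<^sub>H 'b \<Rightarrow>\<^sub>L 'c \<otimes>\<^sub>H 'd)" (infixr \<open>\<otimes>\<^sub>o\<close> 70) where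
  "S \<otimes>\<^sub>o T = (THE R. R \<in> bounded_ops \<and> (\<forall>x y. blinfun_apply R (x \<otimes> y) = S x \<otimes> T y))"

definition flip :: "'a::chilbert_space \<otimes>\<^sub>H 'b::chilbert_space \<Rightarrow>\<^sub>L 'b \<otimes>\<^sub>H 'a" where
  "flip = (THE R. R \<in> bounded_ops \<and> (\<forall>x y. blinfun_apply R (x \<otimes> y) = y \<otimes> x))"

definition assoc ::
  "('a::chilbert_space \<otimes>\<^sub>H 'b::chilbert_space) \<otimes>\<^sub>H 'c::chilbert_space \<Rightarrow>\<^sub>L 'a \<otimes>\<^sub>H ('b \<otimes>\<^sub>H 'c)" where
  "assoc = (THE R. R \<in> bounded_ops \<and> (\<forall>x y z. blinfun_apply R ((x \<otimes> y) \<otimes> z) = x \<otimes> (y \<otimes> z)))"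

text \<open>Triple tensor products are bracketed to the left.\<close>

definition leg12 ::
  "('a::chilbert_space \<otimes>\<^sub>H 'b::chilbert_space \<Rightarrow>\<^sub>L 'a \<otimes>\<^sub>H 'b)
    \<Rightarrow> (('a \<otimes>\<^sub>H 'b) \<otimes>\<^sub>H 'c::chilbert_space \<Rightarrow>\<^sub>L ('a \<otimes>\<^sub>H 'b) \<otimes>\<^sub>H 'c)" where
  "leg12 T = T \<otimes>\<^sub>o id_blinfun"

definition leg23 ::
  "('b::chilbert_space \<otimes>\<^sub>H 'c::chilbert_space \<Rightarrow>\<^sub>L 'b \<otimes>\<^sub>H 'c)
    \<Rightarrow> (('a::chilbert_space \<otimes>\<^sub>H 'b) \<otimes>\<^sub>H 'c \<Rightarrow>\<^sub>L ('a \<otimes>\<^sub>H 'b) \<otimes>\<^sub>H 'c)" where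
  "leg23 T = adj assoc o\<^sub>L (id_blinfun \<otimes>\<^sub>o T) o\<^sub>L assoc"

definition leg13 ::
  "('a::chilbert_space \<otimes>\<^sub>H 'c::chilbert_space \<Rightarrow>\<^sub>L 'a \<otimes>\<^sub>H 'c)
    \<Rightarrow> (('a \<otimes>\<^sub>H 'b::chilbert_space) \<otimes>\<^sub>H 'c \<Rightarrow>\<^sub>L ('a \<otimes>\<^sub>H 'b) \<otimes>\<^sub>H 'c)" where
  "leg13 T = (flip \<otimes>\<^sub>o id_blinfun) o\<^sub>L leg23 T o\<^sub>L (flip \<otimes>\<^sub>o id_blinfun)"

subsection \<open>Existence and uniqueness of these operators\<close>

lemma bounded_ops_eq_on_tensors:
  fixes R R' :: "'a::chilbert_space \<otimes>\<^sub>H 'b::chilbert_space \<Rightarrow>\<^sub>L 'c::complex_inner"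
  assumes "R \<in> bounded_ops" "R' \<in> bounded_ops" and eq: "\<And>x y. R (x \<otimes> y) = R' (x \<otimes> y)"
  shows "R = R'"
proof (rule blinfun_eqI)
  fix u
  have sub: "csubspace {u. R u = R' u}"
    using assms(1,2)
    by (intro complex_vector.subspaceI) (auto simp: bounded_ops_def blinfun.add_right)
  have "cspan {x \<otimes> y | x y. True} \<subseteq> {u. R u = R' u}"
    by (rule complex_vector.span_minimal[OF _ sub]) (auto simp: eq)
  moreover have "closed {u. R u = R' u}"
    by (intro closed_Collect_eq continuous_intros)
  ultimately have "closure (cspan {x \<otimes> y | x y. True}) \<subseteq> {u. R u = R' u}"
    by (rule closure_minimal)
  then show "R u = R' u"
    unfolding closure_cspan_tensor by blast
qed

lemma completion_extension:
  fixes g :: "'v::complex_inner \<Rightarrow> 'c::chilbert_space"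
  assumes add: "\<And>u v. g (u + v) = g u + g v" and scale: "\<And>c u. g (c *\<^sub>C u) = c *\<^sub>C g u"
    and bound: "\<And>u. norm (g u) \<le> M * norm u"
  shows "\<exists>T\<in>bounded_ops. \<forall>u. blinfun_apply T (to_completion u) = g u"
proof -
  have normc: "norm (to_completion u) = norm u" for u :: 'v
    by (simp add: norm_completion.rep_eq to_completion.rep_eq norm_dual_embed)
  have diffc: "to_completion (u - v) = to_completion u - to_completion v" for u v :: 'v
    using to_completion_add[of "u - v" v] by simp
  have diffg: "g (u - v) = g u - g v" for u v
    using add[of "u - v" v] by simp
  have "0 \<le> \<bar>M\<bar>" by simp
  have bound': "norm (g u) \<le> (\<bar>M\<bar> + 1) * norm u" for u
    by (rule order_trans[OF bound]) (simp add: mult_right_mono)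
  have inj: "inj (to_completion :: 'v \<Rightarrow> _)"
  proof (rule injI)
    fix u v :: 'v
    assume "to_completion u = to_completion v"
    then show "u = v" using normc[of "u - v"] by (simp add: diffc)
  qed
  define f where "f x = g (inv to_completion x)" for x
  have f: "f (to_completion u) = g u" for u
    by (simp add: f_def inv_f_f[OF inj])
  have "uniformly_continuous_on (range to_completion) f"
    unfolding uniformly_continuous_on_def
  proof (intro allI impI)
    fix e :: real
    assume "0 < e"
    show "\<exists>d>0. \<forall>x\<in>range to_completion. \<forall>x'\<in>range to_completion. dist x' x < d \<longrightarrow> dist (f x') (f x) < e"
    proof (intro exI[of _ "e / (\<bar>M\<bar> + 1)"] conjI ballI impI)
      show "0 < e / (\<bar>M\<bar> + 1)" using \<open>0 < e\<close> by (simp add: add_nonneg_pos)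
      fix x x' :: "'v completion"
      assume "x \<in> range to_completion" "x' \<in> range to_completion"
      then obtain u u' where x: "x = to_completion u" "x' = to_completion u'" by blast
      assume "dist x' x < e / (\<bar>M\<bar> + 1)"
      then have "(\<bar>M\<bar> + 1) * norm (u' - u) < e"
        unfolding x dist_norm diffc [symmetric] normc by (simp add: field_simps)
      then show "dist (f x') (f x) < e"
        using bound'[of "u' - u"] by (simp add: x f dist_norm diffg)
    qed
  qed
  then obtain h where h: "uniformly_continuous_on (closure (range to_completion)) h"
    and hf: "\<And>x. x \<in> range to_completion \<Longrightarrow> f x = h x"
    by (rule uniformly_continuous_on_extension_on_closure) blast
  have cont: "continuous_on UNIV h"
    using uniformly_continuous_imp_continuous[OF h] by (simp add: closure_range_to_completion)
  have hg: "h (to_completion u) = g u" for u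
    using hf[of "to_completion u"] f by simp
  have seq: "\<exists>s. (\<lambda>n. to_completion (s n)) \<longlonglongrightarrow> x \<and> (\<lambda>n. g (s n)) \<longlonglongrightarrow> h x" for x
  proof -
    obtain s where "(\<lambda>n. dual_embed (s n)) \<longlonglongrightarrow> rep_completion x" by (rule completion_seq)
    then have 1: "(\<lambda>n. to_completion (s n)) \<longlonglongrightarrow> x"
      by (simp add: lim_sequentially dist_completion.rep_eq to_completion.rep_eq)
    have "(\<lambda>n. h (to_completion (s n))) \<longlonglongrightarrow> h x"
      by (rule continuous_on_tendsto_compose[OF cont 1]) auto
    with 1 show ?thesis by (auto simp: hg)
  qed
  have uniq: "h x = l" if "(\<lambda>n. to_completion (s n)) \<longlonglongrightarrow> x" "(\<lambda>n. g (s n)) \<longlonglongrightarrow> l" for s x l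
  proof (rule LIMSEQ_unique[OF _ that(2)])
    show "(\<lambda>n. g (s n)) \<longlonglongrightarrow> h x"
      using continuous_on_tendsto_compose[OF cont that(1)] by (simp add: hg)
  qed
  have h_add: "h (x + y) = h x + h y" for x y
  proof -
    obtain s t where "(\<lambda>n. to_completion (s n)) \<longlonglongrightarrow> x" "(\<lambda>n. g (s n)) \<longlonglongrightarrow> h x"
      "(\<lambda>n. to_completion (t n)) \<longlonglongrightarrow> y" "(\<lambda>n. g (t n)) \<longlonglongrightarrow> h y"
      using seq by metis
    then show ?thesis
      by (intro uniq[of "\<lambda>n. s n + t n"]) (simp_all add: to_completion_add add tendsto_add)
  qed
  have h_scale: "h (c *\<^sub>C x) = c *\<^sub>C h x" for c x
  proof -
    obtain s where "(\<lambda>n. to_completion (s n)) \<longlonglongrightarrow> x" "(\<lambda>n. g (s n)) \<longlonglongrightarrow> h x"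
      using seq by metis
    then show ?thesis
      by (intro uniq[of "\<lambda>n. c *\<^sub>C s n"]) (simp_all add: to_completion_scaleC scale tendsto_scaleC)
  qed
  have "bounded_linear h"
  proof (rule bounded_linear_intro)
    show "h (r *\<^sub>R x) = r *\<^sub>R h x" for r x
      by (simp add: scaleR_scaleC h_scale)
    show "norm (h x) \<le> norm x * M" for x
    proof -
      obtain s where s: "(\<lambda>n. to_completion (s n)) \<longlonglongrightarrow> x" "(\<lambda>n. g (s n)) \<longlonglongrightarrow> h x"
        using seq by metis
      show ?thesis
      proof (rule LIMSEQ_le)
        show "(\<lambda>n. norm (g (s n))) \<longlonglongrightarrow> norm (h x)" by (rule tendsto_norm[OF s(2)])
        show "(\<lambda>n. norm (to_completion (s n)) * M) \<longlonglongrightarrow> norm x * M"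
          by (intro tendsto_intros s)
        show "\<exists>N. \<forall>n\<ge>N. norm (g (s n)) \<le> norm (to_completion (s n)) * M"
          using bound by (simp add: normc mult.commute)
      qed
    qed
  qed (rule h_add)
  then have "blinfun_apply (Blinfun h) = h"
    by (rule bounded_linear_Blinfun_apply)
  then show ?thesis
    by (intro bexI[of _ "Blinfun h"]) (simp_all add: bounded_ops_def h_scale hg)
qed

lemma tensor_extension:
  fixes f :: "'a::chilbert_space \<Rightarrow> 'b::chilbert_space \<Rightarrow> 'c::chilbert_space"
  assumes scale: "\<And>c x y. f (c *\<^sub>C x) y = c *\<^sub>C f x y"
    and bound: "\<And>xs. norm (\<Sum>(p, q)\<leftarrow>xs. f p q) \<le> M * sqrt (Re (gram xs xs))"
  shows "\<exists>T\<in>bounded_ops. \<forall>x y. blinfun_apply T (x \<otimes> y) = f x y"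
proof -
  define F where "F xs = (\<Sum>(p, q)\<leftarrow>xs. f p q)" for xs
  define sc where "sc c xs = map (\<lambda>(p, q). (c *\<^sub>C p, q)) xs"
    for c :: complex and xs :: "('a \<times> 'b) list"
  have F_append: "F (xs @ ys) = F xs + F ys" for xs ys
    by (simp add: F_def)
  have F_sc: "F (sc c xs) = c *\<^sub>C F xs" for c xs
    by (induction xs) (auto simp: F_def sc_def scale scaleC_add_right)
  have F_cong: "F xs = F ys" if "tform xs = tform ys" for xs ys
  proof -
    have "tform (xs @ sc (- 1) ys) = tform []"
      unfolding sc_def by (intro ext) (simp only: tform_simps tform_scale that, simp)
    then have "gram (xs @ sc (- 1) ys) (xs @ sc (- 1) ys) = gram [] ([] :: ('a \<times> 'b) list)"
      by (intro gram_cong)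
    then have "F (xs @ sc (- 1) ys) = 0"
      using bound[of "xs @ sc (- 1) ys"] by (simp add: F_def del: gram_simps(3))
    then show ?thesis
      by (simp add: F_append F_sc)
  qed
  define g where "g u = F (rep_atensor u)" for u
  have tform_rep: "tform (rep_atensor u) = tform_atensor u" for u :: "('a, 'b) atensor"
    by (simp add: tform_atensor_def)
  have g_abs: "g u = F xs" if "tform_atensor u = tform xs" for u xs
    unfolding g_def by (rule F_cong) (simp add: tform_rep that)
  have "\<exists>T\<in>bounded_ops. \<forall>u. blinfun_apply T (to_completion u) = g u"
  proof (rule completion_extension)
    show "g (u + v) = g u + g v" for u v
      unfolding g_def[of u] g_def[of v] F_append [symmetric]
      by (rule g_abs) (simp add: fun_eq_iff tform_atensor_simps tform_rep)
    show "g (c *\<^sub>C u) = c *\<^sub>C g u" for c u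
      unfolding g_def[of u] F_sc [symmetric]
      by (rule g_abs) (simp add: fun_eq_iff tform_atensor_simps tform_rep sc_def tform_scale)
    show "norm (g u) \<le> M * norm u" for u
      using bound[of "rep_atensor u"]
      by (simp add: g_def F_def norm_atensor_def gram_atensor_def)
  qed
  moreover have "g (atens x y) = f x y" for x y
    using g_abs[of "atens x y" "[(x, y)]"] by (simp add: F_def tform_atensor.abs_eq atens.abs_eq)
  ultimately show ?thesis
    unfolding tensor_def by metis
qed

lemma gram_isometry:
  fixes f :: "'a::complex_inner \<Rightarrow> 'b::complex_inner \<Rightarrow> 'c::complex_inner"
  assumes "\<And>x y x' y'. cinner (f x y) (f x' y') = cinner x x' * cinner y y'"
  shows "cinner (\<Sum>(p, q)\<leftarrow>xs. f p q) (\<Sum>(p, q)\<leftarrow>ys. f p q) = gram xs ys"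
proof -
  have "cinner (f x y) (\<Sum>(p, q)\<leftarrow>ys. f p q) = tform ys x y" for x y
    by (induction ys) (auto simp: cinner_add_right assms)
  then show ?thesis
    by (induction xs) (auto simp: cinner_add_left)
qed

lemma isometry_extension:
  fixes f :: "'a::chilbert_space \<Rightarrow> 'b::chilbert_space \<Rightarrow> 'c::chilbert_space"
  assumes iso: "\<And>x y x' y'. cinner (f x y) (f x' y') = cinner x x' * cinner y y'"
  shows "\<exists>T\<in>bounded_ops. \<forall>x y. blinfun_apply T (x \<otimes> y) = f x y"
proof (rule tensor_extension)
  show "f (c *\<^sub>C x) y = c *\<^sub>C f x y" for c x y
  proof -
    have "cinner (f (c *\<^sub>C x) y - c *\<^sub>C f x y) (f (c *\<^sub>C x) y - c *\<^sub>C f x y) = 0"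
      by (simp add: cinner_diff_left cinner_diff_right cinner_scaleC_left cinner_scaleC_right iso)
    then show ?thesis by (simp only: cinner_eq_zero_iff right_minus_eq)
  qed
  show "norm (\<Sum>(p, q)\<leftarrow>xs. f p q) \<le> 1 * sqrt (Re (gram xs xs))" for xs
    unfolding gram_isometry[of f, OF iso, symmetric] by (simp add: cinner_self flip: of_real_power)
qed

lemma flip_exists:
  "\<exists>!R::'a::chilbert_space \<otimes>\<^sub>H 'b::chilbert_space \<Rightarrow>\<^sub>L 'b \<otimes>\<^sub>H 'a.
    R \<in> bounded_ops \<and> (\<forall>x y. blinfun_apply R (x \<otimes> y) = y \<otimes> x)"
proof -
  have "\<exists>R\<in>bounded_ops. \<forall>(x::'a) (y::'b). blinfun_apply R (x \<otimes> y) = y \<otimes> x"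
    by (rule isometry_extension) (simp add: cinner_tensor)
  moreover have "R = R'" if "R \<in> bounded_ops \<and> (\<forall>x y. blinfun_apply R (x \<otimes> y) = y \<otimes> x)"
    "R' \<in> bounded_ops \<and> (\<forall>x y. blinfun_apply R' (x \<otimes> y) = y \<otimes> x)" for R R' :: "'a \<otimes>\<^sub>H 'b \<Rightarrow>\<^sub>L 'b \<otimes>\<^sub>H 'a"
    using that by (intro bounded_ops_eq_on_tensors) auto
  ultimately show ?thesis by blast
qed

lemma flip_bounded_ops: "(flip :: 'a::chilbert_space \<otimes>\<^sub>H 'b::chilbert_space \<Rightarrow>\<^sub>L _) \<in> bounded_ops"
  using theI'[OF flip_exists[where 'a = 'a and 'b = 'b]] by (simp add: flip_def)

lemma flip_tensor: "flip (x \<otimes> y) = y \<otimes> x" for x :: "'a::chilbert_space" and y :: "'b::chilbert_space"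
  using theI'[OF flip_exists[where 'a = 'a and 'b = 'b]] by (simp add: flip_def)

lemma norm_tensor: "norm (x \<otimes> y) = norm x * norm y"
proof -
  have "complex_of_real ((norm (x \<otimes> y))\<^sup>2) = complex_of_real ((norm x * norm y)\<^sup>2)"
    by (simp only: cinner_self [symmetric] cinner_tensor power_mult_distrib of_real_mult)
  then have "(norm (x \<otimes> y))\<^sup>2 = (norm x * norm y)\<^sup>2"
    by (simp only: of_real_eq_iff)
  then show ?thesis
    by (rule power2_eq_imp_eq) simp_all
qed

lemma tensor_zero_left: "0 \<otimes> y = 0"
  using norm_tensor[of 0 y] by simp

lemma bounded_linear_tensor_left: "bounded_linear (\<lambda>x. x \<otimes> y)"
  by (rule bounded_linear_intro[of _ "norm y"])
    (simp_all add: tensor_add_left scaleR_scaleC tensor_scaleC_left norm_tensor)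

lemma bounded_ops_eq_on_triple_tensors:
  fixes R R' :: "('a::chilbert_space \<otimes>\<^sub>H 'b::chilbert_space) \<otimes>\<^sub>H 'c::chilbert_space \<Rightarrow>\<^sub>L 'd::complex_inner"
  assumes R: "R \<in> bounded_ops" and R': "R' \<in> bounded_ops"
    and eq: "\<And>x y z. R ((x \<otimes> y) \<otimes> z) = R' ((x \<otimes> y) \<otimes> z)"
  shows "R = R'"
proof (rule bounded_ops_eq_on_tensors[OF R R'])
  fix u :: "'a \<otimes>\<^sub>H 'b" and z :: 'c
  have sub: "csubspace {u. R (u \<otimes> z) = R' (u \<otimes> z)}"
    using R R' by (intro complex_vector.subspaceI)
      (auto simp: bounded_ops_def tensor_add_left tensor_scaleC_left blinfun.add_right
        tensor_zero_left)
  have "cspan {x \<otimes> y | x y. True} \<subseteq> {u. R (u \<otimes> z) = R' (u \<otimes> z)}"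
    by (rule complex_vector.span_minimal[OF _ sub]) (auto simp: eq)
  moreover have "closed {u. R (u \<otimes> z) = R' (u \<otimes> z)}"
    by (intro closed_Collect_eq continuous_intros bounded_linear.continuous_on[OF bounded_linear_tensor_left])
  ultimately have "closure (cspan {x \<otimes> y | x y. True}) \<subseteq> {u. R (u \<otimes> z) = R' (u \<otimes> z)}"
    by (rule closure_minimal)
  then show "R (u \<otimes> z) = R' (u \<otimes> z)"
    unfolding closure_cspan_tensor by blast
qed

lemma assoc_exists:
  "\<exists>!R::('a::chilbert_space \<otimes>\<^sub>H 'b::chilbert_space) \<otimes>\<^sub>H 'c::chilbert_space \<Rightarrow>\<^sub>L 'a \<otimes>\<^sub>H ('b \<otimes>\<^sub>H 'c).
    R \<in> bounded_ops \<and> (\<forall>x y z. blinfun_apply R ((x \<otimes> y) \<otimes> z) = x \<otimes> (y \<otimes> z))"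
proof -
  have dense: "cinner z w = 0"
    if "\<And>x y. cinner (x \<otimes> y) w = 0" for z w :: "'a \<otimes>\<^sub>H 'b"
  proof -
    have "cspan {x \<otimes> y | x y. True} \<subseteq> {v. cinner v w = 0}"
      by (rule complex_vector.span_minimal)
        (auto intro!: complex_vector.subspaceI simp: that cinner_add_left cinner_scaleC_left)
    moreover have "closed {v. cinner v w = 0}"
      by (intro closed_Collect_eq continuous_intros)
    ultimately have "closure (cspan {x \<otimes> y | x y. True}) \<subseteq> {v. cinner v w = 0}"
      by (rule closure_minimal)
    then show ?thesis unfolding closure_cspan_tensor by blast
  qed
  have eqI: "v = w" if "\<And>x y. cinner (x \<otimes> y) v = cinner (x \<otimes> y) w" for v w :: "'a \<otimes>\<^sub>H 'b"
  proof -
    have "cinner (v - w) (v - w) = 0"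
      by (rule dense) (simp add: cinner_diff_right that)
    then show ?thesis by (simp add: cinner_eq_zero_iff)
  qed
  have "\<exists>T\<in>bounded_ops. \<forall>(x :: 'a) (y :: 'b). blinfun_apply T (x \<otimes> y) = x \<otimes> (y \<otimes> z)" for z :: 'c
  proof (rule tensor_extension)
    show "(c *\<^sub>C x) \<otimes> (y \<otimes> z) = c *\<^sub>C (x \<otimes> (y \<otimes> z))" for c and x :: 'a and y :: 'b
      by (rule tensor_scaleC_left)
    show "norm (\<Sum>(p, q)\<leftarrow>xs. p \<otimes> (q \<otimes> z)) \<le> norm z * sqrt (Re (gram xs xs))"
      for xs :: "('a \<times> 'b) list"
    proof -
      define v where "v = (\<Sum>(p, q)\<leftarrow>xs. p \<otimes> (q \<otimes> z))"
      have 1: "cinner (x \<otimes> (y \<otimes> z)) (\<Sum>(p, q)\<leftarrow>ys. p \<otimes> (q \<otimes> z)) = tform ys x y * cinner z z"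
        for x y and ys :: "('a \<times> 'b) list"
        by (induction ys) (auto simp: cinner_add_right cinner_tensor algebra_simps)
      have "cinner (\<Sum>(p, q)\<leftarrow>ys. p \<otimes> (q \<otimes> z)) v = gram ys xs * cinner z z" for ys
        unfolding v_def by (induction ys) (auto simp: cinner_add_left 1 algebra_simps)
      then have "cinner v v = gram xs xs * cinner z z"
        unfolding v_def .
      then have "Re (cinner v v) = Re (gram xs xs) * (norm z)\<^sup>2"
        by (simp add: cinner_self flip: of_real_power)
      then have "(norm v)\<^sup>2 = (norm z * sqrt (Re (gram xs xs)))\<^sup>2"
        using gram_pos[of xs] by (simp add: cinner_self power_mult_distrib flip: of_real_power)
      then have "norm v = norm z * sqrt (Re (gram xs xs))"
        by (rule power2_eq_imp_eq) (simp_all add: gram_pos)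
      then show ?thesis by (simp add: v_def)
    qed
  qed
  then obtain E :: "'c \<Rightarrow> ('a \<otimes>\<^sub>H 'b \<Rightarrow>\<^sub>L 'a \<otimes>\<^sub>H ('b \<otimes>\<^sub>H 'c))"
    where E: "\<And>z. E z \<in> bounded_ops" "\<And>x y z. blinfun_apply (E z) (x \<otimes> y) = x \<otimes> (y \<otimes> z)"
    by metis
  have E_adj: "adj (E z) (E z' u) = cinner z z' *\<^sub>C u" for z z' u
  proof -
    have "adj (E z) (E z' (x' \<otimes> y')) = cinner z z' *\<^sub>C (x' \<otimes> y')" for x' y'
    proof (rule eqI)
      fix x y
      have "cinner (x \<otimes> y) (adj (E z) (E z' (x' \<otimes> y')))
          = cnj (cinner (x' \<otimes> (y' \<otimes> z')) (x \<otimes> (y \<otimes> z)))"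
        by (subst cinner_commute) (simp add: cinner_adj E)
      also have "\<dots> = cinner (x \<otimes> (y \<otimes> z)) (x' \<otimes> (y' \<otimes> z'))"
        by (rule cinner_commute [symmetric])
      finally show "cinner (x \<otimes> y) (adj (E z) (E z' (x' \<otimes> y')))
          = cinner (x \<otimes> y) (cinner z z' *\<^sub>C (x' \<otimes> y'))"
        by (simp add: cinner_tensor cinner_scaleC_right)
    qed
    then have "adj (E z) o\<^sub>L E z' = cinner z z' *\<^sub>C id_blinfun"
      using adj_bounded_ops[OF E(1)] E(1)
      by (intro bounded_ops_eq_on_tensors)
        (auto simp: bounded_ops_def scaleC_blinfun.rep_eq scaleC_scaleC mult.commute)
    then show ?thesis
      by (metis blinfun_apply_blinfun_compose id_blinfun.rep_eq scaleC_blinfun.rep_eq)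
  qed
  have "\<exists>R\<in>bounded_ops. \<forall>u z. blinfun_apply R (u \<otimes> z) = E z u"
  proof (rule isometry_extension)
    fix u u' z z'
    have "cinner (E z u) (E z' u') = cnj (cinner (E z' u') (E z u))"
      by (rule cinner_commute)
    also have "\<dots> = cnj (cinner (adj (E z) (E z' u')) u)"
      by (simp add: cinner_adj E(1))
    also have "\<dots> = cinner u u' * cinner z z'"
      by (simp add: E_adj cinner_scaleC_left) (metis cinner_commute mult.commute)
    finally show "cinner (E z u) (E z' u') = cinner u u' * cinner z z'" .
  qed
  then obtain R :: "('a \<otimes>\<^sub>H 'b) \<otimes>\<^sub>H 'c \<Rightarrow>\<^sub>L 'a \<otimes>\<^sub>H ('b \<otimes>\<^sub>H 'c)"
    where R: "R \<in> bounded_ops" "\<forall>u z. blinfun_apply R (u \<otimes> z) = blinfun_apply (E z) u"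
    by blast
  have R2: "R ((x \<otimes> y) \<otimes> z) = x \<otimes> (y \<otimes> z)" for x y z
    by (simp add: R(2) E(2))
  show ?thesis
  proof (rule ex1I[of _ R])
    show "R \<in> bounded_ops \<and> (\<forall>x y z. blinfun_apply R ((x \<otimes> y) \<otimes> z) = x \<otimes> (y \<otimes> z))"
      using R(1) R2 by simp
  next
    fix R' :: "('a \<otimes>\<^sub>H 'b) \<otimes>\<^sub>H 'c \<Rightarrow>\<^sub>L 'a \<otimes>\<^sub>H ('b \<otimes>\<^sub>H 'c)"
    assume R': "R' \<in> bounded_ops \<and> (\<forall>x y z. blinfun_apply R' ((x \<otimes> y) \<otimes> z) = x \<otimes> (y \<otimes> z))"
    show "R' = R"
      using R(1) R' R2 by (intro bounded_ops_eq_on_triple_tensors) auto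
  qed
qed

lemma assoc_bounded_ops:
  "(assoc :: ('a::chilbert_space \<otimes>\<^sub>H 'b::chilbert_space) \<otimes>\<^sub>H 'c::chilbert_space \<Rightarrow>\<^sub>L _) \<in> bounded_ops"
  using theI'[OF assoc_exists[where 'a = 'a and 'b = 'b and 'c = 'c]] by (simp add: assoc_def)

lemma assoc_tensor: "assoc ((x \<otimes> y) \<otimes> z) = x \<otimes> (y \<otimes> z)"
  for x :: "'a::chilbert_space" and y :: "'b::chilbert_space" and z :: "'c::chilbert_space"
  using theI'[OF assoc_exists[where 'a = 'a and 'b = 'b and 'c = 'c]] by (simp add: assoc_def)

text \<open>For the existence of the tensor product of two operators, both legs are treated
  separately; the orthogonalization above gives the norm estimates.\<close>

lemma tform_map_right:
  assumes "T \<in> bounded_ops"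
  shows "tform (map (\<lambda>(p, q). (p, blinfun_apply T q)) xs) x y = tform xs x (adj T y)"
  by (induction xs) (auto simp: cinner_adj[OF assms])

lemma gram_map_right:
  fixes T :: "'b::chilbert_space \<Rightarrow>\<^sub>L 'd::chilbert_space"
    and xs :: "('a::complex_inner \<times> 'b) list"
  assumes T: "T \<in> bounded_ops"
  defines "f \<equiv> map (\<lambda>(p, q). (p, blinfun_apply T q))"
  shows "Re (gram (f xs) (f xs)) \<le> (norm T)\<^sup>2 * Re (gram xs xs)"
proof -
  obtain ys where ys: "ortho ys" "tform ys = tform xs" using ortho_rep by blast
  have "tform (f ys) = tform (f xs)"
    unfolding f_def by (intro ext) (simp add: tform_map_right[OF T] ys(2))
  then have 1: "gram (f xs) (f xs) = gram (f ys) (f ys)" by (intro gram_cong) simp_all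
  have 2: "gram xs xs = gram ys ys" using ys(2) by (intro gram_cong) simp_all
  have 3: "ortho (f ys)"
  proof -
    have "map fst (f ys) = map fst ys" by (auto simp: f_def)
    then show ?thesis using ys(1) by (simp add: ortho_map_fst)
  qed
  have "(\<Sum>(e, z)\<leftarrow>f ys. (norm e)\<^sup>2 * (norm z)\<^sup>2) \<le> (norm T)\<^sup>2 * (\<Sum>(e, z)\<leftarrow>ys. (norm e)\<^sup>2 * (norm z)\<^sup>2)"
  proof (induction ys)
    case (Cons a ys)
    obtain e z where a: "a = (e, z)" by (cases a)
    have "(norm (T z))\<^sup>2 \<le> (norm T * norm z)\<^sup>2"
      by (rule power_mono[OF norm_blinfun]) simp
    then have "(norm e)\<^sup>2 * (norm (T z))\<^sup>2 \<le> (norm e)\<^sup>2 * (norm T * norm z)\<^sup>2"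
      by (rule mult_left_mono) simp
    with Cons.IH show ?case
      by (simp add: f_def a algebra_simps)
  qed (simp add: f_def)
  then show ?thesis
    by (simp add: 1 2 gram_ortho[OF 3] gram_ortho[OF ys(1)])
qed

lemma gram_swap: "gram (map prod.swap xs) (map prod.swap ys) = gram xs ys"
proof -
  have "tform (map prod.swap ys) q p = tform ys p q" for p q
    by (induction ys) auto
  then show ?thesis
    by (induction xs) auto
qed

lemma gram_map_both:
  fixes S :: "'a::chilbert_space \<Rightarrow>\<^sub>L 'c::chilbert_space"
    and T :: "'b::chilbert_space \<Rightarrow>\<^sub>L 'd::chilbert_space"
  assumes S: "S \<in> bounded_ops" and T: "T \<in> bounded_ops"
  defines "f \<equiv> map (\<lambda>(p, q). (blinfun_apply S p, blinfun_apply T q))"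
  shows "Re (gram (f xs) (f xs)) \<le> (norm S)\<^sup>2 * ((norm T)\<^sup>2 * Re (gram xs xs))"
proof -
  define g where "g = map (\<lambda>(p::'a, q). (p, blinfun_apply T q))"
  define h where "h = map (\<lambda>(q::'d, p). (q, blinfun_apply S p))"
  have fg: "f xs = map prod.swap (h (map prod.swap (g xs)))"
    by (auto simp: f_def g_def h_def)
  have "Re (gram (f xs) (f xs)) = Re (gram (h (map prod.swap (g xs))) (h (map prod.swap (g xs))))"
    unfolding fg gram_swap ..
  also have "\<dots> \<le> (norm S)\<^sup>2 * Re (gram (map prod.swap (g xs)) (map prod.swap (g xs)))"
    unfolding h_def by (rule gram_map_right[OF S])
  also have "\<dots> = (norm S)\<^sup>2 * Re (gram (g xs) (g xs))"
    unfolding gram_swap ..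
  also have "\<dots> \<le> (norm S)\<^sup>2 * ((norm T)\<^sup>2 * Re (gram xs xs))"
    unfolding g_def by (rule mult_left_mono[OF gram_map_right[OF T]]) simp
  finally show ?thesis .
qed

lemma op_tensor_exists:
  fixes S :: "'a::chilbert_space \<Rightarrow>\<^sub>L 'c::chilbert_space"
    and T :: "'b::chilbert_space \<Rightarrow>\<^sub>L 'd::chilbert_space"
  assumes S: "S \<in> bounded_ops" and T: "T \<in> bounded_ops"
  shows "\<exists>!R. R \<in> bounded_ops \<and> (\<forall>x y. blinfun_apply R (x \<otimes> y) = S x \<otimes> T y)"
proof -
  have "\<exists>R\<in>bounded_ops. \<forall>x y. blinfun_apply R (x \<otimes> y) = S x \<otimes> T y"
  proof (rule tensor_extension)
    show "S (c *\<^sub>C x) \<otimes> T y = c *\<^sub>C (S x \<otimes> T y)" for c x y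
      using S by (simp add: bounded_ops_def tensor_scaleC_left)
    show "norm (\<Sum>(p, q)\<leftarrow>xs. S p \<otimes> T q) \<le> norm S * norm T * sqrt (Re (gram xs xs))" for xs
    proof -
      define ys where "ys = map (\<lambda>(p, q). (blinfun_apply S p, blinfun_apply T q)) xs"
      define v where "v = (\<Sum>(p, q)\<leftarrow>ys. p \<otimes> q)"
      have v: "(\<Sum>(p, q)\<leftarrow>xs. S p \<otimes> T q) = v"
        unfolding v_def ys_def by (induction xs) auto
      have "cinner v v = gram ys ys"
        unfolding v_def by (rule gram_isometry) (rule cinner_tensor)
      then have "(norm v)\<^sup>2 = Re (gram ys ys)"
        by (metis Re_complex_of_real cinner_self)
      also have "\<dots> \<le> (norm S)\<^sup>2 * ((norm T)\<^sup>2 * Re (gram xs xs))"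
        unfolding ys_def by (rule gram_map_both[OF S T])
      also have "\<dots> = (norm S * norm T * sqrt (Re (gram xs xs)))\<^sup>2"
        using gram_pos[of xs] by (simp add: power_mult_distrib)
      finally show ?thesis
        unfolding v by (rule power2_le_imp_le) (simp add: gram_pos)
    qed
  qed
  moreover have "R = R'"
    if "R \<in> bounded_ops \<and> (\<forall>x y. blinfun_apply R (x \<otimes> y) = S x \<otimes> T y)"
      "R' \<in> bounded_ops \<and> (\<forall>x y. blinfun_apply R' (x \<otimes> y) = S x \<otimes> T y)" for R R'
    using that by (intro bounded_ops_eq_on_tensors) auto
  ultimately show ?thesis by blast
qed

lemma
  assumes "S \<in> bounded_ops" "T \<in> bounded_ops"
  shows op_tensor_bounded_ops: "S \<otimes>\<^sub>o T \<in> bounded_ops"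
    and op_tensor_tensor: "(S \<otimes>\<^sub>o T) (x \<otimes> y) = S x \<otimes> T y"
  using theI'[OF op_tensor_exists[OF assms]] by (simp_all add: op_tensor_def)

lemma id_bounded_ops [simp]: "id_blinfun \<in> bounded_ops"
  by (simp add: bounded_ops_def)

lemma adj_assoc_tensor: "adj assoc (x \<otimes> (y \<otimes> z)) = (x \<otimes> y) \<otimes> z"
  for x :: "'a::chilbert_space" and y :: "'b::chilbert_space" and z :: "'c::chilbert_space"
proof (rule cinner_eqI)
  define F where "F p = Blinfun (cinner p)" for p :: "('a \<otimes>\<^sub>H 'b) \<otimes>\<^sub>H 'c"
  have F: "F p v = cinner p v" for p v
    by (simp add: F_def bounded_linear_Blinfun_apply[OF bounded_linear_cinner_right])
  have "F (adj assoc (x \<otimes> (y \<otimes> z))) = F ((x \<otimes> y) \<otimes> z)"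
    by (rule bounded_ops_eq_on_triple_tensors)
      (simp_all add: bounded_ops_def F cinner_scaleC_right cinner_adj[OF assoc_bounded_ops]
        assoc_tensor cinner_tensor)
  then show "cinner (adj assoc (x \<otimes> (y \<otimes> z))) v = cinner ((x \<otimes> y) \<otimes> z) v" for v
    by (metis F)
qed

lemma leg12_tensor:
  assumes "S \<in> bounded_ops" "T \<in> bounded_ops"
  shows "leg12 (S \<otimes>\<^sub>o T) ((x \<otimes> y) \<otimes> z) = (S x \<otimes> T y) \<otimes> z"
  using assms by (simp add: leg12_def op_tensor_tensor op_tensor_bounded_ops)

lemma leg23_tensor:
  assumes "S \<in> bounded_ops" "T \<in> bounded_ops"
  shows "leg23 (S \<otimes>\<^sub>o T) ((x \<otimes> y) \<otimes> z) = (x \<otimes> S y) \<otimes> T z"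
  using assms
  by (simp add: leg23_def op_tensor_tensor op_tensor_bounded_ops assoc_tensor adj_assoc_tensor)

lemma leg13_tensor:
  assumes "S \<in> bounded_ops" "T \<in> bounded_ops"
  shows "leg13 (S \<otimes>\<^sub>o T) ((x \<otimes> y) \<otimes> z) = (S x \<otimes> y) \<otimes> T z"
  using assms
  by (simp add: leg13_def op_tensor_tensor flip_bounded_ops flip_tensor leg23_tensor)

section \<open>Unbounded operators\<close>

text \<open>An unbounded operator is identified with its graph, so that equality of operators
  includes equality of domains. The inverse of an injective operator is the converse
  relation, and the product \<open>S T\<close> of operators is \<open>T O S\<close>.\<close>

definition graph_of :: "('a::complex_inner \<Rightarrow>\<^sub>L 'b::complex_inner) \<Rightarrow> ('a \<times> 'b) set" where
  "graph_of T = {(x, T x) | x. True}"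

definition graph_adjoint :: "('a::complex_inner \<times> 'b::complex_inner) set \<Rightarrow> ('b \<times> 'a) set" where
  "graph_adjoint G = {(y, z). \<forall>(x, x') \<in> G. cinner z x = cinner y x'}"

definition selfadjoint :: "('a::complex_inner \<times> 'a) set \<Rightarrow> bool" where
  "selfadjoint G \<longleftrightarrow> csubspace G \<and> single_valued G \<and> closure (Domain G) = UNIV
    \<and> graph_adjoint G = G"

definition positive :: "('a::complex_inner \<times> 'a) set \<Rightarrow> bool" where
  "positive G \<longleftrightarrow> (\<forall>(x, x') \<in> G. cinner x x' \<in> \<real>\<^sub>\<ge>\<^sub>0)"

definition trivial_kernel :: "('a::complex_inner \<times> 'b::complex_inner) set \<Rightarrow> bool" where
  "trivial_kernel G \<longleftrightarrow> (\<forall>x. (x, 0) \<in> G \<longrightarrow> x = 0)"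

text \<open>The tensor product of self-adjoint operators is the closure of their algebraic
  tensor product.\<close>

definition graph_tensor :: "('a::chilbert_space \<times> 'a) set \<Rightarrow> ('b::chilbert_space \<times> 'b) set
    \<Rightarrow> (('a \<otimes>\<^sub>H 'b) \<times> ('a \<otimes>\<^sub>H 'b)) set" where
  "graph_tensor P Q =
    closure (cspan {(x \<otimes> y, x' \<otimes> y') | x x' y y'. (x, x') \<in> P \<and> (y, y') \<in> Q})"

section \<open>Modular multiplicative unitaries\<close>

definition multiplicative_unitary ::
  "('h::chilbert_space \<otimes>\<^sub>H 'h \<Rightarrow>\<^sub>L 'h \<otimes>\<^sub>H 'h) \<Rightarrow> bool" where
  "multiplicative_unitary W \<longleftrightarrow> unitary W \<and>
    leg23 W o\<^sub>L leg12 W = leg12 W o\<^sub>L leg13 W o\<^sub>L leg23 W"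

definition modular_multiplicative_unitary ::
  "('h::chilbert_space \<otimes>\<^sub>H 'h \<Rightarrow>\<^sub>L 'h \<otimes>\<^sub>H 'h) \<Rightarrow> bool" where
  "modular_multiplicative_unitary W \<longleftrightarrow> multiplicative_unitary W \<and>
    (\<exists>(Qh :: ('h \<times> 'h) set) (Q :: ('h \<times> 'h) set)
        (Wt :: 'h conj_space \<otimes>\<^sub>H 'h \<Rightarrow>\<^sub>L 'h conj_space \<otimes>\<^sub>H 'h).
      selfadjoint Qh \<and> positive Qh \<and> trivial_kernel Qh \<and>
      selfadjoint Q \<and> positive Q \<and> trivial_kernel Q \<and>
      unitary Wt \<and>
      graph_of W O graph_tensor Qh Q O graph_of (adj W) = graph_tensor Qh Q \<and>
      (\<forall>x z y Qy u Qinv_u. (y, Qy) \<in> Q \<longrightarrow> (u, Qinv_u) \<in> Q\<inverse> \<longrightarrow>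
        cinner (x \<otimes> y) (W (z \<otimes> u)) = cinner (bar z \<otimes> Qy) (Wt (bar x \<otimes> Qinv_u))))"

section \<open>Representations, spatial tensor products and multiplier algebras\<close>

definition faithful_nondegenerate_rep ::
  "('d::cstar_algebra \<Rightarrow> ('l::chilbert_space \<Rightarrow>\<^sub>L 'l)) \<Rightarrow> bool" where
  "faithful_nondegenerate_rep \<pi> \<longleftrightarrow>
    range \<pi> \<subseteq> bounded_ops \<and>
    (\<forall>x y. \<pi> (x + y) = \<pi> x + \<pi> y) \<and>
    (\<forall>c x. \<pi> (c *\<^sub>C x) = c *\<^sub>C \<pi> x) \<and>
    (\<forall>x y. \<pi> (x * y) = \<pi> x o\<^sub>L \<pi> y) \<and>
    (\<forall>x. \<pi> (star x) = adj (\<pi> x)) \<and>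
    inj \<pi> \<and>
    closure (cspan {\<pi> x \<xi> | x \<xi>. True}) = UNIV"

text \<open>A C*-algebra is represented faithfully and nondegenerately, i.e. as a nondegenerate
  C*-algebra \<open>A\<close> of operators on a Hilbert space. The spatial tensor product is then the closed
  linear span of the elementary tensors on the tensor product of the Hilbert spaces, and the
  multiplier algebra is the idealizer of \<open>A\<close> in the algebra of all bounded operators. Up to
  canonical isomorphism neither depends on the choice of the representation.\<close>

definition spatial_tensor ::
  "('a::chilbert_space \<Rightarrow>\<^sub>L 'a) set \<Rightarrow> ('b::chilbert_space \<Rightarrow>\<^sub>L 'b) set
    \<Rightarrow> ('a \<otimes>\<^sub>H 'b \<Rightarrow>\<^sub>L 'a \<otimes>\<^sub>H 'b) set" where
  "spatial_tensor A B = closure (cspan {S \<otimes>\<^sub>o T | S T. S \<in> A \<and> T \<in> B})"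

definition multiplier_algebra :: "('a::chilbert_space \<Rightarrow>\<^sub>L 'a) set \<Rightarrow> ('a \<Rightarrow>\<^sub>L 'a) set" where
  "multiplier_algebra A = {M \<in> bounded_ops. \<forall>S\<in>A. M o\<^sub>L S \<in> A \<and> S o\<^sub>L M \<in> A}"

end

theory Submission
  imports Defs
begin

text \<open>
  Slicing the second leg of \<open>a\<close> and \<open>b\<close> reduces the statement with coefficients to the case of
  operators \<open>a\<close>, \<open>b\<close> with \<open>W (a \<otimes> 1) = (1 \<otimes> b) W\<close>, and the pentagon equation then gives \<open>a = b\<close>.
  If some \<open>v \<noteq> 0\<close> in the domain of \<open>Q\<close> has \<open>a v\<close> in the domain of \<open>Q\<close>, modularity yields
  \<open>bar (a\<^sup>* z) \<otimes> Q v = bar z \<otimes> Q (a v)\<close> for all \<open>z\<close>, so that \<open>a\<^sup>* z\<close> is a fixed multiple of \<open>z\<close>.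

  In general \<open>a\<close> is first regularized. Put \<open>V = (Q\<^sup>2 - 1) (Q\<^sup>2 + 1)\<^sup>-\<^sup>1\<close> and
  \<open>K = 2 Q (Q\<^sup>2 + 1)\<^sup>-\<^sup>1\<close>, and let \<open>y = (\<Sum>n. V\<^sup>n K a K V\<^sup>n)\<close>, the unique solution of
  \<open>y - V y V = K a K\<close>; formally \<open>Q y Q\<^sup>-\<^sup>1 + Q\<^sup>-\<^sup>1 y Q = 2 a\<close>. Then \<open>y\<close> maps the range of \<open>K\<^sup>2\<close> to the
  domain of \<open>Q\<close>, and \<open>a\<close> is scalar if \<open>y\<close> is. Since \<open>W\<close> commutes with the tensor product \<open>G\<close> of the two
  given selfadjoint operators, uniqueness of the solution of the corresponding equation for \<open>G\<close>
  shows that \<open>W\<close> intertwines the regularizations of \<open>a\<close> as well.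

  The slice of a multiplier maps the range of the representation to its closure, so one also needs
  that injective star homomorphisms of C*-algebras are isometric.
\<close>

section \<open>Bounded operators\<close>

lemma bounded_opsD: "T \<in> bounded_ops \<Longrightarrow> T (c *\<^sub>C x) = c *\<^sub>C T x"
  by (simp add: bounded_ops_def)

lemma bounded_ops_compose [simp]:
  "S \<in> bounded_ops \<Longrightarrow> T \<in> bounded_ops \<Longrightarrow> S o\<^sub>L T \<in> bounded_ops"
  by (simp add: bounded_ops_def)

lemma bounded_ops_add [simp]:
  "S \<in> bounded_ops \<Longrightarrow> T \<in> bounded_ops \<Longrightarrow> S + T \<in> bounded_ops"
  by (simp add: bounded_ops_def plus_blinfun.rep_eq scaleC_add_right)

lemma bounded_ops_diff [simp]:
  "S \<in> bounded_ops \<Longrightarrow> T \<in> bounded_ops \<Longrightarrow> S - T \<in> bounded_ops"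
  by (simp add: bounded_ops_def minus_blinfun.rep_eq complex_vector.scale_right_diff_distrib)

lemma bounded_ops_scaleC [simp]: "T \<in> bounded_ops \<Longrightarrow> c *\<^sub>C T \<in> bounded_ops"
  by (simp add: bounded_ops_def scaleC_blinfun.rep_eq scaleC_scaleC mult.commute)

lemma bounded_ops_scaleR [simp]: "T \<in> bounded_ops \<Longrightarrow> r *\<^sub>R T \<in> bounded_ops"
  unfolding scaleR_scaleC by (rule bounded_ops_scaleC)

lemma bounded_ops_zero [simp]: "0 \<in> bounded_ops"
  by (simp add: bounded_ops_def)

declare op_tensor_bounded_ops [simp] adj_bounded_ops [simp] flip_bounded_ops [simp]
  assoc_bounded_ops [simp]

lemma bounded_ops_Blinfun:
  fixes f :: "'a::complex_inner \<Rightarrow> 'b::complex_inner"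
  assumes "\<And>x y. f (x + y) = f x + f y" and "\<And>c x. f (c *\<^sub>C x) = c *\<^sub>C f x"
    and "\<And>x. norm (f x) \<le> norm x * C"
  shows "Blinfun f \<in> bounded_ops" and "blinfun_apply (Blinfun f) = f"
proof -
  have "bounded_linear f"
    by (rule bounded_linear_intro[of _ C]) (simp_all add: assms scaleR_scaleC)
  then show 1: "blinfun_apply (Blinfun f) = f"
    by (rule bounded_linear_Blinfun_apply)
  show "Blinfun f \<in> bounded_ops"
    by (simp add: bounded_ops_def 1 assms)
qed

lemma cinner_adj_right:
  "T \<in> bounded_ops \<Longrightarrow> cinner x (adj T y) = cinner (T x) y"
  by (metis cinner_adj cinner_commute)

lemma adj_eqI:
  fixes T :: "'a::chilbert_space \<Rightarrow>\<^sub>L 'b::chilbert_space"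
  assumes "T \<in> bounded_ops" and "\<And>x y. cinner (blinfun_apply S x) y = cinner x (T y)"
  shows "adj T = S"
  by (rule blinfun_eqI, rule cinner_eqI) (simp add: cinner_adj assms)

lemma cinner_eqI_right: "(\<And>v. cinner v x = cinner v y) \<Longrightarrow> x = y" for x :: "'a::complex_inner"
  by (rule cinner_eqI) (metis cinner_commute)

lemma norm_le_cinnerI:
  fixes x :: "'a::complex_inner"
  assumes "norm (cinner x x) \<le> C * norm x" "0 \<le> C"
  shows "norm x \<le> C"
proof (cases "x = 0")
  case False
  have "norm (cinner x x) = norm x * norm x"
    by (simp add: cinner_self norm_power power2_eq_square norm_mult)
  then show ?thesis using assms False by simp
qed (use assms in simp)

lemma norm_adj_le: 
  assumes T: "T \<in> bounded_ops" shows "norm (adj T) \<le> norm T"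
proof (rule norm_blinfun_bound)
  fix x
  show "norm (adj T x) \<le> norm T * norm x"
  proof (rule norm_le_cinnerI)
    have "norm (cinner (adj T x) (adj T x)) = norm (cinner x (T (adj T x)))"
      by (simp add: cinner_adj T)
    also have "\<dots> \<le> norm x * (norm T * norm (adj T x))"
      by (rule order_trans[OF cinner_Cauchy_Schwarz]) (simp add: mult_left_mono norm_blinfun)
    finally show "norm (cinner (adj T x) (adj T x)) \<le> norm T * norm x * norm (adj T x)"
      by (simp add: mult_ac)
  qed simp
qed simp

lemma tensor_diff_right: "x \<otimes> (y - y') = x \<otimes> y - x \<otimes> y'"
  using tensor_add_right[of x "y - y'" y'] by simp

lemma tensor_diff_left: "(x - x') \<otimes> y = x \<otimes> y - x' \<otimes> y"
  using tensor_add_left[of "x - x'" x' y] by simp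

text \<open>The functionals \<open>cinner v\<close> and \<open>cinner w\<close> are bounded and
  linear and, by the conjugated assumption, agree on the total set of elementary tensors.\<close>

lemma tensor_cinner_eqI:
  fixes v w :: "'a::chilbert_space \<otimes>\<^sub>H 'b::chilbert_space"
  assumes "\<And>x y. cinner (x \<otimes> y) v = cinner (x \<otimes> y) w"
  shows "v = w"
proof -
  define F where "F p = Blinfun (cinner p)" for p :: "'a \<otimes>\<^sub>H 'b"
  have F: "F p v = cinner p v" for p v
    by (simp add: F_def bounded_linear_Blinfun_apply[OF bounded_linear_cinner_right])
  have "F v = F w"
    by (rule bounded_ops_eq_on_tensors)
      (simp_all add: bounded_ops_def F cinner_scaleC_right, metis assms cinner_commute)
  then show ?thesis by (metis F cinner_eqI)
qed

lemma op_tensor_compose: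
  assumes "S \<in> bounded_ops" "T \<in> bounded_ops" "S' \<in> bounded_ops" "T' \<in> bounded_ops"
  shows "(S \<otimes>\<^sub>o T) o\<^sub>L (S' \<otimes>\<^sub>o T') = (S o\<^sub>L S') \<otimes>\<^sub>o (T o\<^sub>L T')"
  by (rule bounded_ops_eq_on_tensors) (simp_all add: assms op_tensor_tensor)

lemma adj_op_tensor:
  assumes "S \<in> bounded_ops" "T \<in> bounded_ops"
  shows "adj (S \<otimes>\<^sub>o T) = adj S \<otimes>\<^sub>o adj T"
proof (rule bounded_ops_eq_on_tensors)
  show "adj (S \<otimes>\<^sub>o T) (x \<otimes> y) = (adj S \<otimes>\<^sub>o adj T) (x \<otimes> y)" for x y
    by (rule tensor_cinner_eqI)
      (simp add: cinner_adj_right assms op_tensor_tensor cinner_tensor)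
qed (simp_all add: assms)

lemma adj_id [simp]: "adj id_blinfun = id_blinfun"
  by (rule adj_eqI) simp_all

subsection \<open>Slices\<close>

text \<open>The adjoints of the following operators are the slice maps.\<close>

definition tensor_r :: "'b::chilbert_space \<Rightarrow> ('a::chilbert_space \<Rightarrow>\<^sub>L 'a \<otimes>\<^sub>H 'b)" where
  "tensor_r q = Blinfun (\<lambda>x. x \<otimes> q)"

definition tensor_l :: "'a::chilbert_space \<Rightarrow> ('b::chilbert_space \<Rightarrow>\<^sub>L 'a \<otimes>\<^sub>H 'b)" where
  "tensor_l p = Blinfun (\<lambda>y. p \<otimes> y)"

lemma tensor_r:
  fixes q :: "'b::chilbert_space" and x :: "'a::chilbert_space"
  shows tensor_r_bounded_ops [simp]: "(tensor_r q :: 'a \<Rightarrow>\<^sub>L 'a \<otimes>\<^sub>H 'b) \<in> bounded_ops"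
    and tensor_r_apply [simp]: "tensor_r q x = x \<otimes> q"
  using bounded_ops_Blinfun[of "\<lambda>x::'a. x \<otimes> q" "norm q"]
  by (simp_all add: tensor_r_def tensor_add_left tensor_scaleC_left norm_tensor)

lemma tensor_l:
  fixes p :: "'a::chilbert_space" and y :: "'b::chilbert_space"
  shows tensor_l_bounded_ops [simp]: "(tensor_l p :: 'b \<Rightarrow>\<^sub>L 'a \<otimes>\<^sub>H 'b) \<in> bounded_ops"
    and tensor_l_apply [simp]: "tensor_l p y = p \<otimes> y"
  using bounded_ops_Blinfun[of "\<lambda>y::'b. p \<otimes> y" "norm p"]
  by (simp_all add: tensor_l_def tensor_add_right tensor_scaleC_right norm_tensor mult.commute)

text \<open>Adjoint form of \<open>(adj S \<otimes>\<^sub>o id_blinfun) (x \<otimes> q) = adj S x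
  \<otimes> q\<close>.\<close>

lemma slice_r_op_tensor:
  assumes "S \<in> bounded_ops"
  shows "adj (tensor_r q) ((S \<otimes>\<^sub>o id_blinfun) z) = S (adj (tensor_r q) z)"
  by (rule cinner_eqI_right)
    (simp add: cinner_adj_right op_tensor_tensor adj_op_tensor assms
      flip: cinner_adj[OF assms] cinner_adj[OF op_tensor_bounded_ops[OF assms id_bounded_ops]])

lemma slice_l_op_tensor:
  assumes "T \<in> bounded_ops"
  shows "adj (tensor_l p) ((id_blinfun \<otimes>\<^sub>o T) z) = T (adj (tensor_l p) z)"
  by (rule cinner_eqI_right)
    (simp add: cinner_adj_right op_tensor_tensor adj_op_tensor assms
      flip: cinner_adj[OF assms] cinner_adj[OF op_tensor_bounded_ops[OF id_bounded_ops assms]])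

lemma slice_r_eq_0:
  fixes z :: "'a::chilbert_space \<otimes>\<^sub>H 'b::chilbert_space"
  assumes "\<And>q :: 'b. adj (tensor_r q) z = 0"
  shows "z = 0"
proof (rule tensor_cinner_eqI)
  show "cinner (x \<otimes> y) z = cinner (x \<otimes> y) 0" for x y
    using cinner_adj_right[of "tensor_r y" x z] by (simp add: assms)
qed

lemma slice_l_eq_0:
  fixes z :: "'a::chilbert_space \<otimes>\<^sub>H 'b::chilbert_space"
  assumes "\<And>p :: 'a. adj (tensor_l p) z = 0"
  shows "z = 0"
proof (rule tensor_cinner_eqI)
  show "cinner (x \<otimes> y) z = cinner (x \<otimes> y) 0" for x y
    using cinner_adj_right[of "tensor_l x" y z] by (simp add: assms)
qed

text \<open>In the factorization \<open>(S \<otimes> 1) (1 \<otimes> T)\<close> each factor passes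
  through the slices that remove the other leg, and a vector with vanishing slices is zero.\<close>

lemma op_tensor_injective:
  fixes S :: "'a::chilbert_space \<Rightarrow>\<^sub>L 'c::chilbert_space"
    and T :: "'b::chilbert_space \<Rightarrow>\<^sub>L 'd::chilbert_space"
  assumes b: "S \<in> bounded_ops" "T \<in> bounded_ops"
    and S: "\<And>x. S x = 0 \<Longrightarrow> x = 0" and T: "\<And>x. T x = 0 \<Longrightarrow> x = 0"
    and z: "(S \<otimes>\<^sub>o T) z = 0"
  shows "z = 0"
proof -
  have "(S \<otimes>\<^sub>o T) = (S \<otimes>\<^sub>o id_blinfun) o\<^sub>L (id_blinfun \<otimes>\<^sub>o T)"
    by (rule bounded_ops_eq_on_tensors) (simp_all add: b op_tensor_tensor)
  then have z': "(S \<otimes>\<^sub>o id_blinfun) ((id_blinfun \<otimes>\<^sub>o T) z) = 0"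
    using z by simp
  have "(id_blinfun \<otimes>\<^sub>o T) z = 0"
  proof (rule slice_r_eq_0)
    fix q
    have "S (adj (tensor_r q) ((id_blinfun \<otimes>\<^sub>o T) z)) = adj (tensor_r q) 0"
      by (metis slice_r_op_tensor[OF b(1)] z')
    then show "adj (tensor_r q) ((id_blinfun \<otimes>\<^sub>o T) z) = 0"
      by (intro S) simp
  qed
  show ?thesis
  proof (rule slice_l_eq_0)
    fix p
    have "T (adj (tensor_l p) z) = adj (tensor_l p) 0"
      by (metis slice_l_op_tensor[OF b(2)] \<open>(id_blinfun \<otimes>\<^sub>o T) z = 0\<close>)
    then show "adj (tensor_l p) z = 0"
      by (intro T) simp
  qed
qed

subsection \<open>Leg numbering\<close>

lemma bounded_ops_eq_on_triple_tensors_right: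
  fixes R R' :: "'a::chilbert_space \<otimes>\<^sub>H 'b::chilbert_space \<otimes>\<^sub>H 'c::chilbert_space \<Rightarrow>\<^sub>L 'd::complex_inner"
  assumes R: "R \<in> bounded_ops" and R': "R' \<in> bounded_ops"
    and eq: "\<And>x y z. R (x \<otimes> y \<otimes> z) = R' (x \<otimes> y \<otimes> z)"
  shows "R = R'"
proof (rule bounded_ops_eq_on_tensors[OF R R'])
  fix x :: 'a and w :: "'b \<otimes>\<^sub>H 'c"
  have "R o\<^sub>L tensor_l x = R' o\<^sub>L tensor_l x"
    by (rule bounded_ops_eq_on_tensors) (simp_all add: R R' eq)
  then have "(R o\<^sub>L tensor_l x) w = (R' o\<^sub>L tensor_l x) w" by simp
  then show "R (x \<otimes> w) = R' (x \<otimes> w)" by simp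
qed

lemma leg_bounded_ops [simp]:
  "T \<in> bounded_ops \<Longrightarrow> leg12 T \<in> bounded_ops"
  "T \<in> bounded_ops \<Longrightarrow> leg23 T \<in> bounded_ops"
  "T \<in> bounded_ops \<Longrightarrow> leg13 T \<in> bounded_ops"
  by (simp_all add: leg12_def leg13_def leg23_def)

lemma assoc_adj_assoc [simp]:
  fixes z :: "'a::chilbert_space \<otimes>\<^sub>H 'b::chilbert_space \<otimes>\<^sub>H 'c::chilbert_space"
  shows "assoc (adj assoc z) = z"
proof -
  have "assoc o\<^sub>L adj assoc = (id_blinfun :: _ \<Rightarrow>\<^sub>L 'a \<otimes>\<^sub>H 'b \<otimes>\<^sub>H 'c)"
    by (rule bounded_ops_eq_on_triple_tensors_right) (simp_all add: adj_assoc_tensor assoc_tensor)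
  then have "(assoc o\<^sub>L adj assoc) z = id_blinfun z" by simp
  then show ?thesis by simp
qed

lemma flip_flip [simp]:
  fixes z :: "('a::chilbert_space \<otimes>\<^sub>H 'b::chilbert_space) \<otimes>\<^sub>H 'c::chilbert_space"
  shows "(flip \<otimes>\<^sub>o id_blinfun) ((flip \<otimes>\<^sub>o id_blinfun) z) = z"
proof -
  have "(flip \<otimes>\<^sub>o id_blinfun) o\<^sub>L (flip \<otimes>\<^sub>o id_blinfun) = (id_blinfun :: _ \<Rightarrow>\<^sub>L ('a \<otimes>\<^sub>H 'b) \<otimes>\<^sub>H 'c)"
    by (rule bounded_ops_eq_on_triple_tensors) (simp_all add: op_tensor_tensor flip_tensor)
  then have "((flip \<otimes>\<^sub>o id_blinfun) o\<^sub>L (flip \<otimes>\<^sub>o id_blinfun)) z = id_blinfun z" by simp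
  then show ?thesis by simp
qed

lemma blinfun_compose_ident [simp]:
  "id_blinfun o\<^sub>L T = T" "T o\<^sub>L id_blinfun = T"
  by (rule blinfun_eqI, simp)+

lemma blinfun_compose_assoc: "(R o\<^sub>L S) o\<^sub>L T = R o\<^sub>L (S o\<^sub>L T)"
  by (rule blinfun_eqI) simp

lemma op_tensor_compose_apply:
  assumes "S \<in> bounded_ops" "T \<in> bounded_ops" "S' \<in> bounded_ops" "T' \<in> bounded_ops"
  shows "(S \<otimes>\<^sub>o T) ((S' \<otimes>\<^sub>o T') z) = ((S o\<^sub>L S') \<otimes>\<^sub>o (T o\<^sub>L T')) z"
  using op_tensor_compose[OF assms] by (metis blinfun_apply_blinfun_compose)

lemma leg_compose:
  assumes "S \<in> bounded_ops" "T \<in> bounded_ops"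
  shows "leg12 S o\<^sub>L leg12 T = leg12 (S o\<^sub>L T)"
    and "leg23 S o\<^sub>L leg23 T = leg23 (S o\<^sub>L T)"
    and "leg13 S o\<^sub>L leg13 T = leg13 (S o\<^sub>L T)"
  by (rule blinfun_eqI;
      simp add: leg12_def leg13_def leg23_def assms op_tensor_compose_apply)+

lemma leg_id [simp]: "leg12 id_blinfun = id_blinfun" "leg23 id_blinfun = id_blinfun"
  by (rule bounded_ops_eq_on_triple_tensors;
      simp add: leg12_def leg23_def op_tensor_tensor assoc_tensor adj_assoc_tensor)+

text \<open>An operator on a single leg arises from several two-leg embeddings; these
  identifications serve the pentagon computation.\<close>

lemma leg12_leg13_eq:
  fixes S T :: "'a::chilbert_space \<Rightarrow>\<^sub>L 'a"
  assumes S: "S \<in> bounded_ops"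
  shows "leg13 (S \<otimes>\<^sub>o id_blinfun) = leg12 (S \<otimes>\<^sub>o id_blinfun)"
    and "leg12 (id_blinfun \<otimes>\<^sub>o S) = leg23 (S \<otimes>\<^sub>o id_blinfun)"
    and "leg13 (id_blinfun \<otimes>\<^sub>o S) = leg23 (id_blinfun \<otimes>\<^sub>o S)"
    and "leg23 (id_blinfun \<otimes>\<^sub>o S) = id_blinfun \<otimes>\<^sub>o S"
  by (rule bounded_ops_eq_on_triple_tensors;
      simp add: S leg12_tensor leg13_tensor leg23_tensor op_tensor_tensor)+

text \<open>After rebracketing by \<open>assoc\<close>, the two operators act on different tensor
  factors.\<close>

lemma leg12_leg23_commute:
  assumes S: "S \<in> bounded_ops" and T: "T \<in> bounded_ops"
  shows "leg12 (S \<otimes>\<^sub>o id_blinfun) o\<^sub>L leg23 T = leg23 T o\<^sub>L leg12 (S \<otimes>\<^sub>o id_blinfun)"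
proof -
  have 1: "assoc o\<^sub>L leg12 (S \<otimes>\<^sub>o id_blinfun) = (S \<otimes>\<^sub>o id_blinfun) o\<^sub>L assoc"
    by (rule bounded_ops_eq_on_triple_tensors)
      (simp_all add: S leg12_tensor assoc_tensor op_tensor_tensor)
  have 2: "adj assoc o\<^sub>L (S \<otimes>\<^sub>o id_blinfun) = leg12 (S \<otimes>\<^sub>o id_blinfun) o\<^sub>L adj assoc"
    by (rule bounded_ops_eq_on_triple_tensors_right)
      (simp_all add: S leg12_tensor adj_assoc_tensor op_tensor_tensor)
  have 3: "(id_blinfun \<otimes>\<^sub>o T) o\<^sub>L (S \<otimes>\<^sub>o id_blinfun) = (S \<otimes>\<^sub>o id_blinfun) o\<^sub>L (id_blinfun \<otimes>\<^sub>o T)"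
    by (simp add: S T op_tensor_compose)
  have "leg23 T o\<^sub>L leg12 (S \<otimes>\<^sub>o id_blinfun)
      = adj assoc o\<^sub>L ((id_blinfun \<otimes>\<^sub>o T) o\<^sub>L (assoc o\<^sub>L leg12 (S \<otimes>\<^sub>o id_blinfun)))"
    by (simp add: leg23_def blinfun_compose_assoc)
  also have "\<dots> = (adj assoc o\<^sub>L ((id_blinfun \<otimes>\<^sub>o T) o\<^sub>L (S \<otimes>\<^sub>o id_blinfun))) o\<^sub>L assoc"
    by (simp add: 1 blinfun_compose_assoc)
  also have "\<dots> = ((adj assoc o\<^sub>L (S \<otimes>\<^sub>o id_blinfun)) o\<^sub>L (id_blinfun \<otimes>\<^sub>o T)) o\<^sub>L assoc"
    by (simp add: 3 blinfun_compose_assoc)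
  also have "\<dots> = leg12 (S \<otimes>\<^sub>o id_blinfun) o\<^sub>L leg23 T"
    by (simp add: 2 leg23_def blinfun_compose_assoc)
  finally show ?thesis ..
qed

lemma adj_flip: "adj flip = (flip :: 'a::chilbert_space \<otimes>\<^sub>H 'b::chilbert_space \<Rightarrow>\<^sub>L _)"
proof (rule bounded_ops_eq_on_tensors)
  show "adj flip (x \<otimes> y) = flip (x \<otimes> y)" for x :: 'a and y :: 'b
    by (rule tensor_cinner_eqI) (simp add: cinner_adj_right flip_tensor cinner_tensor)
qed simp_all

text \<open>Slicing the third leg reduces relations on three legs to relations on two; the identity
  is checked on matrix coefficients.\<close>

lemma slice_leg23:
  fixes b :: "'b::chilbert_space \<otimes>\<^sub>H 'c::chilbert_space \<Rightarrow>\<^sub>L 'b \<otimes>\<^sub>H 'c"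
  assumes b: "b \<in> bounded_ops"
  shows "adj (tensor_r p) o\<^sub>L leg23 b o\<^sub>L tensor_r q
    = (id_blinfun :: 'a::chilbert_space \<Rightarrow>\<^sub>L 'a) \<otimes>\<^sub>o (adj (tensor_r p) o\<^sub>L b o\<^sub>L tensor_r q)"
proof (rule bounded_ops_eq_on_tensors)
  fix z :: 'a and u :: 'b
  show "(adj (tensor_r p) o\<^sub>L leg23 b o\<^sub>L tensor_r q) (z \<otimes> u)
      = (id_blinfun \<otimes>\<^sub>o (adj (tensor_r p) o\<^sub>L b o\<^sub>L tensor_r q)) (z \<otimes> u)"
    by (rule tensor_cinner_eqI)
      (simp add: b cinner_adj_right leg23_def assoc_tensor op_tensor_tensor cinner_tensor)
qed (simp_all add: b)

lemma slice_leg13: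
  fixes a :: "'a::chilbert_space \<otimes>\<^sub>H 'c::chilbert_space \<Rightarrow>\<^sub>L 'a \<otimes>\<^sub>H 'c"
  assumes a: "a \<in> bounded_ops"
  shows "adj (tensor_r p) o\<^sub>L leg13 a o\<^sub>L tensor_r q
    = (adj (tensor_r p) o\<^sub>L a o\<^sub>L tensor_r q) \<otimes>\<^sub>o (id_blinfun :: 'b::chilbert_space \<Rightarrow>\<^sub>L 'b)"
proof (rule bounded_ops_eq_on_tensors)
  fix z :: 'a and u :: 'b
  \<comment> \<open>The flip is selfadjoint, so the outer flip in \<open>leg13\<close> can be moved
    to the test vector.\<close>
  have fl: "cinner v ((flip \<otimes>\<^sub>o id_blinfun) w) = cinner ((flip \<otimes>\<^sub>o id_blinfun) v) w"
    for v :: "('a \<otimes>\<^sub>H 'b) \<otimes>\<^sub>H 'c" and w :: "('b \<otimes>\<^sub>H 'a) \<otimes>\<^sub>H 'c"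
  proof -
    have "adj (flip \<otimes>\<^sub>o id_blinfun) = ((flip :: 'a \<otimes>\<^sub>H 'b \<Rightarrow>\<^sub>L _) \<otimes>\<^sub>o (id_blinfun :: 'c \<Rightarrow>\<^sub>L _))"
      by (simp add: adj_op_tensor adj_flip)
    then show ?thesis
      using cinner_adj[of "(flip :: 'b \<otimes>\<^sub>H 'a \<Rightarrow>\<^sub>L _) \<otimes>\<^sub>o (id_blinfun :: 'c \<Rightarrow>\<^sub>L _)" v w] by simp
  qed
  show "(adj (tensor_r p) o\<^sub>L leg13 a o\<^sub>L tensor_r q) (z \<otimes> u)
      = ((adj (tensor_r p) o\<^sub>L a o\<^sub>L tensor_r q) \<otimes>\<^sub>o id_blinfun) (z \<otimes> u)"
    by (rule tensor_cinner_eqI)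
      (simp add: a cinner_adj_right leg13_def leg23_def assoc_tensor op_tensor_tensor cinner_tensor
        fl flip_tensor)
qed (simp_all add: a)

section \<open>Multiplicative unitaries\<close>

lemma
  assumes "unitary U"
  shows unitary_bounded_ops: "U \<in> bounded_ops"
    and unitary_adj_apply: "adj U (U x) = x" "U (adj U y) = y"
proof -
  show "U \<in> bounded_ops" using assms by (simp add: unitary_def)
  have "adj U o\<^sub>L U = id_blinfun" "U o\<^sub>L adj U = id_blinfun"
    using assms by (simp_all add: unitary_def)
  then have "(adj U o\<^sub>L U) x = x" "(U o\<^sub>L adj U) y = y"
    by (simp_all only: id_blinfun.rep_eq)
  then show "adj U (U x) = x" "U (adj U y) = y"
    by simp_all
qed

text \<open>With digits for legs, the pentagon gives \<open>W23 b2 W12 = W23 W12 a1 = W12 W13 W23 a1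
  = b3 W12 W13 W23 = b3 W23 W12 = W23 a2 W12\<close>. Cancelling the unitaries leaves
  \<open>b2 = a2\<close>.\<close>

lemma pentagon_intertwiner_eq:
  fixes W :: "'h::chilbert_space \<otimes>\<^sub>H 'h \<Rightarrow>\<^sub>L 'h \<otimes>\<^sub>H 'h"
  assumes mu: "multiplicative_unitary W" and a: "a \<in> bounded_ops" and b: "b \<in> bounded_ops"
    and ab: "W o\<^sub>L (a \<otimes>\<^sub>o id_blinfun) = (id_blinfun \<otimes>\<^sub>o b) o\<^sub>L W"
  shows "a = b"
proof -
  have U: "unitary W"
    and pent: "leg23 W o\<^sub>L leg12 W = leg12 W o\<^sub>L leg13 W o\<^sub>L leg23 W"
    using mu by (simp_all add: multiplicative_unitary_def)
  note W = unitary_bounded_ops[OF U]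
  define W12 W13 W23 :: "('h \<otimes>\<^sub>H 'h) \<otimes>\<^sub>H 'h \<Rightarrow>\<^sub>L ('h \<otimes>\<^sub>H 'h) \<otimes>\<^sub>H 'h"
    where "W12 = leg12 W" and "W13 = leg13 W" and "W23 = leg23 W"
  define a1 a2 b2 b3 :: "('h \<otimes>\<^sub>H 'h) \<otimes>\<^sub>H 'h \<Rightarrow>\<^sub>L ('h \<otimes>\<^sub>H 'h) \<otimes>\<^sub>H 'h"
    where "a1 = leg12 (a \<otimes>\<^sub>o id_blinfun)" and "a2 = leg12 (id_blinfun \<otimes>\<^sub>o a)"
      and "b2 = leg12 (id_blinfun \<otimes>\<^sub>o b)" and "b3 = leg23 (id_blinfun \<otimes>\<^sub>o b)"
  note defs = W12_def W13_def W23_def a1_def a2_def b2_def b3_def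
  have 1: "W12 o\<^sub>L a1 = b2 o\<^sub>L W12"
    by (simp add: defs leg_compose a b W ab)
  have 2: "W13 o\<^sub>L a1 = b3 o\<^sub>L W13"
    unfolding defs leg12_leg13_eq(1)[OF a, symmetric] leg12_leg13_eq(3)[OF b, symmetric]
    by (simp add: leg_compose a b W ab)
  have 3: "W23 o\<^sub>L a2 = b3 o\<^sub>L W23"
    unfolding defs leg12_leg13_eq(2)[OF a]
    by (simp add: leg_compose a b W ab)
  have 4: "a1 o\<^sub>L W23 = W23 o\<^sub>L a1"
    unfolding defs by (rule leg12_leg23_commute) (simp_all add: a W)
  have 5: "b3 o\<^sub>L W12 = W12 o\<^sub>L b3"
    unfolding defs leg12_leg13_eq(4)[OF b] leg12_def by (simp add: op_tensor_compose b W)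
  have pent': "W23 o\<^sub>L W12 = W12 o\<^sub>L W13 o\<^sub>L W23"
    using pent by (simp add: defs)
  have "(W23 o\<^sub>L b2) o\<^sub>L W12 = (W23 o\<^sub>L W12) o\<^sub>L a1"
    by (simp add: blinfun_compose_assoc 1)
  also have "\<dots> = W12 o\<^sub>L (W13 o\<^sub>L a1) o\<^sub>L W23"
    unfolding pent' by (simp add: blinfun_compose_assoc 4)
  also have "\<dots> = (b3 o\<^sub>L W12) o\<^sub>L W13 o\<^sub>L W23"
    unfolding 2 5 by (simp add: blinfun_compose_assoc)
  also have "\<dots> = (b3 o\<^sub>L W23) o\<^sub>L W12"
    using pent' by (simp add: blinfun_compose_assoc)
  finally have "((W23 o\<^sub>L b2) o\<^sub>L W12) o\<^sub>L leg12 (adj W) = ((W23 o\<^sub>L a2) o\<^sub>L W12) o\<^sub>L leg12 (adj W)"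
    by (simp add: 3)
  moreover have "W12 o\<^sub>L leg12 (adj W) = id_blinfun"
    using U by (simp add: defs leg_compose W unitary_def)
  ultimately have "leg23 (adj W) o\<^sub>L (W23 o\<^sub>L b2) = leg23 (adj W) o\<^sub>L (W23 o\<^sub>L a2)"
    by (simp add: blinfun_compose_assoc)
  moreover have "leg23 (adj W) o\<^sub>L W23 = id_blinfun"
    using U by (simp add: defs leg_compose W unitary_def)
  ultimately have "b2 = a2"
    by (simp flip: blinfun_compose_assoc)
  show ?thesis
  proof (rule blinfun_eqI)
    fix x
    show "a x = b x"
    proof (cases "x = 0")
      case False
      \<comment> \<open>The nonzero vector \<open>x\<close> also fills the idle legs 1 and 3, so the
        middle legs can be compared.\<close>
      have "(x \<otimes> a x) \<otimes> x = (x \<otimes> b x) \<otimes> x"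
        using arg_cong[OF \<open>b2 = a2\<close>, of "\<lambda>T. T ((x \<otimes> x) \<otimes> x)"]
        by (simp add: defs leg12_tensor a b)
      then have "cinner (x \<otimes> (a x - b x)) (x \<otimes> (a x - b x)) * cinner x x = 0"
        unfolding cinner_tensor[symmetric] by (simp add: tensor_diff_right tensor_diff_left)
      then show ?thesis
        using False by (simp add: cinner_tensor cinner_eq_zero_iff)
    qed (simp add: blinfun.zero_right)
  qed
qed

section \<open>Orthogonal projections and closed graphs\<close>

text \<open>A closed graph thereby becomes a closed subspace of a Hilbert space, onto which one can
  project.\<close>

instantiation prod :: (complex_inner, complex_inner) complex_inner
begin

definition cinner_prod_def:
  "cinner p q = cinner (fst p) (fst q) + cinner (snd p) (snd q)" for p q :: "'a \<times> 'b"

instance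
proof
  fix x y z :: "'a \<times> 'b" and c :: complex
  show "cinner x y = cnj (cinner y x)"
    unfolding cinner_prod_def complex_cnj_add by (simp flip: cinner_commute)
  show "cinner x (y + z) = cinner x y + cinner x z"
    by (simp add: cinner_prod_def cinner_add_right)
  show "cinner x (c *\<^sub>C y) = c * cinner x y"
    by (simp add: cinner_prod_def scaleC_prod_def cinner_scaleC_right distrib_left)
  show "cinner x x = complex_of_real ((norm x)\<^sup>2)"
    by (simp add: cinner_prod_def norm_prod_def cinner_self)
qed

end

instance prod :: (chilbert_space, chilbert_space) chilbert_space ..

text \<open>A minimizing sequence for the distance to \<open>x\<close> is Cauchy by the
  parallelogram law; the first variation at its limit gives orthogonality.\<close>

lemma orthogonal_projection:
  fixes M :: "'a::chilbert_space set"
  assumes M: "csubspace M" "closed M"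
  shows "\<exists>p\<in>M. \<forall>m\<in>M. cinner m (x - p) = 0"
proof -
  define J where "J m = (norm (x - m))\<^sup>2" for m
  define d where "d = Inf (J ` M)"
  have ne: "0 \<in> M" by (rule complex_vector.subspace_0[OF M(1)])
  have bdd: "bdd_below (J ` M)"
    by (intro bdd_belowI[of _ 0]) (auto simp: J_def)
  have d_le: "d \<le> J m" if "m \<in> M" for m
    unfolding d_def by (rule cInf_lower[OF _ bdd]) (use that in simp)
  have "\<exists>m\<in>M. J m < d + inverse (real (Suc n))" for n
    using cInf_lessD[of "J ` M" "d + inverse (real (Suc n))"] ne by (auto simp: d_def)
  then obtain X where X: "\<And>n. X n \<in> M" "\<And>n. J (X n) < d + inverse (real (Suc n))" by metis
  have para: "(norm (m - n))\<^sup>2 \<le> 2 * (J m - d) + 2 * (J n - d)" if "m \<in> M" "n \<in> M" for m n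
  proof -
    have "(1 / 2) *\<^sub>R (m + n) \<in> M"
      unfolding scaleR_scaleC
      by (intro complex_vector.subspace_scale complex_vector.subspace_add M that)
    then have "d \<le> J ((1 / 2) *\<^sub>R (m + n))" by (rule d_le)
    also have "(x - m) + (x - n) = 2 *\<^sub>R (x - (1 / 2) *\<^sub>R (m + n))"
      by (simp add: algebra_simps scaleR_2)
    then have "J ((1 / 2) *\<^sub>R (m + n)) = (norm ((x - m) + (x - n)))\<^sup>2 / 4"
      by (simp add: J_def power_mult_distrib)
    finally have "4 * d \<le> (norm ((x - m) + (x - n)))\<^sup>2" by simp
    moreover have "(norm ((x - m) + (x - n)))\<^sup>2 + (norm (m - n))\<^sup>2 = 2 * J m + 2 * J n"
    proof -
      have "Re (cinner (x - n) (- (x - m))) = - Re (cinner (x - m) (x - n))"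
        by (subst cinner_commute) (simp add: cinner_minus_left del: minus_diff_eq)
      moreover have "(x - n) + - (x - m) = m - n" by simp
      ultimately show ?thesis
        using norm_add_squared[of "x - m" "x - n"] norm_add_squared[of "x - n" "- (x - m)"]
        unfolding J_def norm_minus_cancel by simp
    qed
    ultimately show ?thesis by simp
  qed
  have "Cauchy X"
  proof (rule CauchyI)
    fix e :: real
    assume "0 < e"
    then obtain N where N: "inverse (real (Suc N)) < e\<^sup>2 / 4"
      using reals_Archimedean[of "e\<^sup>2 / 4"] by auto
    have small: "J (X n) - d < e\<^sup>2 / 4" if "n \<ge> N" for n
    proof -
      have "inverse (real (Suc n)) \<le> inverse (real (Suc N))"
        using that by (intro le_imp_inverse_le) auto
      then show ?thesis using X(2)[of n] N by linarith
    qed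
    have "norm (X i - X j) < e" if "i \<ge> N" "j \<ge> N" for i j
    proof (rule power2_less_imp_less)
      show "(norm (X i - X j))\<^sup>2 < e\<^sup>2"
      proof (rule le_less_trans[OF para[OF X(1) X(1)]])
        have "2 * (J (X i) - d) < 2 * (e\<^sup>2 / 4)" "2 * (J (X j) - d) < 2 * (e\<^sup>2 / 4)"
          using small[OF that(1)] small[OF that(2)] by (simp_all only: mult_less_cancel_left_pos zero_less_numeral)
        from add_strict_mono[OF this] show "2 * (J (X i) - d) + 2 * (J (X j) - d) < e\<^sup>2"
          by simp
      qed
    qed (use \<open>0 < e\<close> in simp)
    then show "\<exists>N. \<forall>i\<ge>N. \<forall>j\<ge>N. norm (X i - X j) < e" by blast
  qed
  then obtain p where p: "X \<longlonglongrightarrow> p"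
    using Cauchy_convergent convergent_def by blast
  have pM: "p \<in> M"
    by (rule closed_sequentially[OF M(2) X(1) p])
  have "(\<lambda>n. J (X n)) \<longlonglongrightarrow> J p"
    unfolding J_def by (intro tendsto_intros p)
  moreover have "(\<lambda>n. d + inverse (real (Suc n))) \<longlonglongrightarrow> d + 0"
    by (intro tendsto_intros LIMSEQ_inverse_real_of_nat)
  ultimately have "J p \<le> d + 0"
    by (rule LIMSEQ_le) (use X(2) less_imp_le in blast)
  then have min: "J p \<le> J m" if "m \<in> M" for m
    using d_le[OF that] by simp
  have re: "Re (cinner (x - p) m) = 0" if m: "m \<in> M" for m
  proof (rule linear_le_quadratic_zero)
    fix t :: real
    have eq: "x - (p - t *\<^sub>R m) = (x - p) + t *\<^sub>R m" by simp
    have "p - t *\<^sub>R m \<in> M"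
      unfolding scaleR_scaleC
      by (intro complex_vector.subspace_scale complex_vector.subspace_diff M m pM)
    then have "J p \<le> J (p - t *\<^sub>R m)" by (rule min)
    also have "J (p - t *\<^sub>R m) = J p + 2 * t * Re (cinner (x - p) m) + t\<^sup>2 * (norm m)\<^sup>2"
      unfolding J_def eq norm_add_squared[of "x - p" "t *\<^sub>R m"]
      by (simp add: scaleR_scaleC cinner_scaleC_right norm_scaleC power_mult_distrib)
    finally show "0 \<le> 2 * t * Re (cinner (x - p) m) + t\<^sup>2 * (norm m)\<^sup>2" by simp
  qed simp
  have "cinner m (x - p) = 0" if m: "m \<in> M" for m
  proof -
    \<comment> \<open>The vanishing real part, applied to this multiple of \<open>m\<close>, yields
      the imaginary part.\<close>
    have "\<i> *\<^sub>C m \<in> M" by (intro complex_vector.subspace_scale M m)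
    then have "cinner (x - p) m = 0"
      using re[OF m] re[of "\<i> *\<^sub>C m"] by (simp add: cinner_scaleC_right complex_eq_iff)
    then show ?thesis by (metis cinner_commute complex_cnj_zero)
  qed
  then show ?thesis using pM by blast
qed

section \<open>Adjoint graphs and resolvents\<close>

lemma graph_adjointI:
  "(\<And>x x'. (x, x') \<in> G \<Longrightarrow> cinner z x = cinner y x') \<Longrightarrow> (y, z) \<in> graph_adjoint G"
  by (auto simp: graph_adjoint_def)

lemma graph_adjointD:
  "(y, z) \<in> graph_adjoint G \<Longrightarrow> (x, x') \<in> G \<Longrightarrow> cinner z x = cinner y x'"
  by (auto simp: graph_adjoint_def)

lemma graph_adjoint_iff:
  "(y, z) \<in> graph_adjoint G \<longleftrightarrow> (\<forall>x x'. (x, x') \<in> G \<longrightarrow> cinner z x = cinner y x')"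
  by (auto simp: graph_adjoint_def)

lemma csubspace_graph_adjoint: "csubspace (graph_adjoint G)"
  by (rule complex_vector.subspaceI)
    (auto simp: graph_adjoint_iff zero_prod_def plus_prod_def scaleC_prod_def
      cinner_add_left cinner_scaleC_left)

lemma closed_graph_adjoint:
  fixes G :: "('a::complex_inner \<times> 'b::complex_inner) set"
  shows "closed (graph_adjoint G)"
proof -
  have "graph_adjoint G = (\<Inter>p\<in>G. {q. cinner (snd q) (fst p) = cinner (fst q) (snd p)})"
    by (fastforce simp: graph_adjoint_iff)
  also have "closed \<dots>"
    by (intro closed_INT ballI closed_Collect_eq continuous_intros)
  finally show ?thesis .
qed

text \<open>If \<open>G\<close> is the graph of an operator \<open>Q\<close>, then \<open>R = (1 + Q\<^sup>* Q)\<^sup>-\<^sup>1\<close> and \<open>S = Q R\<close>; the point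
  \<open>(R z, S z)\<close> is the projection of \<open>(z, 0)\<close> to \<open>G\<close>.\<close>

definition resolvent_pair ::
  "('a::chilbert_space \<times> 'a) set \<Rightarrow> ('a \<Rightarrow>\<^sub>L 'a) \<Rightarrow> ('a \<Rightarrow>\<^sub>L 'a) \<Rightarrow> bool" where
  "resolvent_pair G R S \<longleftrightarrow> R \<in> bounded_ops \<and> S \<in> bounded_ops \<and>
    (\<forall>z. (R z, S z) \<in> G \<and> (S z, z - R z) \<in> graph_adjoint G)"

text \<open>The difference \<open>(d, e)\<close> of two solutions lies in \<open>G\<close>, and
  \<open>(e, - d)\<close> in the adjoint graph; pairing them makes the sum of the squared norms of
  \<open>d\<close> and \<open>e\<close> vanish.\<close>

lemma resolvent_unique:
  assumes G: "csubspace G"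
    and 1: "(r, s) \<in> G" "(s, z - r) \<in> graph_adjoint G"
    and 2: "(r', s') \<in> G" "(s', z - r') \<in> graph_adjoint G"
  shows "r' = r" "s' = s"
proof -
  have "(r - r', s - s') \<in> G"
    using complex_vector.subspace_diff[OF G 1(1) 2(1)] by simp
  moreover have "(s - s', r' - r) \<in> graph_adjoint G"
    using complex_vector.subspace_diff[OF csubspace_graph_adjoint 1(2) 2(2)] by simp
  ultimately have "cinner (r' - r) (r - r') = cinner (s - s') (s - s')"
    by (metis graph_adjointD)
  moreover have "cinner (r - r') (r - r') = - cinner (r' - r) (r - r')"
    using cinner_minus_left[of "r' - r" "r - r'"] by simp
  ultimately have "cinner (r - r') (r - r') + cinner (s - s') (s - s') = 0"
    by simp
  then have "complex_of_real ((norm (r - r'))\<^sup>2 + (norm (s - s'))\<^sup>2) = 0"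
    by (simp add: cinner_self)
  then have "(norm (r - r'))\<^sup>2 + (norm (s - s'))\<^sup>2 = 0"
    by (simp only: of_real_eq_0_iff)
  then show "r' = r" "s' = s"
    by (simp_all add: sum_power2_eq_zero_iff)
qed

text \<open>Orthogonality of \<open>(z, 0) - (r, s)\<close> to \<open>G\<close> means that
  \<open>(s, z - r)\<close> is in the adjoint graph. Linearity in \<open>z\<close> then follows from
  uniqueness.\<close>

lemma resolvent_pair_exists:
  fixes G :: "('a::chilbert_space \<times> 'a) set"
  assumes G: "csubspace G" "closed G"
  shows "\<exists>R S. resolvent_pair G R S"
proof -
  have "\<exists>r s. (r, s) \<in> G \<and> (s, z - r) \<in> graph_adjoint G" for z
  proof -
    obtain r s where rs: "(r, s) \<in> G" and o: "\<And>m. m \<in> G \<Longrightarrow> cinner m ((z, 0) - (r, s)) = 0"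
      using orthogonal_projection[OF G, of "(z, 0)"] by fastforce
    have "(s, z - r) \<in> graph_adjoint G"
    proof (rule graph_adjointI)
      fix x x' assume "(x, x') \<in> G"
      from o[OF this] have "cinner x (z - r) = cinner x' s"
        by (simp add: cinner_prod_def cinner_minus_right)
      then show "cinner (z - r) x = cinner s x'"
        by (metis cinner_commute)
    qed
    then show ?thesis using rs by blast
  qed
  then obtain r s where rs: "\<And>z. (r z, s z) \<in> G" "\<And>z. (s z, z - r z) \<in> graph_adjoint G"
    by metis
  note uniq = resolvent_unique[OF G(1)]
  have add: "r (y + z) = r y + r z" "s (y + z) = s y + s z" for y z
    using uniq[of "r y + r z" "s y + s z" "y + z", OF _ _ rs(1) rs(2)]
      complex_vector.subspace_add[OF G(1) rs(1) rs(1), of y z]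
      complex_vector.subspace_add[OF csubspace_graph_adjoint rs(2) rs(2), of y z]
    by (simp_all add: algebra_simps)
  have scale: "r (c *\<^sub>C z) = c *\<^sub>C r z" "s (c *\<^sub>C z) = c *\<^sub>C s z" for c z
    using uniq[of "c *\<^sub>C r z" "c *\<^sub>C s z" "c *\<^sub>C z", OF _ _ rs(1) rs(2)]
      complex_vector.subspace_scale[OF G(1) rs(1), of c z]
      complex_vector.subspace_scale[OF csubspace_graph_adjoint rs(2), of c z]
    by (simp_all add: scaleC_prod_def complex_vector.scale_right_diff_distrib)
  \<comment> \<open>Pairing the two memberships of \<open>z\<close> with each other bounds
    \<open>r\<close> and \<open>s\<close> simultaneously.\<close>
  have "(norm (r z))\<^sup>2 + (norm (s z))\<^sup>2 \<le> norm z * norm (r z)" for z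
  proof -
    have "cinner (z - r z) (r z) = cinner (s z) (s z)"
      using rs by (rule graph_adjointD[rotated])
    then have "cinner z (r z) = complex_of_real ((norm (r z))\<^sup>2 + (norm (s z))\<^sup>2)"
      by (simp add: cinner_diff_left cinner_self diff_eq_eq add.commute)
    then have "(norm (r z))\<^sup>2 + (norm (s z))\<^sup>2 = norm (cinner z (r z))"
      by (simp only: norm_of_real) simp
    also have "\<dots> \<le> norm z * norm (r z)" by (rule cinner_Cauchy_Schwarz)
    finally show ?thesis .
  qed
  note est = this
  have nr: "norm (r z) \<le> norm z * 1" for z
  proof -
    have "norm (r z) * norm (r z) \<le> norm z * norm (r z)"
      using est[of z] zero_le_power2[of "norm (s z)"] unfolding power2_eq_square by linarith
    then show ?thesis by (cases "r z = 0") simp_all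
  qed
  have ns: "norm (s z) \<le> norm z * 1" for z
  proof -
    have "(norm (s z))\<^sup>2 \<le> norm z * norm (r z)" using est[of z] zero_le_power2[of "norm (r z)"] by linarith
    also have "\<dots> \<le> norm z * norm z" using nr[of z] by (intro mult_left_mono) auto
    finally have "(norm (s z))\<^sup>2 \<le> (norm z)\<^sup>2" by (simp add: power2_eq_square)
    then show ?thesis by (simp del: power_mono_iff add: power2_le_iff_abs_le)
  qed
  note R = bounded_ops_Blinfun[of r, OF add(1) scale(1) nr]
  note S = bounded_ops_Blinfun[of s, OF add(2) scale(2) ns]
  have "resolvent_pair G (Blinfun r) (Blinfun s)"
    unfolding resolvent_pair_def by (simp add: R S rs)
  then show ?thesis by blast
qed

text \<open>Both identities come from pairing \<open>(S y, y - R y)\<close> in the adjoint graph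
  with \<open>(R z, S z)\<close> in \<open>G\<close>.\<close>

lemma resolvent_pair_adj:
  assumes "resolvent_pair G R S"
  shows "adj R = R" and "adj S (S z) = R z - R (R z)"
proof -
  have b: "R \<in> bounded_ops" "S \<in> bounded_ops"
    and G: "\<And>z. (R z, S z) \<in> G" "\<And>z. (S z, z - R z) \<in> graph_adjoint G"
    using assms by (simp_all add: resolvent_pair_def)
  have 1: "cinner (y - R y) (R z) = cinner (S y) (S z)" for y z
    by (rule graph_adjointD[OF G(2) G(1)])
  have 2: "cinner (R y) (z - R z) = cinner (S y) (S z)" for y z
    using 1[of z y] by (metis cinner_commute)
  show adjR: "adj R = R"
  proof (rule adj_eqI[OF b(1)])
    show "cinner (R y) z = cinner y (R z)" for y z
      using trans[OF 2 1[symmetric], of y z] by (simp add: cinner_diff_left cinner_diff_right)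
  qed
  show "adj S (S z) = R z - R (R z)"
  proof (rule cinner_eqI_right)
    have "cinner v (R z) = cinner (R v) z" for v z
      using cinner_adj[OF b(1), of v z] by (simp add: adjR)
    then show "cinner v (adj S (S z)) = cinner v (R z - R (R z))" for v
      using 2[of v z] by (simp add: cinner_adj_right b cinner_diff_right)
  qed
qed

text \<open>\<open>T F T = 0\<close> gives \<open>F T = 0\<close> by injectivity; then
  \<open>T (adj F) = 0\<close>, and injectivity applies once more.\<close>

lemma sandwich_eq_0:
  fixes T F :: "'a::chilbert_space \<Rightarrow>\<^sub>L 'a"
  assumes T: "T \<in> bounded_ops" "adj T = T" and inj: "\<And>x. T x = 0 \<Longrightarrow> x = 0"
    and F: "F \<in> bounded_ops" and eq: "\<And>x y. cinner (T x) (F (T y)) = 0"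
  shows "F = 0"
proof -
  have cinner_T: "cinner (T x) y = cinner x (T y)" for x y
    using cinner_adj[OF T(1)] by (simp add: T)
  have "cinner x (T (F (T y))) = 0" for x y
    using eq[of x y] by (simp add: cinner_T)
  then have "T (F (T y)) = 0" for y
    using cinner_eq_zero_iff by blast
  then have FT: "F (T y) = 0" for y
    by (rule inj)
  have "adj F w = 0" for w
  proof (rule inj, rule cinner_eqI)
    have "cinner (T (adj F w)) v = cinner w (F (T v))" for v
      by (simp add: cinner_T cinner_adj F)
    then show "cinner (T (adj F w)) v = cinner 0 v" for v
      by (simp add: FT)
  qed
  then have "cinner w (F x) = 0" for w x
    using cinner_adj[OF F, of w x] by simp
  then have "F x = 0" for x
    using cinner_eq_zero_iff by blast
  then show ?thesis
    by (intro blinfun_eqI) simp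
qed

section \<open>A Stein equation\<close>

text \<open>For a selfadjoint contraction \<open>V\<close> with defect \<open>K\<^sup>* K = 1 - V\<^sup>2\<close>, the equation
  \<open>y - V y V = K\<^sup>* a K\<close> is solved by \<open>y = (\<Sum>n. V\<^sup>n K\<^sup>* a K V\<^sup>n)\<close>.\<close>

locale defect_pair =
  fixes V K :: "'a::chilbert_space \<Rightarrow>\<^sub>L 'a"
  assumes V [simp]: "V \<in> bounded_ops" and K [simp]: "K \<in> bounded_ops"
    and adj_V: "adj V = V" and defect: "adj K (K z) = z - V (V z)"
begin

primrec Vpow :: "nat \<Rightarrow> ('a \<Rightarrow>\<^sub>L 'a)" where
  "Vpow 0 = id_blinfun"
| "Vpow (Suc n) = V o\<^sub>L Vpow n"

lemma Vpow_bounded_ops [simp]: "Vpow n \<in> bounded_ops"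
  by (induction n) simp_all

lemma Vpow_add: "Vpow (m + n) x = Vpow m (Vpow n x)"
  by (induction m) simp_all

lemma Vpow_Suc_right: "Vpow (Suc n) x = Vpow n (V x)"
  by (induction n) simp_all

lemma cinner_V: "cinner (V x) y = cinner x (V y)"
  using cinner_adj[OF V] by (simp add: adj_V)

lemma cinner_Vpow: "cinner (Vpow n x) y = cinner x (Vpow n y)"
proof (induction n arbitrary: x y)
  case (Suc n)
  have "cinner (Vpow (Suc n) x) y = cinner x (Vpow n (V y))"
    by (simp add: cinner_V Suc)
  then show ?case by (simp only: Vpow_Suc_right)
qed simp

lemma norm_defect: "(norm (K x))\<^sup>2 = (norm x)\<^sup>2 - (norm (V x))\<^sup>2"
proof -
  have "cinner (K x) (K x) = cinner x x - cinner (V x) (V x)"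
    using cinner_adj_right[OF K, of x "K x"] by (simp add: defect cinner_diff_right cinner_V)
  then have "complex_of_real ((norm (K x))\<^sup>2) = complex_of_real ((norm x)\<^sup>2 - (norm (V x))\<^sup>2)"
    by (simp add: cinner_self)
  then show ?thesis by (simp only: of_real_eq_iff)
qed

lemma norm_V_le: "norm (V x) \<le> norm x"
  by (rule power2_le_imp_le) (use norm_defect[of x] zero_le_power2[of "norm (K x)"] in linarith, simp)

lemma norm_Vpow_le: "norm (Vpow n x) \<le> norm x"
  by (induction n) (auto intro: order_trans norm_V_le)

text \<open>By \<open>norm_defect\<close> the sum telescopes. Thus the column of the operators
  \<open>K V\<^sup>n\<close> is a contraction.\<close>

lemma sum_defect: "(\<Sum>n<N. (norm (K (Vpow n x)))\<^sup>2) = (norm x)\<^sup>2 - (norm (Vpow N x))\<^sup>2"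
  by (induction N) (simp_all add: norm_defect)

lemma sum_defect_le:
  assumes "finite F"
  shows "(\<Sum>n\<in>F. (norm (K (Vpow n x)))\<^sup>2) \<le> (norm x)\<^sup>2"
proof -
  obtain N where "F \<subseteq> {..<N}" using assms finite_nat_iff_bounded by blast
  then have "(\<Sum>n\<in>F. (norm (K (Vpow n x)))\<^sup>2) \<le> (\<Sum>n<N. (norm (K (Vpow n x)))\<^sup>2)"
    by (intro sum_mono2) auto
  then show ?thesis using zero_le_power2[of "norm (Vpow N x)"] unfolding sum_defect by linarith
qed

lemma summable_defect: "summable (\<lambda>n. (norm (K (Vpow n x)))\<^sup>2)"
  by (rule bounded_imp_summable[of _ "(norm x)\<^sup>2"])
    (use sum_defect_le[of "{.._}" x] in simp_all)

text \<open>The row of adjoints is contractive because the column is: pair the sum with itself, move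
  every factor across and apply Cauchy-Schwarz.\<close>

lemma norm_sum_adj_defect:
  assumes "finite F"
  shows "(norm (\<Sum>n\<in>F. Vpow n (adj K (x n))))\<^sup>2 \<le> (\<Sum>n\<in>F. (norm (x n))\<^sup>2)"
proof -
  define s where "s = (\<Sum>n\<in>F. Vpow n (adj K (x n)))"
  have "cinner s s = (\<Sum>n\<in>F. cinner s (Vpow n (adj K (x n))))"
    by (subst (2) s_def) (rule linear_sum[OF bounded_linear.linear[OF bounded_linear_cinner_right]])
  also have "\<dots> = (\<Sum>n\<in>F. cinner (K (Vpow n s)) (x n))"
    by (simp add: cinner_adj_right flip: cinner_Vpow)
  finally have "norm (cinner s s) \<le> (\<Sum>n\<in>F. norm (K (Vpow n s)) * norm (x n))"
    by (simp add: sum_norm_le[OF cinner_Cauchy_Schwarz])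
  also have "\<dots> \<le> L2_set (\<lambda>n. norm (K (Vpow n s))) F * L2_set (\<lambda>n. norm (x n)) F"
    using L2_set_mult_ineq[of "\<lambda>n. norm (K (Vpow n s))" "\<lambda>n. norm (x n)" F] by simp
  also have "\<dots> \<le> norm s * L2_set (\<lambda>n. norm (x n)) F"
  proof (rule mult_right_mono)
    show "L2_set (\<lambda>n. norm (K (Vpow n s))) F \<le> norm s"
      unfolding L2_set_def using sum_defect_le[OF assms, of s] by (intro real_le_lsqrt) auto
  qed (simp add: L2_set_nonneg)
  finally have "norm (cinner s s) \<le> L2_set (\<lambda>n. norm (x n)) F * norm s"
    by (simp only: mult.commute)
  then have "norm s \<le> L2_set (\<lambda>n. norm (x n)) F"
    by (rule norm_le_cinnerI) (rule L2_set_nonneg)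
  then have "(norm s)\<^sup>2 \<le> (L2_set (\<lambda>n. norm (x n)) F)\<^sup>2"
    by (rule power_mono) simp
  also have "\<dots> = (\<Sum>n\<in>F. (norm (x n))\<^sup>2)"
    unfolding L2_set_def by (simp add: sum_nonneg)
  finally show ?thesis unfolding s_def .
qed

definition stein_term :: "('a \<Rightarrow>\<^sub>L 'a) \<Rightarrow> 'a \<Rightarrow> nat \<Rightarrow> 'a" where
  "stein_term a x n = Vpow n (adj K (a (K (Vpow n x))))"

lemma norm_sum_stein_term:
  assumes "finite F"
  shows "(norm (sum (stein_term a x) F))\<^sup>2 \<le> (norm a)\<^sup>2 * (\<Sum>n\<in>F. (norm (K (Vpow n x)))\<^sup>2)"
proof -
  have "(norm (sum (stein_term a x) F))\<^sup>2 \<le> (\<Sum>n\<in>F. (norm (a (K (Vpow n x))))\<^sup>2)"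
    unfolding stein_term_def by (rule norm_sum_adj_defect[OF assms])
  also have "\<dots> \<le> (\<Sum>n\<in>F. (norm a)\<^sup>2 * (norm (K (Vpow n x)))\<^sup>2)"
    by (intro sum_mono) (simp add: norm_blinfun power_mono flip: power_mult_distrib)
  finally show ?thesis by (simp add: sum_distrib_left)
qed

text \<open>The squared norm of a block of terms is dominated by a block of the convergent series of
  squared defects; no absolute convergence is claimed.\<close>

lemma summable_stein: "summable (stein_term a x)"
  unfolding summable_Cauchy
proof (intro allI impI)
  fix e :: real
  assume e: "0 < e"
  have "summable (\<lambda>n. (norm a)\<^sup>2 * (norm (K (Vpow n x)))\<^sup>2)"
    by (intro summable_mult summable_defect)
  then obtain N where N: "\<And>m n. m \<ge> N \<Longrightarrow> norm (\<Sum>k=m..<n. (norm a)\<^sup>2 * (norm (K (Vpow k x)))\<^sup>2) < e\<^sup>2"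
    unfolding summable_Cauchy using e by (metis zero_less_power)
  have "norm (sum (stein_term a x) {m..<n}) < e" if "m \<ge> N" for m n
  proof (rule power2_less_imp_less)
    have "(norm (sum (stein_term a x) {m..<n}))\<^sup>2
        \<le> (\<Sum>k=m..<n. (norm a)\<^sup>2 * (norm (K (Vpow k x)))\<^sup>2)"
      using norm_sum_stein_term[of "{m..<n}" a x] by (simp add: sum_distrib_left)
    also have "\<dots> \<le> norm (\<Sum>k=m..<n. (norm a)\<^sup>2 * (norm (K (Vpow k x)))\<^sup>2)"
      by (simp only: real_norm_def abs_ge_self)
    also have "\<dots> < e\<^sup>2" by (rule N[OF that])
    finally show "(norm (sum (stein_term a x) {m..<n}))\<^sup>2 < e\<^sup>2" .
  qed (use e in simp)
  then show "\<exists>N. \<forall>m\<ge>N. \<forall>n. norm (sum (stein_term a x) {m..<n}) < e" by blast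
qed

lemma stein_solution:
  assumes a: "a \<in> bounded_ops"
  obtains y where "y \<in> bounded_ops" "\<And>x. stein_term a x sums y x"
    "\<And>x. y x - V (y (V x)) = adj K (a (K x))"
proof -
  define f where "f x = suminf (stein_term a x)" for x
  have sums: "stein_term a x sums f x" for x
    unfolding f_def by (rule summable_sums[OF summable_stein])
  have add: "stein_term a (x + x') n = stein_term a x n + stein_term a x' n" for x x' n
    by (simp add: stein_term_def blinfun.add_right)
  have scale: "stein_term a (c *\<^sub>C x) n = c *\<^sub>C stein_term a x n" for c x n
    by (simp add: stein_term_def bounded_opsD a)
  have f_add: "f (x + x') = f x + f x'" for x x'
    using sums_add[OF sums sums, of x x'] sums[of "x + x'"]
    by (intro sums_unique2[of "stein_term a (x + x')"]) (simp_all add: add flip: add)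
  have f_scale: "f (c *\<^sub>C x) = c *\<^sub>C f x" for c x
    using bounded_linear.sums[OF bounded_linear_scaleC sums, of c x] sums[of "c *\<^sub>C x"]
    by (intro sums_unique2[of "stein_term a (c *\<^sub>C x)"]) (simp_all flip: scale)
  have f_bound: "norm (f x) \<le> norm x * norm a" for x
  proof (rule Lim_norm_ubound[OF sequentially_bot])
    show "(\<lambda>n. \<Sum>i<n. stein_term a x i) \<longlonglongrightarrow> f x"
      using sums unfolding sums_def .
    have "norm (\<Sum>i<n. stein_term a x i) \<le> norm x * norm a" for n
    proof (rule power2_le_imp_le)
      have "(norm (\<Sum>i<n. stein_term a x i))\<^sup>2 \<le> (norm a)\<^sup>2 * (\<Sum>i<n. (norm (K (Vpow i x)))\<^sup>2)"
        by (rule norm_sum_stein_term) simp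
      also have "\<dots> \<le> (norm a)\<^sup>2 * (norm x)\<^sup>2"
        by (intro mult_left_mono sum_defect_le) simp_all
      finally show "(norm (\<Sum>i<n. stein_term a x i))\<^sup>2 \<le> (norm x * norm a)\<^sup>2"
        by (simp add: power_mult_distrib mult.commute)
    qed simp
    then show "\<forall>\<^sub>F n in sequentially. norm (\<Sum>i<n. stein_term a x i) \<le> norm x * norm a"
      by simp
  qed
  note F = bounded_ops_Blinfun[of f, OF f_add f_scale f_bound]
  have eq: "f x - V (f (V x)) = adj K (a (K x))" for x
  proof -
    \<comment> \<open>Taking one \<open>V\<close> off each side shifts the index; the zeroth term is
      the right-hand side of the equation.\<close>
    have "stein_term a x (Suc n) = V (stein_term a (V x) n)" for n
      unfolding stein_term_def Vpow_Suc_right[symmetric] by simp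
    then have "(\<lambda>n. stein_term a x (Suc n)) sums V (f (V x))"
      using bounded_linear.sums[OF blinfun.bounded_linear_right sums, of V "V x"] by simp
    then have "stein_term a x sums (V (f (V x)) + stein_term a x 0)"
      by (rule sums_Suc_iff[THEN iffD1])
    then have "f x = V (f (V x)) + stein_term a x 0"
      by (rule sums_unique2[OF sums])
    then show ?thesis by (simp add: stein_term_def)
  qed
  show ?thesis
    by (rule that[of "Blinfun f"]) (simp_all add: F sums eq)
qed

lemma defect_tendsto_0: "(\<lambda>n. norm (K (Vpow n x))) \<longlonglongrightarrow> 0"
proof -
  have "(\<lambda>n. sqrt ((norm (K (Vpow n x)))\<^sup>2)) \<longlonglongrightarrow> sqrt 0"
    by (intro tendsto_real_sqrt summable_LIMSEQ_zero summable_defect)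
  then show ?thesis by simp
qed

text \<open>Iteration gives \<open>D = V\<^sup>n D V\<^sup>n\<close>. On the range of
  \<open>P = adj K o K\<close>, which commutes with \<open>V\<close>, the powers tend strongly to
  zero, so \<open>P D P = 0\<close>; and \<open>P\<close> is injective.\<close>

lemma stein_unique:
  assumes D: "D \<in> bounded_ops" and eq: "\<And>x. D x = V (D (V x))"
    and inj: "\<And>x. K x = 0 \<Longrightarrow> x = 0"
  shows "D = 0"
proof (rule sandwich_eq_0[OF _ _ _ D])
  define P where "P = adj K o\<^sub>L K"
  show "adj K o\<^sub>L K \<in> bounded_ops" by simp
  show "adj (adj K o\<^sub>L K) = adj K o\<^sub>L K"
    by (rule adj_eqI) (simp_all add: cinner_adj cinner_adj_right)
  show "x = 0" if "(adj K o\<^sub>L K) x = 0" for x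
  proof (rule inj)
    have "cinner (K x) (K x) = cinner x ((adj K o\<^sub>L K) x)"
      by (simp add: cinner_adj_right)
    then show "K x = 0" by (simp only: that cinner_zero_right cinner_eq_zero_iff)
  qed
  have P_Vpow: "Vpow n (P x) = P (Vpow n x)" for n x
  proof -
    have "V (Vpow n x) = Vpow n (V x)" for x
      using Vpow_Suc_right[of n x] by simp
    then show ?thesis by (simp add: P_def defect blinfun.diff_right)
  qed
  have lim: "(\<lambda>n. Vpow n (P x)) \<longlonglongrightarrow> 0" for x
  proof (rule Lim_null_comparison)
    show "\<forall>\<^sub>F n in sequentially. norm (Vpow n (P x)) \<le> norm (adj K) * norm (K (Vpow n x))"
      unfolding P_Vpow by (simp add: P_def norm_blinfun)
    show "(\<lambda>n. norm (adj K) * norm (K (Vpow n x))) \<longlonglongrightarrow> 0"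
      using tendsto_mult_left[OF defect_tendsto_0, of "norm (adj K)" x] by simp
  qed
  have D_Vpow: "cinner x (D y) = cinner (Vpow n x) (D (Vpow n y))" for n x y
  proof (induction n)
    case (Suc n)
    then show ?case
      using eq[of "Vpow n y"] by (simp add: cinner_V)
  qed simp
  have "cinner (P x) (D (P y)) = 0" for x y
  proof (rule LIMSEQ_unique)
    show "(\<lambda>n. cinner (P x) (D (P y))) \<longlonglongrightarrow> cinner (P x) (D (P y))" by simp
    have "(\<lambda>n. cinner (Vpow n (P x)) (D (Vpow n (P y)))) \<longlonglongrightarrow> cinner 0 (D 0)"
      by (intro tendsto_intros lim)
    then show "(\<lambda>n. cinner (P x) (D (P y))) \<longlonglongrightarrow> 0"
      by (simp flip: D_Vpow)
  qed
  then show "cinner ((adj K o\<^sub>L K) x) (D ((adj K o\<^sub>L K) y)) = 0" for x y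
    by (simp only: P_def)
qed

text \<open>When \<open>K\<close> commutes with \<open>V\<close>, the norms of
  \<open>K V\<^sup>k x\<close> decrease in \<open>k\<close>, while the first \<open>n + 1\<close>
  squares add up to at most the squared norm of \<open>x\<close>.\<close>

lemma norm_defect_rate:
  assumes comm: "\<And>x. K (V x) = V (K x)"
  shows "norm (K (Vpow n x)) \<le> norm x / sqrt (real (Suc n))"
proof -
  have comm': "K (Vpow k x) = Vpow k (K x)" for k x
    by (induction k) (simp_all add: comm)
  have le: "norm (K (Vpow n x)) \<le> norm (K (Vpow k x))" if "k < Suc n" for k
  proof -
    have "Vpow n x = Vpow (n - k) (Vpow k x)"
      using that by (simp flip: Vpow_add)
    then show ?thesis using norm_Vpow_le by (simp add: comm')
  qed
  have "real (Suc n) * (norm (K (Vpow n x)))\<^sup>2 = (\<Sum>k<Suc n. (norm (K (Vpow n x)))\<^sup>2)"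
    by simp
  also have "\<dots> \<le> (\<Sum>k<Suc n. (norm (K (Vpow k x)))\<^sup>2)"
    by (intro sum_mono power_mono le) auto
  also have "\<dots> \<le> (norm x)\<^sup>2"
    by (rule sum_defect_le) simp
  finally have "(sqrt (real (Suc n)) * norm (K (Vpow n x)))\<^sup>2 \<le> (norm x)\<^sup>2"
    by (simp add: power_mult_distrib)
  then have "sqrt (real (Suc n)) * norm (K (Vpow n x)) \<le> norm x"
    by (rule power2_le_imp_le) simp
  then show ?thesis by (simp add: field_simps)
qed

text \<open>Each of the three factors \<open>K\<close> takes about a third of the powers of
  \<open>V\<close> and contributes decay of order -1/2; together this is the summable order
  -3/2.\<close>

lemma summable_defect_cubed:
  assumes comm: "\<And>x. K (V x) = V (K x)"
  shows "summable (\<lambda>n. norm (K (Vpow n (K (K x)))))"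
proof (rule summable_comparison_test', rule summable_mult)
  show "summable (\<lambda>n. real (Suc n) powr (- 3 / 2))"
    by (subst summable_Suc_iff) (simp add: summable_real_powr_iff)
  fix n :: nat
  have comm': "Vpow k (K x) = K (Vpow k x)" for k x
    by (induction k) (simp_all add: comm)
  define k where "k = n div 3"
  \<comment> \<open>The remaining \<open>n mod 3\<close> powers are merely contractions.\<close>
  have "n = k + (k + (k + n mod 3))" unfolding k_def by presburger
  then have "Vpow n x = Vpow k (Vpow k (Vpow k (Vpow (n mod 3) x)))"
    by (metis Vpow_add)
  then have "K (Vpow n (K (K x))) = K (Vpow k (K (Vpow k (K (Vpow k (Vpow (n mod 3) x))))))"
    by (simp add: comm')
  also have "norm \<dots> \<le> norm (K (Vpow k (K (Vpow k (Vpow (n mod 3) x))))) / sqrt (real (Suc k))"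
    by (rule norm_defect_rate[OF comm])
  also have "\<dots> \<le> norm (K (Vpow k (Vpow (n mod 3) x))) / sqrt (real (Suc k)) / sqrt (real (Suc k))"
    by (intro divide_right_mono norm_defect_rate[OF comm]) simp
  also have "\<dots> \<le> norm (Vpow (n mod 3) x) / sqrt (real (Suc k)) / sqrt (real (Suc k)) / sqrt (real (Suc k))"
    by (intro divide_right_mono norm_defect_rate[OF comm]) simp_all
  also have "\<dots> \<le> norm x / sqrt (real (Suc k)) / sqrt (real (Suc k)) / sqrt (real (Suc k))"
    by (intro divide_right_mono norm_Vpow_le) simp_all
  also have "\<dots> = norm x * real (Suc k) powr (- 3 / 2)"
  proof -
    have "real (Suc k) powr (- 3 / 2) = real (Suc k) powr (- (1 / 2) + - (1 / 2) + - (1 / 2))"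
      by simp
    also have "\<dots> = real (Suc k) powr (- (1 / 2)) * real (Suc k) powr (- (1 / 2)) * real (Suc k) powr (- (1 / 2))"
      by (simp only: powr_add)
    also have "real (Suc k) powr (- (1 / 2)) = 1 / sqrt (real (Suc k))"
      by (simp only: powr_minus powr_half_sqrt of_nat_0_le_iff inverse_eq_divide)
    finally show ?thesis by simp
  qed
  finally have 1: "norm (K (Vpow n (K (K x)))) \<le> norm x * real (Suc k) powr (- 3 / 2)" .
  have "real (Suc k) powr (- 3 / 2) \<le> (real (Suc n) / 3) powr (- 3 / 2)"
  proof (rule powr_mono2')
    have "Suc n \<le> 3 * Suc k" unfolding k_def by presburger
    then have "real (Suc n) \<le> real (3 * Suc k)" by (simp only: of_nat_le_iff)
    then show "real (Suc n) / 3 \<le> real (Suc k)" by simp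
  qed simp_all
  also have "(real (Suc n) / 3) powr (- 3 / 2) = real (Suc n) powr (- 3 / 2) * (1 / 3) powr (- 3 / 2)"
    by (simp flip: powr_mult)
  finally have "norm x * real (Suc k) powr (- 3 / 2)
      \<le> norm x * (real (Suc n) powr (- 3 / 2) * (1 / 3) powr (- 3 / 2))"
    by (rule mult_left_mono) simp
  with 1 show "norm (norm (K (Vpow n (K (K x)))))
      \<le> (norm x * (1 / 3) powr (- 3 / 2)) * real (Suc n) powr (- 3 / 2)"
    by (simp add: mult_ac)
qed

end

section \<open>Resolvents of selfadjoint operators\<close>

lemma adj_scaleR:
  assumes "T \<in> bounded_ops"
  shows "adj (r *\<^sub>R T) = r *\<^sub>R adj T"
proof (rule adj_eqI)
  show "cinner ((r *\<^sub>R adj T) x) y = cinner x ((r *\<^sub>R T) y)" for x y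
    unfolding blinfun.scaleR_left unfolding scaleR_scaleC
    by (simp add: cinner_scaleC_left cinner_scaleC_right cinner_adj assms)
qed (simp add: assms)

text \<open>The defect relation is \<open>4 R (1 - R) = 1 - (1 - 2 R)\<^sup>2\<close>, since
  \<open>adj S o S = R (1 - R)\<close>.\<close>

lemma resolvent_defect_pair:
  assumes RS: "resolvent_pair G R S"
  shows "defect_pair (id_blinfun - 2 *\<^sub>R R) (2 *\<^sub>R S)"
proof
  have b: "R \<in> bounded_ops" "S \<in> bounded_ops"
    using RS by (simp_all add: resolvent_pair_def)
  note app = blinfun.diff_left blinfun.scaleR_left blinfun.diff_right blinfun.scaleR_right
  show "id_blinfun - 2 *\<^sub>R R \<in> bounded_ops" "2 *\<^sub>R S \<in> bounded_ops"
    by (simp_all add: b)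
  show "adj (id_blinfun - 2 *\<^sub>R R) = id_blinfun - 2 *\<^sub>R R"
  proof (rule adj_eqI)
    have "cinner (R x) y = cinner x (R y)" for x y
      using cinner_adj[OF b(1)] by (simp add: resolvent_pair_adj[OF RS])
    then show "cinner ((id_blinfun - 2 *\<^sub>R R) x) y = cinner x ((id_blinfun - 2 *\<^sub>R R) y)" for x y
      unfolding app unfolding scaleR_scaleC
      by (simp add: cinner_diff_left cinner_diff_right cinner_scaleC_left cinner_scaleC_right)
  qed (simp add: b)
  show "adj (2 *\<^sub>R S) ((2 *\<^sub>R S) z)
      = z - (id_blinfun - 2 *\<^sub>R R) ((id_blinfun - 2 *\<^sub>R R) z)" for z
    by (simp add: app adj_scaleR b resolvent_pair_adj[OF RS] algebra_simps flip: scaleR_add_left)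
qed

locale selfadjoint_resolvent =
  fixes Q :: "('a::chilbert_space \<times> 'a) set" and R S :: "'a \<Rightarrow>\<^sub>L 'a"
  assumes Q: "selfadjoint Q" and RS: "resolvent_pair Q R S" and ker: "trivial_kernel Q"
begin

lemma csubspace_Q: "csubspace Q" and adjoint_Q: "graph_adjoint Q = Q"
  using Q by (simp_all add: selfadjoint_def)

lemma closed_Q: "closed Q"
  using closed_graph_adjoint[of Q] by (simp add: adjoint_Q)

lemma R [simp]: "R \<in> bounded_ops" and S [simp]: "S \<in> bounded_ops"
  and RQ: "(R z, S z) \<in> Q" and SQ: "(S z, z - R z) \<in> Q"
  using RS by (simp_all add: resolvent_pair_def adjoint_Q)

lemma symmetric_Q: "(x, x') \<in> Q \<Longrightarrow> (y, y') \<in> Q \<Longrightarrow> cinner x' y = cinner x y'"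
  using graph_adjointD[of x x' Q] by (simp add: adjoint_Q)

lemma adj_R: "adj R = R"
  by (rule resolvent_pair_adj[OF RS])

text \<open>Symmetry of \<open>Q\<close> is used on the points \<open>(R x, S x)\<close> and
  \<open>(S x, x - R x)\<close>; adding the two relations cancels the terms with
  \<open>R\<close>.\<close>

lemma adj_S: "adj S = S"
proof (rule adj_eqI[OF S])
  fix x y
  have "cinner (S x) (R y) = cinner (R x) (S y)"
    by (rule symmetric_Q[OF RQ RQ])
  moreover have "cinner (x - R x) (S y) = cinner (S x) (y - R y)"
    by (rule symmetric_Q[OF SQ SQ])
  ultimately show "cinner (S x) y = cinner x (S y)"
    by (simp add: cinner_diff_left cinner_diff_right)
qed

lemma SS: "S (S z) = R z - R (R z)"
  using resolvent_pair_adj(2)[OF RS] by (simp add: adj_S)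

text \<open>Symmetry against the points \<open>(R h, S h)\<close> shows that \<open>R Q\<close> is
  contained in \<open>S = Q R\<close>, so \<open>R\<close> commutes with \<open>Q\<close>.\<close>

lemma R_graph: "(f, g) \<in> Q \<Longrightarrow> R g = S f"
proof (rule cinner_eqI_right)
  fix h assume fg: "(f, g) \<in> Q"
  have "cinner (R h) g = cinner (S h) f"
    using symmetric_Q[OF RQ fg] by simp
  then show "cinner h (R g) = cinner h (S f)"
    using cinner_adj[OF R] cinner_adj[OF S] by (simp add: adj_R adj_S)
qed

lemma R_preserves: "(f, g) \<in> Q \<Longrightarrow> (R f, R g) \<in> Q"
  using RQ by (simp add: R_graph)

lemma RS_commute: "R (S z) = S (R z)"
  by (rule R_graph[OF RQ])

text \<open>If \<open>S z = 0\<close>, then \<open>R z\<close> is in the kernel of \<open>Q\<close>,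
  hence zero, and then \<open>z\<close> is the value of \<open>Q\<close> at 0.\<close>

lemma S_inj: 
  assumes "S z = 0" shows "z = 0"
proof -
  have "(R z, 0) \<in> Q" using RQ[of z] assms by simp
  then have "R z = 0" using ker by (auto simp: trivial_kernel_def)
  then have "(0, z) \<in> Q" using SQ[of z] assms by simp
  moreover have "(0, 0) \<in> Q"
    using complex_vector.subspace_0[OF csubspace_Q] by (simp add: zero_prod_def)
  ultimately show ?thesis
    using Q by (auto simp: selfadjoint_def single_valued_def)
qed

text \<open>\<open>R\<close> and \<open>1 - R\<close> are the two factors of the injective operator
  \<open>S\<^sup>2\<close>.\<close>

lemma R_inj: "R z = 0 \<Longrightarrow> z = 0"
  by (rule S_inj, rule S_inj) (simp add: SS)

lemma R_compl_inj: "z - R z = 0 \<Longrightarrow> z = 0"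
  by (rule S_inj, rule S_inj) (simp add: SS)

definition "V = id_blinfun - 2 *\<^sub>R R"
definition "K = 2 *\<^sub>R S"

lemma V_apply: "V z = z - 2 *\<^sub>R R z" and K_apply: "K z = 2 *\<^sub>R S z"
  by (simp_all add: V_def K_def blinfun.diff_left blinfun.scaleR_left)

lemma adj_K: "adj K = K"
  by (simp add: K_def adj_scaleR adj_S)

sublocale defect_pair V K
  unfolding V_def K_def by (rule resolvent_defect_pair[OF RS])

lemma K_inj: "K z = 0 \<Longrightarrow> z = 0"
  by (rule S_inj) (simp add: K_apply)

lemma KV_commute: "K (V z) = V (K z)"
  by (simp add: K_apply V_apply blinfun.diff_right blinfun.scaleR_right RS_commute scaleR_diff_right)

text \<open>Substitute \<open>V = 1 - 2 R\<close>. Formally \<open>1 - R = Q S\<close> and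
  \<open>R = Q\<^sup>-\<^sup>1 S\<close>, so this is
  \<open>Q y Q\<^sup>-\<^sup>1 + Q\<^sup>-\<^sup>1 y Q = 2 a\<close> multiplied by \<open>S\<close>
  on both sides.\<close>

lemma lyapunov:
  fixes a y :: "'a \<Rightarrow>\<^sub>L 'a"
  assumes "\<And>x. y x - V (y (V x)) = adj K (a (K x))"
  shows "(y (R x) - R (y (R x))) + R (y (x - R x)) = 2 *\<^sub>R S (a (S x))"
proof -
  have "2 *\<^sub>R ((y (R x) - R (y (R x))) + R (y (x - R x))) = y x - V (y (V x))"
    by (simp add: V_apply blinfun.diff_right blinfun.scaleR_right algebra_simps
        flip: scaleR_add_left)
  also have "\<dots> = 2 *\<^sub>R (2 *\<^sub>R S (a (S x)))"
    unfolding assms by (simp add: adj_K K_apply blinfun.scaleR_right)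
  finally show ?thesis by (simp only: scaleR_cancel_left) simp
qed

lemma Vpow_preserves: "(f, g) \<in> Q \<Longrightarrow> (Vpow n f, Vpow n g) \<in> Q"
proof (induction n)
  case (Suc n)
  then have IH: "(Vpow n f, Vpow n g) \<in> Q" by simp
  have "(Vpow n f, Vpow n g) - complex_of_real 2 *\<^sub>C (R (Vpow n f), R (Vpow n g)) \<in> Q"
    by (intro complex_vector.subspace_diff[OF csubspace_Q IH]
        complex_vector.subspace_scale[OF csubspace_Q] R_preserves IH)
  then show ?case
    by (simp only: scaleC_prod_def scaleR_scaleC V_apply fst_conv snd_conv diff_Pair Vpow.simps
        blinfun_apply_blinfun_compose)
qed simp

text \<open>On the range of \<open>K\<^sup>2\<close> the operator \<open>Q\<close> may be applied to the series termwise, because the norms of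
  \<open>K V\<^sup>n K\<^sup>2 x\<close> are summable and \<open>Q K\<close> is bounded.\<close>

lemma stein_domain:
  assumes a: "a \<in> bounded_ops" and y: "stein_term a (K (K x)) sums y"
  shows "\<exists>w. (y, w) \<in> Q"
proof -
  define u where "u n = a (K (Vpow n (K (K x))))" for n
  \<comment> \<open>This is \<open>Q\<close> applied to the term of index \<open>n\<close>:
    \<open>Q K\<close> is the bounded operator \<open>2 (1 - R)\<close>, and \<open>V\<close>
    preserves the graph of \<open>Q\<close>.\<close>
  define w where "w n = Vpow n (2 *\<^sub>R (u n - R (u n)))" for n
  have "(K (u n), 2 *\<^sub>R (u n - R (u n))) \<in> Q" for n
    using complex_vector.subspace_scale[OF csubspace_Q SQ, of 2 "u n"]
    by (simp add: scaleC_prod_def K_apply scaleR_scaleC)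
  then have "(Vpow n (K (u n)), w n) \<in> Q" for n
    unfolding w_def by (rule Vpow_preserves)
  then have "(stein_term a (K (K x)) n, w n) \<in> Q" for n
    by (simp add: stein_term_def adj_K u_def)
  then have "(\<Sum>n<N. (stein_term a (K (K x)) n, w n)) \<in> Q" for N
    by (intro complex_vector.subspace_sum[OF csubspace_Q])
  then have inQ: "(\<Sum>n<N. stein_term a (K (K x)) n, \<Sum>n<N. w n) \<in> Q" for N
    by (simp add: sum_prod)
  have "summable w"
  proof (rule summable_comparison_test')
    show "summable (\<lambda>n. (2 * (1 + norm R) * norm a) * norm (K (Vpow n (K (K x)))))"
      by (intro summable_mult summable_defect_cubed KV_commute)
    fix n
    have "norm (w n) \<le> norm (2 *\<^sub>R (u n - R (u n)))"
      unfolding w_def by (rule norm_Vpow_le)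
    also have "\<dots> \<le> 2 * (norm (u n) + norm R * norm (u n))"
      using norm_triangle_ineq4[of "u n" "R (u n)"] norm_blinfun[of R "u n"] by simp
    also have "\<dots> = 2 * (1 + norm R) * norm (u n)"
      by (simp add: algebra_simps)
    also have "\<dots> \<le> 2 * (1 + norm R) * (norm a * norm (K (Vpow n (K (K x)))))"
      unfolding u_def by (intro mult_left_mono norm_blinfun) simp
    finally show "norm (w n) \<le> (2 * (1 + norm R) * norm a) * norm (K (Vpow n (K (K x))))"
      by (simp add: mult.assoc)
  qed
  then have "(\<lambda>N. (\<Sum>n<N. stein_term a (K (K x)) n, \<Sum>n<N. w n)) \<longlonglongrightarrow> (y, suminf w)"
    using y by (intro tendsto_Pair) (simp_all add: sums_def summable_LIMSEQ)
  then have "(y, suminf w) \<in> Q"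
    by (rule closed_sequentially[OF closed_Q inQ])
  then show ?thesis ..
qed

end

lemma adj_diff:
  fixes S T :: "'a::chilbert_space \<Rightarrow>\<^sub>L 'b::chilbert_space"
  assumes "S \<in> bounded_ops" "T \<in> bounded_ops"
  shows "adj (S - T) = adj S - adj T"
  by (rule adj_eqI)
    (simp_all add: assms blinfun.diff_left cinner_diff_left cinner_diff_right cinner_adj)

lemma resolvent_pair_eq:
  assumes "csubspace G" "resolvent_pair G R S" "(r, s) \<in> G" "(s, z - r) \<in> graph_adjoint G"
  shows "R z = r" "S z = s"
  using resolvent_unique[OF assms(1,3,4), of "R z" "S z"] assms(2)
  by (auto simp: resolvent_pair_def)

section \<open>Tensor products of selfadjoint operators\<close>

lemma tensor_total:
  fixes M :: "('a::chilbert_space \<otimes>\<^sub>H 'b::chilbert_space) set"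
  assumes "csubspace M" "closed M" "\<And>x y. x \<otimes> y \<in> M"
  shows "z \<in> M"
proof -
  have "closure (cspan {x \<otimes> y | x y. True}) \<subseteq> M"
    by (intro closure_minimal complex_vector.span_minimal assms) (use assms(3) in blast)
  then show ?thesis unfolding closure_cspan_tensor by blast
qed

lemma csubspace_graph_tensor: "csubspace (graph_tensor P Q)"
  unfolding graph_tensor_def by (rule csubspace_closure) (rule complex_vector.subspace_span)

lemma closed_graph_tensor: "closed (graph_tensor P Q)"
  unfolding graph_tensor_def by (rule closed_closure)

lemma graph_tensorI: "(x, x') \<in> P \<Longrightarrow> (y, y') \<in> Q \<Longrightarrow> (x \<otimes> y, x' \<otimes> y') \<in> graph_tensor P Q"
  unfolding graph_tensor_def
  by (rule subsetD[OF closure_subset], rule complex_vector.span_base) blast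

text \<open>The defining relation of the adjoint graph is symmetric up to conjugation.\<close>

lemma subset_graph_adjoint_commute:
  "A \<subseteq> graph_adjoint B \<Longrightarrow> B \<subseteq> graph_adjoint A"
proof (clarify, rule graph_adjointI)
  fix y z x x'
  assume sub: "A \<subseteq> graph_adjoint B" and B: "(y, z) \<in> B" and A: "(x, x') \<in> A"
  have "cinner x' y = cinner x z"
    using graph_adjointD[of x x' B] sub A B by blast
  then show "cinner z x = cinner y x'"
    by (metis cinner_commute)
qed

text \<open>Adjoint graphs are closed subspaces, so the inclusion extends from elementary tensors to
  \<open>graph_tensor P Q\<close>, first on one side and, after exchanging sides, on the
  other.\<close>

lemma graph_tensor_symmetric:
  assumes P: "P \<subseteq> graph_adjoint P" and Q: "Q \<subseteq> graph_adjoint Q"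
  shows "graph_tensor P Q \<subseteq> graph_adjoint (graph_tensor P Q)"
proof -
  define T where "T = {(x \<otimes> y, x' \<otimes> y') | x x' y y'. (x, x') \<in> P \<and> (y, y') \<in> Q}"
  have ext: "graph_tensor P Q \<subseteq> graph_adjoint H" if "T \<subseteq> graph_adjoint H" for H
    unfolding graph_tensor_def T_def[symmetric]
    by (intro closure_minimal complex_vector.span_minimal that csubspace_graph_adjoint
        closed_graph_adjoint)
  have "T \<subseteq> graph_adjoint T"
  proof clarify
    fix p q assume "(p, q) \<in> T"
    then obtain x x' y y' where p: "p = x \<otimes> y" "q = x' \<otimes> y'" "(x, x') \<in> P" "(y, y') \<in> Q"
      by (auto simp: T_def)
    show "(p, q) \<in> graph_adjoint T"
    proof (rule graph_adjointI)
      fix f g assume "(f, g) \<in> T"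
      then obtain u u' v v' where f: "f = u \<otimes> v" "g = u' \<otimes> v'" "(u, u') \<in> P" "(v, v') \<in> Q"
        by (auto simp: T_def)
      have "cinner x' u = cinner x u'" "cinner y' v = cinner y v'"
        using graph_adjointD subsetD[OF P p(3)] subsetD[OF Q p(4)] f by blast+
      then show "cinner q f = cinner p g"
        by (simp add: p f cinner_tensor)
    qed
  qed
  then show ?thesis
    by (rule ext[OF subset_graph_adjoint_commute[OF ext]])
qed

lemma graph_tensor_operators:
  fixes A C :: "'a::chilbert_space \<otimes>\<^sub>H 'b::chilbert_space \<Rightarrow>\<^sub>L 'c::complex_inner"
  assumes G: "csubspace G" "closed G" and A: "A \<in> bounded_ops" and C: "C \<in> bounded_ops"
    and mem: "\<And>x y. (A (x \<otimes> y), C (x \<otimes> y)) \<in> G"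
  shows "(A z, C z) \<in> G"
proof -
  have "closed ((\<lambda>z. (A z, C z)) -` G)"
    by (intro continuous_closed_vimage G) (intro continuous_intros)
  then have "closed {z. (A z, C z) \<in> G}" by (simp add: vimage_def)
  moreover have "csubspace {z. (A z, C z) \<in> G}"
  proof (rule complex_vector.subspaceI)
    show "0 \<in> {z. (A z, C z) \<in> G}"
      using complex_vector.subspace_0[OF G(1)] by (simp add: zero_prod_def)
    fix x y c
    assume "x \<in> {z. (A z, C z) \<in> G}" "y \<in> {z. (A z, C z) \<in> G}"
    then have xy: "(A x, C x) \<in> G" "(A y, C y) \<in> G" by simp_all
    show "x + y \<in> {z. (A z, C z) \<in> G}"
      using complex_vector.subspace_add[OF G(1) xy] by (simp add: blinfun.add_right)
    show "c *\<^sub>C x \<in> {z. (A z, C z) \<in> G}"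
      using complex_vector.subspace_scale[OF G(1) xy(1), of c]
      by (simp add: scaleC_prod_def bounded_opsD A C)
  qed
  ultimately show ?thesis
    using tensor_total[of "{z. (A z, C z) \<in> G}" z] mem by simp
qed

text \<open>As \<open>U\<close> preserves \<open>G\<close>, the pair
  \<open>(U (N z), U (M z))\<close> satisfies the conditions that characterize the resolvents at
  \<open>U z\<close>.\<close>

lemma resolvent_pair_commute:
  assumes U: "unitary U" and inv: "graph_of U O G O graph_of (adj U) = G"
    and G: "csubspace G" and NM: "resolvent_pair G N M"
  shows "U (N z) = N (U z)" and "U (M z) = M (U z)"
proof -
  note U' = unitary_adj_apply[OF U] and Ub = unitary_bounded_ops[OF U]
  have down: "(x, adj U g) \<in> G" if "(U x, g) \<in> G" for x g
  proof -
    have "(x, adj U g) \<in> graph_of U O G O graph_of (adj U)"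
      using that by (auto simp: graph_of_def)
    then show ?thesis by (simp add: inv)
  qed
  have up: "(U x, U x') \<in> G" if "(x, x') \<in> G" for x x'
  proof -
    have "(x, x') \<in> graph_of U O G O graph_of (adj U)"
      using that by (simp add: inv)
    then show ?thesis by (auto simp: graph_of_def U')
  qed
  have 1: "(U (N z), U (M z)) \<in> G"
    using NM by (intro up) (simp add: resolvent_pair_def)
  have 2: "(U (M z), U z - U (N z)) \<in> graph_adjoint G"
  proof (rule graph_adjointI)
    fix f g assume fg: "(f, g) \<in> G"
    have "(adj U f, adj U g) \<in> G"
      by (rule down) (simp add: U' fg)
    moreover have "(M z, z - N z) \<in> graph_adjoint G"
      using NM by (simp add: resolvent_pair_def)
    ultimately have "cinner (z - N z) (adj U f) = cinner (M z) (adj U g)"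
      by (rule graph_adjointD[rotated])
    then show "cinner (U z - U (N z)) f = cinner (U (M z)) g"
      by (simp add: cinner_adj_right Ub blinfun.diff_right)
  qed
  show "U (N z) = N (U z)" "U (M z) = M (U z)"
    using resolvent_pair_eq[OF G NM 1 2] by simp_all
qed

text \<open>The operators \<open>R \<otimes> R\<close>, \<open>S \<otimes> S\<close>, \<open>(1 - R) \<otimes> (1 - R)\<close> built from the resolvents of \<open>P\<close> and
  \<open>Q\<close> replace the resolvents of \<open>P \<otimes> Q\<close>, up to multiplication by the injective operator
  \<open>A + B\<close>.\<close>

locale tensor_resolvent =
  P: selfadjoint_resolvent P Rp Sp + Q: selfadjoint_resolvent Q Rq Sq
  for P :: "('a::chilbert_space \<times> 'a) set" and Rp Sp
    and Q :: "('b::chilbert_space \<times> 'b) set" and Rq Sq +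
  fixes N M :: "'a \<otimes>\<^sub>H 'b \<Rightarrow>\<^sub>L 'a \<otimes>\<^sub>H 'b"
  assumes NM: "resolvent_pair (graph_tensor P Q) N M"
begin

definition "A = Rp \<otimes>\<^sub>o Rq"
definition "B = (id_blinfun - Rp) \<otimes>\<^sub>o (id_blinfun - Rq)"
definition "C = Sp \<otimes>\<^sub>o Sq"

lemma ABC_bounded_ops [simp]: "A \<in> bounded_ops" "B \<in> bounded_ops" "C \<in> bounded_ops"
  by (simp_all add: A_def B_def C_def)

lemma NM_bounded_ops [simp]: "N \<in> bounded_ops" "M \<in> bounded_ops"
  using NM by (simp_all add: resolvent_pair_def)

lemma ABC_tensor:
  "A (x \<otimes> y) = Rp x \<otimes> Rq y"
  "B (x \<otimes> y) = (x - Rp x) \<otimes> (y - Rq y)"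
  "C (x \<otimes> y) = Sp x \<otimes> Sq y"
  by (simp_all add: A_def B_def C_def op_tensor_tensor blinfun.diff_left)

lemma adj_ABC: "adj A = A" "adj B = B" "adj C = C"
  by (simp_all add: A_def B_def C_def adj_op_tensor adj_diff P.adj_R P.adj_S Q.adj_R Q.adj_S)

lemma cinner_ABC:
  "cinner (A x) y = cinner x (A y)" "cinner (B x) y = cinner x (B y)"
  "cinner (C x) y = cinner x (C y)"
  using cinner_adj[of A x y] cinner_adj[of B x y] cinner_adj[of C x y] by (simp_all add: adj_ABC)

lemma A_inj: "A z = 0 \<Longrightarrow> z = 0"
  unfolding A_def by (rule op_tensor_injective[OF P.R Q.R P.R_inj Q.R_inj])

lemma B_inj: "B z = 0 \<Longrightarrow> z = 0"
  unfolding B_def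
  by (rule op_tensor_injective[of "id_blinfun - Rp" "id_blinfun - Rq"])
    (auto simp: blinfun.diff_left intro: P.R_compl_inj Q.R_compl_inj)

lemma graph_symmetric: "graph_tensor P Q \<subseteq> graph_adjoint (graph_tensor P Q)"
  by (rule graph_tensor_symmetric) (simp_all add: P.adjoint_Q Q.adjoint_Q)

text \<open>For the tensor product \<open>G\<close> this says \<open>G A = C\<close> and
  \<open>G C = B\<close>; on each leg it is \<open>Q R = S\<close> and
  \<open>Q S = 1 - R\<close>.\<close>

lemma AC: "(A z, C z) \<in> graph_tensor P Q" and CB: "(C z, B z) \<in> graph_tensor P Q"
  by (rule graph_tensor_operators[OF csubspace_graph_tensor closed_graph_tensor];
      simp add: ABC_tensor graph_tensorI P.RQ Q.RQ P.SQ Q.SQ)+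

text \<open>Formally \<open>N = (1 + G\<^sup>2)\<^sup>-\<^sup>1\<close> and
  \<open>A + B = (1 + G\<^sup>2) A\<close>. The symmetry of \<open>G\<close> places
  \<open>(C z, B z)\<close> in the adjoint graph.\<close>

lemma NM_sum: "N (A z + B z) = A z" "M (A z + B z) = C z"
proof -
  have "(C z, (A z + B z) - A z) \<in> graph_adjoint (graph_tensor P Q)"
    using CB graph_symmetric by auto
  from resolvent_pair_eq[OF csubspace_graph_tensor NM AC this]
  show "N (A z + B z) = A z" "M (A z + B z) = C z" .
qed

text \<open>If \<open>M z = 0\<close>, pairing with the points \<open>(A v, C v)\<close> gives
  \<open>A (z - N z) = 0\<close>, so \<open>N z = z\<close>; pairing \<open>(z, 0)\<close> with the
  points \<open>(C v, B v)\<close> then gives \<open>B z = 0\<close>.\<close>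

lemma M_inj: assumes "M z = 0" shows "z = 0"
proof -
  have 1: "(N z, 0) \<in> graph_tensor P Q" "(0, z - N z) \<in> graph_adjoint (graph_tensor P Q)"
    using NM assms unfolding resolvent_pair_def by metis+
  have "cinner (A (z - N z)) v = 0" for v
    using graph_adjointD[OF 1(2) AC, of v] by (simp add: cinner_ABC)
  then have "A (z - N z) = 0"
    using cinner_eq_zero_iff by blast
  then have "N z = z"
    using A_inj[of "z - N z"] by simp
  then have "(z, 0) \<in> graph_adjoint (graph_tensor P Q)"
    using 1(1) graph_symmetric by auto
  then have "cinner (B z) v = 0" for v
    using graph_adjointD[OF _ CB, of z 0 v] by (simp add: cinner_ABC)
  then have "B z = 0"
    using cinner_eq_zero_iff by blast
  then show "z = 0" by (rule B_inj)
qed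

text \<open>Multiply the difference of both sides by \<open>A + B\<close> on the left and right:
  \<open>N\<close>, \<open>1 - N\<close> and \<open>M\<close> turn into \<open>A\<close>,
  \<open>B\<close> and \<open>C\<close>, so the assumption makes it zero. Then \<open>A + B\<close>
  is cancelled by \<open>sandwich_eq_0\<close>.\<close>

lemma lyapunov_transfer:
  assumes Y: "Y \<in> bounded_ops" and X: "X \<in> bounded_ops"
    and eq: "\<And>z. B (Y (A z)) + A (Y (B z)) = 2 *\<^sub>R C (X (C z))"
  shows "(Y (N z) - N (Y (N z))) + N (Y (z - N z)) = 2 *\<^sub>R adj M (X (M z))"
proof -
  define F where "F = ((Y o\<^sub>L N) - (N o\<^sub>L Y o\<^sub>L N)) + (N o\<^sub>L Y o\<^sub>L (id_blinfun - N)) - 2 *\<^sub>R (adj M o\<^sub>L X o\<^sub>L M)"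
  have cinner_N: "cinner x (N y) = cinner (N x) y" for x y
    using cinner_adj[of N x y] by (simp add: resolvent_pair_adj[OF NM])
  have F_apply: "F z = (Y (N z) - N (Y (N z))) + N (Y (z - N z)) - 2 *\<^sub>R adj M (X (M z))" for z
    by (simp only: F_def blinfun.add_left blinfun.diff_left blinfun.scaleR_left
        blinfun_apply_blinfun_compose id_blinfun.rep_eq)
  have "F = 0"
  proof (rule sandwich_eq_0[of "A + B"])
    show "A + B \<in> bounded_ops" "F \<in> bounded_ops"
      by (simp_all add: F_def X Y)
    show "adj (A + B) = A + B"
      by (rule adj_eqI) (simp_all add: blinfun.add_left cinner_add_left cinner_add_right cinner_ABC)
    show "x = 0" if "(A + B) x = 0" for x
    proof (rule A_inj)
      have "N 0 = A x"
        using NM_sum(1)[of x] that by (simp add: blinfun.add_left)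
      then show "A x = 0" by simp
    qed
    fix x y
    have Cx: "cinner (C x) v = cinner (M (A x)) v + cinner (M (B x)) v" for v
      unfolding NM_sum(2)[symmetric] blinfun.add_right by (rule cinner_add_left)
    have "cinner (A x + B x) (F (A y + B y)) = cinner (B x) (Y (A y)) + cinner (A x) (Y (B y))
        - 2 *\<^sub>R cinner (C x) (X (C y))"
      by (simp add: F_apply NM_sum cinner_N cinner_adj_right cinner_add_left cinner_add_right
          cinner_diff_right scaleR_scaleC cinner_scaleC_right Cx distrib_left)
    also have "\<dots> = cinner x (B (Y (A y)) + A (Y (B y)) - 2 *\<^sub>R C (X (C y)))"
      by (simp add: cinner_ABC cinner_add_right cinner_diff_right scaleR_scaleC cinner_scaleC_right)
    finally show "cinner ((A + B) x) (F ((A + B) y)) = 0"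
      by (simp add: eq blinfun.add_left)
  qed
  then show ?thesis
    using F_apply[of z] by simp
qed

text \<open>On elementary tensors the left leg is the equation \<open>P.lyapunov\<close>, and on the
  right leg every term carries \<open>Rq (1 - Rq) = Sq\<^sup>2\<close>.\<close>

lemma lyapunov_left:
  fixes a y :: "'a \<Rightarrow>\<^sub>L 'a"
  assumes a: "a \<in> bounded_ops" and y: "y \<in> bounded_ops"
    and eq: "\<And>x. y x - P.V (y (P.V x)) = adj P.K (a (P.K x))"
  shows "B ((y \<otimes>\<^sub>o id_blinfun) (A z)) + A ((y \<otimes>\<^sub>o id_blinfun) (B z))
    = 2 *\<^sub>R C ((a \<otimes>\<^sub>o id_blinfun) (C z))"
proof -
  let ?y = "y \<otimes>\<^sub>o (id_blinfun :: 'b \<Rightarrow>\<^sub>L 'b)" and ?a = "a \<otimes>\<^sub>o (id_blinfun :: 'b \<Rightarrow>\<^sub>L 'b)"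
  have "(B o\<^sub>L ?y o\<^sub>L A) + (A o\<^sub>L ?y o\<^sub>L B) = 2 *\<^sub>R (C o\<^sub>L ?a o\<^sub>L C)"
  proof (rule bounded_ops_eq_on_tensors)
    fix u v
    have "((y (Rp u) - Rp (y (Rp u))) + Rp (y (u - Rp u))) \<otimes> (Rq v - Rq (Rq v))
        = (2 *\<^sub>R Sp (a (Sp u))) \<otimes> Sq (Sq v)"
      by (simp only: P.lyapunov[OF eq] Q.SS)
    then show "((B o\<^sub>L ?y o\<^sub>L A) + (A o\<^sub>L ?y o\<^sub>L B)) (u \<otimes> v) = (2 *\<^sub>R (C o\<^sub>L ?a o\<^sub>L C)) (u \<otimes> v)"
      by (simp add: blinfun.add_left blinfun.scaleR_left ABC_tensor op_tensor_tensor a y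
          blinfun.diff_right tensor_add_left scaleR_scaleC tensor_scaleC_left scaleC_blinfun.rep_eq)
  qed (simp_all add: a y)
  then have "((B o\<^sub>L ?y o\<^sub>L A) + (A o\<^sub>L ?y o\<^sub>L B)) z = (2 *\<^sub>R (C o\<^sub>L ?a o\<^sub>L C)) z"
    by simp
  then show ?thesis
    by (simp add: blinfun.add_left blinfun.scaleR_left)
qed

lemma lyapunov_right:
  fixes a y :: "'b \<Rightarrow>\<^sub>L 'b"
  assumes a: "a \<in> bounded_ops" and y: "y \<in> bounded_ops"
    and eq: "\<And>x. y x - Q.V (y (Q.V x)) = adj Q.K (a (Q.K x))"
  shows "B ((id_blinfun \<otimes>\<^sub>o y) (A z)) + A ((id_blinfun \<otimes>\<^sub>o y) (B z))
    = 2 *\<^sub>R C ((id_blinfun \<otimes>\<^sub>o a) (C z))"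
proof -
  let ?y = "(id_blinfun :: 'a \<Rightarrow>\<^sub>L 'a) \<otimes>\<^sub>o y" and ?a = "(id_blinfun :: 'a \<Rightarrow>\<^sub>L 'a) \<otimes>\<^sub>o a"
  have "(B o\<^sub>L ?y o\<^sub>L A) + (A o\<^sub>L ?y o\<^sub>L B) = 2 *\<^sub>R (C o\<^sub>L ?a o\<^sub>L C)"
  proof (rule bounded_ops_eq_on_tensors)
    fix u v
    have "(Rp u - Rp (Rp u)) \<otimes> ((y (Rq v) - Rq (y (Rq v))) + Rq (y (v - Rq v)))
        = Sp (Sp u) \<otimes> (2 *\<^sub>R Sq (a (Sq v)))"
      by (simp only: Q.lyapunov[OF eq] P.SS)
    then show "((B o\<^sub>L ?y o\<^sub>L A) + (A o\<^sub>L ?y o\<^sub>L B)) (u \<otimes> v) = (2 *\<^sub>R (C o\<^sub>L ?a o\<^sub>L C)) (u \<otimes> v)"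
      by (simp add: blinfun.add_left blinfun.scaleR_left ABC_tensor op_tensor_tensor a y
          blinfun.diff_right tensor_add_right scaleR_scaleC tensor_scaleC_right scaleC_blinfun.rep_eq)
  qed (simp_all add: a y)
  then have "((B o\<^sub>L ?y o\<^sub>L A) + (A o\<^sub>L ?y o\<^sub>L B)) z = (2 *\<^sub>R (C o\<^sub>L ?a o\<^sub>L C)) z"
    by simp
  then show ?thesis
    by (simp add: blinfun.add_left blinfun.scaleR_left)
qed

text \<open>The resolvents \<open>N\<close> and \<open>M\<close> commute with \<open>U\<close>, and
  \<open>U\<close> intertwines the right-hand sides. Hence the difference \<open>D\<close> of the
  two sides solves the homogeneous Stein equation of the tensor product and vanishes.\<close>

lemma stein_intertwiner:
  assumes U: "unitary U" and inv: "graph_of U O graph_tensor P Q O graph_of (adj U) = graph_tensor P Q"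
    and a: "a \<in> bounded_ops" and b: "b \<in> bounded_ops"
    and ab: "U o\<^sub>L (a \<otimes>\<^sub>o id_blinfun) = (id_blinfun \<otimes>\<^sub>o b) o\<^sub>L U"
    and y: "y \<in> bounded_ops" "\<And>x. y x - P.V (y (P.V x)) = adj P.K (a (P.K x))"
    and w: "w \<in> bounded_ops" "\<And>x. w x - Q.V (w (Q.V x)) = adj Q.K (b (Q.K x))"
  shows "U o\<^sub>L (y \<otimes>\<^sub>o id_blinfun) = (id_blinfun \<otimes>\<^sub>o w) o\<^sub>L U"
proof -
  note U' = unitary_adj_apply[OF U] and Ub = unitary_bounded_ops[OF U]
  note comm = resolvent_pair_commute[OF U inv csubspace_graph_tensor NM]
  define Y where "Y = (y \<otimes>\<^sub>o (id_blinfun :: 'b \<Rightarrow>\<^sub>L 'b))"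
  define X where "X = (a \<otimes>\<^sub>o (id_blinfun :: 'b \<Rightarrow>\<^sub>L 'b))"
  define Y' where "Y' = ((id_blinfun :: 'a \<Rightarrow>\<^sub>L 'a) \<otimes>\<^sub>o w)"
  define X' where "X' = ((id_blinfun :: 'a \<Rightarrow>\<^sub>L 'a) \<otimes>\<^sub>o b)"
  have bd: "Y \<in> bounded_ops" "X \<in> bounded_ops" "Y' \<in> bounded_ops" "X' \<in> bounded_ops"
    by (simp_all add: Y_def X_def Y'_def X'_def a b y w)
  have UX: "U (X z) = X' (U z)" for z
    using arg_cong[OF ab, of "\<lambda>T. blinfun_apply T z"] by (simp add: X_def X'_def)
  have eq: "(Y (N z) - N (Y (N z))) + N (Y (z - N z)) = 2 *\<^sub>R adj M (X (M z))"
    "(Y' (N z) - N (Y' (N z))) + N (Y' (z - N z)) = 2 *\<^sub>R adj M (X' (M z))" for z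
    unfolding X_def X'_def Y_def Y'_def
    by (intro lyapunov_transfer lyapunov_left lyapunov_right; simp add: a b y w)+
  have adjM: "U (adj M z) = adj M (U z)" for z
  proof (rule cinner_eqI_right)
    fix v
    have "U (M (adj U v)) = M v"
      using comm(2)[of "adj U v"] by (simp add: U')
    then have "M (adj U v) = adj U (M v)"
      by (metis U'(1))
    then show "cinner v (U (adj M z)) = cinner v (adj M (U z))"
      by (simp add: cinner_adj_right Ub flip: cinner_adj[OF Ub])
  qed
  define D where "D = (U o\<^sub>L Y) - (Y' o\<^sub>L U)"
  have D_apply: "D z = U (Y z) - Y' (U z)" for z
    by (simp add: D_def blinfun.diff_left)
  have "(D (N z) - N (D (N z))) + N (D (z - N z))
      = U ((Y (N z) - N (Y (N z))) + N (Y (z - N z)))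
        - ((Y' (N (U z)) - N (Y' (N (U z)))) + N (Y' (U z - N (U z))))" for z
    by (simp add: D_apply blinfun.diff_right blinfun.add_right comm)
  then have D_eq: "(D (N z) - N (D (N z))) + N (D (z - N z)) = 0" for z
    unfolding eq by (simp add: blinfun.scaleR_right adjM UX comm)
  interpret defect_pair "id_blinfun - 2 *\<^sub>R N" "2 *\<^sub>R M"
    by (rule resolvent_defect_pair[OF NM])
  have "D = 0"
  proof (rule stein_unique)
    show "D \<in> bounded_ops" by (simp add: D_def bd Ub)
    show "x = 0" if "(2 *\<^sub>R M) x = 0" for x
      by (rule M_inj) (use that in \<open>simp add: blinfun.scaleR_left\<close>)
    fix z
    \<comment> \<open>This returns from the form with \<open>N\<close> and \<open>1 - N\<close> to
      the Stein form required for uniqueness.\<close>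
    have "(id_blinfun - 2 *\<^sub>R N) (D ((id_blinfun - 2 *\<^sub>R N) z))
        = D z - 2 *\<^sub>R ((D (N z) - N (D (N z))) + N (D (z - N z)))"
      by (simp add: blinfun.diff_left blinfun.scaleR_left blinfun.diff_right blinfun.scaleR_right
          algebra_simps flip: scaleR_add_left)
    then show "D z = (id_blinfun - 2 *\<^sub>R N) (D ((id_blinfun - 2 *\<^sub>R N) z))"
      by (simp add: D_eq)
  qed
  then show ?thesis
    by (simp add: D_def Y_def Y'_def)
qed

end

section \<open>Modularity\<close>

lemma slice_tensor: "adj (tensor_r q) (x \<otimes> y) = cinner q y *\<^sub>C x"
  for q y :: "'b::chilbert_space" and x :: "'a::chilbert_space"
  by (rule cinner_eqI_right)
    (simp add: cinner_adj_right cinner_tensor cinner_scaleC_right mult.commute)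

text \<open>The relation is equivalent to
  \<open>adj U (1 \<otimes> y) = (y \<otimes> 1) adj U\<close>, which carries \<open>y\<close> from
  the second leg of the left vector to the first leg of the right one.\<close>

lemma adj_intertwiner:
  assumes U: "unitary U" and y: "y \<in> bounded_ops"
    and comm: "U o\<^sub>L (y \<otimes>\<^sub>o id_blinfun) = (id_blinfun \<otimes>\<^sub>o y) o\<^sub>L U"
  shows "cinner (x \<otimes> v) (U (adj y z \<otimes> u)) = cinner (x \<otimes> y v) (U (z \<otimes> u))"
proof -
  note Ub = unitary_bounded_ops[OF U]
  have "(id_blinfun \<otimes>\<^sub>o y) (x \<otimes> v) = U ((y \<otimes>\<^sub>o id_blinfun) (adj U (x \<otimes> v)))"
    using arg_cong[OF comm, of "\<lambda>T. T (adj U (x \<otimes> v))"] by (simp add: unitary_adj_apply[OF U])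
  then have 1: "adj U (x \<otimes> y v) = (y \<otimes>\<^sub>o id_blinfun) (adj U (x \<otimes> v))"
    by (simp add: unitary_adj_apply[OF U] op_tensor_tensor y)
  have "cinner (x \<otimes> y v) (U (z \<otimes> u)) = cinner (adj U (x \<otimes> y v)) (z \<otimes> u)"
    by (simp add: cinner_adj Ub)
  also have "\<dots> = cinner (adj U (x \<otimes> v)) (adj (y \<otimes>\<^sub>o id_blinfun) (z \<otimes> u))"
    unfolding 1 by (simp add: cinner_adj_right y)
  also have "\<dots> = cinner (x \<otimes> v) (U (adj y z \<otimes> u))"
    by (simp add: adj_op_tensor y op_tensor_tensor cinner_adj Ub)
  finally show ?thesis ..
qed

text \<open>Modularity turns the intertwining relation into \<open>bar (y\<^sup>* z) \<otimes> Q v = bar z \<otimes> Q (y v)\<close>, provided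
  that both \<open>v\<close> and \<open>y v\<close> belong to the domain of \<open>Q\<close>.\<close>

lemma modular_adj_scalar:
  fixes W :: "'h::chilbert_space \<otimes>\<^sub>H 'h \<Rightarrow>\<^sub>L 'h \<otimes>\<^sub>H 'h"
  assumes U: "unitary W" and Ut: "unitary Wt"
    and Q: "selfadjoint Q" "trivial_kernel Q"
    and modular: "\<And>x z y y' u w. (y, y') \<in> Q \<Longrightarrow> (w, u) \<in> Q \<Longrightarrow>
      cinner (x \<otimes> y) (W (z \<otimes> u)) = cinner (bar z \<otimes> y') (Wt (bar x \<otimes> w))"
    and y: "y \<in> bounded_ops" and comm: "W o\<^sub>L (y \<otimes>\<^sub>o id_blinfun) = (id_blinfun \<otimes>\<^sub>o y) o\<^sub>L W"
    and v: "(v, q) \<in> Q" "(y v, q') \<in> Q" "v \<noteq> 0"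
  shows "\<exists>c. \<forall>z. adj y z = c *\<^sub>C z"
proof -
  have q: "q \<noteq> 0"
    using v Q(2) by (auto simp: trivial_kernel_def)
  have key: "bar (adj y z) \<otimes> q = bar z \<otimes> q'" for z
  proof -
    \<comment> \<open>By modularity \<open>adj Wt \<zeta>\<close> is orthogonal to
      \<open>bar x \<otimes> w\<close> for all \<open>w\<close> in the domain of \<open>Q\<close>.
      That domain is dense, so \<open>adj Wt \<zeta>\<close> and therefore \<zeta> vanish.\<close>
    define \<zeta> where "\<zeta> = bar (adj y z) \<otimes> q - bar z \<otimes> q'"
    have 0: "cinner (adj Wt \<zeta>) (bar x \<otimes> w) = 0" if "w \<in> Domain Q" for x w
    proof -
      obtain u where u: "(w, u) \<in> Q" using \<open>w \<in> Domain Q\<close> by blast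
      have "cinner (bar (adj y z) \<otimes> q) (Wt (bar x \<otimes> w)) = cinner (bar z \<otimes> q') (Wt (bar x \<otimes> w))"
        using modular[OF v(1) u, of x "adj y z"] modular[OF v(2) u, of x z]
          adj_intertwiner[OF U y comm, of x v z u] by simp
      then show ?thesis
        by (simp add: \<zeta>_def cinner_adj unitary_bounded_ops[OF Ut] cinner_diff_left)
    qed
    have "closed {w. cinner (adj Wt \<zeta>) (tensor_l x w) = 0}" for x
      by (intro closed_Collect_eq continuous_intros)
    then have "closure (Domain Q) \<subseteq> {w. cinner (adj Wt \<zeta>) (tensor_l (bar x) w) = 0}" for x
      using 0[of _ x] by (intro closure_minimal subsetI CollectI) (simp_all only: tensor_l_apply)
    then have "cinner (adj Wt \<zeta>) (bar x \<otimes> w) = 0" for x w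
      using Q(1) by (auto simp: selfadjoint_def)
    then have "cinner (p \<otimes> w) (adj Wt \<zeta>) = cinner (p \<otimes> w) 0" for p w
      by (metis cinner_commute cinner_zero_right complex_cnj_zero of_bar_inverse)
    then have "adj Wt \<zeta> = 0" by (rule tensor_cinner_eqI)
    then have "Wt (adj Wt \<zeta>) = 0" by simp
    then show ?thesis
      by (simp add: unitary_adj_apply[OF Ut] \<zeta>_def)
  qed
  \<comment> \<open>Slicing \<open>key\<close> against \<open>q \<noteq> 0\<close> produces this
    factor; it becomes \<open>cnj \<mu>\<close> on leaving the conjugate space.\<close>
  define \<mu> where "\<mu> = cinner q q' / cinner q q"
  have "adj y z = cnj \<mu> *\<^sub>C z" for z
  proof -
    have "cinner q q *\<^sub>C bar (adj y z) = cinner q q' *\<^sub>C bar z"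
      using arg_cong[OF key, of "adj (tensor_r q)" z] by (simp add: slice_tensor)
    then have "(1 / cinner q q) *\<^sub>C cinner q q *\<^sub>C bar (adj y z) = (1 / cinner q q) *\<^sub>C cinner q q' *\<^sub>C bar z"
      by simp
    then have "bar (adj y z) = \<mu> *\<^sub>C bar z"
      using q by (simp add: scaleC_scaleC \<mu>_def cinner_eq_zero_iff scaleC_one)
    then have "of_bar (bar (adj y z)) = of_bar (\<mu> *\<^sub>C bar z)" by simp
    then show ?thesis by (simp add: scaleC_conj_space.rep_eq)
  qed
  then show ?thesis by blast
qed

text \<open>The equation becomes \<open>K a K = c (1 - V\<^sup>2) = c K\<^sup>2\<close>, and the
  injective selfadjoint \<open>K\<close> cancels on both sides.\<close>

lemma (in selfadjoint_resolvent) stein_scalar: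
  fixes a y :: "'a \<Rightarrow>\<^sub>L 'a"
  assumes a: "a \<in> bounded_ops" and y: "\<And>x. y x - V (y (V x)) = adj K (a (K x))"
    and scalar: "\<And>x. y x = c *\<^sub>C x"
  shows "a = c *\<^sub>C id_blinfun"
proof -
  have "K (a (K x)) = c *\<^sub>C (x - V (V x))" for x
    using y[of x] by (simp add: scalar adj_K bounded_opsD complex_vector.scale_right_diff_distrib)
  then have KaK: "K (a (K x)) = c *\<^sub>C K (K x)" for x
    using defect[of x] by (simp add: adj_K)
  have "a - c *\<^sub>C id_blinfun = 0"
  proof (rule sandwich_eq_0[OF K adj_K K_inj])
    show "cinner (K x) ((a - c *\<^sub>C id_blinfun) (K z)) = 0" for x z
    proof -
      have "cinner (K x) ((a - c *\<^sub>C id_blinfun) (K z)) = cinner x (K ((a - c *\<^sub>C id_blinfun) (K z)))"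
        using cinner_adj[OF K, of x] by (simp add: adj_K)
      then show ?thesis
        by (simp add: blinfun.diff_left blinfun.diff_right scaleC_blinfun.rep_eq KaK bounded_opsD)
    qed
  qed (simp_all add: a)
  then show ?thesis by simp
qed

lemma modular_intertwiner_scalar:
  fixes W :: "'h::chilbert_space \<otimes>\<^sub>H 'h \<Rightarrow>\<^sub>L 'h \<otimes>\<^sub>H 'h"
  assumes W: "modular_multiplicative_unitary W" and a: "a \<in> bounded_ops" and b: "b \<in> bounded_ops"
    and ab: "W o\<^sub>L (a \<otimes>\<^sub>o id_blinfun) = (id_blinfun \<otimes>\<^sub>o b) o\<^sub>L W"
  shows "\<exists>c. a = c *\<^sub>C id_blinfun \<and> b = c *\<^sub>C id_blinfun"
proof (cases "\<exists>x :: 'h. x \<noteq> 0")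
  \<comment> \<open>On the zero space all operators coincide; otherwise there is a nonzero vector
    from which to build \<open>v\<close>.\<close>
  case False
  then have "a = 0 *\<^sub>C id_blinfun" "b = 0 *\<^sub>C id_blinfun"
    by (intro blinfun_eqI; metis)+
  then show ?thesis by blast
next
  case True
  obtain Qh Q :: "('h \<times> 'h) set" and Wt :: "'h conj_space \<otimes>\<^sub>H 'h \<Rightarrow>\<^sub>L 'h conj_space \<otimes>\<^sub>H 'h"
    where Qh: "selfadjoint Qh" "trivial_kernel Qh" and Q: "selfadjoint Q" "trivial_kernel Q"
      and Ut: "unitary Wt"
      and inv: "graph_of W O graph_tensor Qh Q O graph_of (adj W) = graph_tensor Qh Q"
      and modular: "\<forall>x z y Qy u Qinv_u. (y, Qy) \<in> Q \<longrightarrow> (u, Qinv_u) \<in> Q\<inverse> \<longrightarrow>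
        cinner (x \<otimes> y) (W (z \<otimes> u)) = cinner (bar z \<otimes> Qy) (Wt (bar x \<otimes> Qinv_u))"
    using W unfolding modular_multiplicative_unitary_def by blast
  have mu: "multiplicative_unitary W"
    using W by (simp add: modular_multiplicative_unitary_def)
  then have U: "unitary W" by (simp add: multiplicative_unitary_def)
  have cl: "csubspace G" "closed G" if "selfadjoint G" for G :: "('h \<times> 'h) set"
    using that closed_graph_adjoint[of G] by (simp_all add: selfadjoint_def)
  obtain Rh Sh where "resolvent_pair Qh Rh Sh" using resolvent_pair_exists[OF cl[OF Qh(1)]] by blast
  moreover obtain R S where "resolvent_pair Q R S" using resolvent_pair_exists[OF cl[OF Q(1)]] by blast
  moreover obtain N M where "resolvent_pair (graph_tensor Qh Q) N M"
    using resolvent_pair_exists[OF csubspace_graph_tensor closed_graph_tensor] by blast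
  ultimately interpret tensor_resolvent Qh Rh Sh Q R S N M
    by unfold_locales (use Qh Q in simp_all)
  have eq: "a = b"
    by (rule pentagon_intertwiner_eq[OF mu a b ab])
  obtain y where y: "y \<in> bounded_ops" "\<And>x. y x - P.V (y (P.V x)) = adj P.K (a (P.K x))"
    using P.stein_solution[OF a] by metis
  obtain w where w: "w \<in> bounded_ops" "\<And>x. Q.stein_term a x sums w x"
    "\<And>x. w x - Q.V (w (Q.V x)) = adj Q.K (a (Q.K x))"
    using Q.stein_solution[OF a] by metis
  have yw: "W o\<^sub>L (y \<otimes>\<^sub>o id_blinfun) = (id_blinfun \<otimes>\<^sub>o w) o\<^sub>L W"
    by (rule stein_intertwiner[OF U inv a b ab y w(1)]) (simp add: w(3) eq)
  \<comment> \<open>The two regularizations of \<open>a\<close> belong to different operators,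
    \<open>Qh\<close> and \<open>Q\<close>; the pentagon identifies them.\<close>
  have "y = w"
    by (rule pentagon_intertwiner_eq[OF mu y(1) w(1) yw])
  then have comm: "W o\<^sub>L (w \<otimes>\<^sub>o id_blinfun) = (id_blinfun \<otimes>\<^sub>o w) o\<^sub>L W"
    using yw by simp
  obtain x :: 'h where x: "x \<noteq> 0" using True by blast
  define v where "v = Q.K (Q.K x)"
  have "v \<noteq> 0" using x Q.K_inj unfolding v_def by blast
  moreover have "\<exists>q. (v, q) \<in> Q"
  proof -
    \<comment> \<open>\<open>K\<^sup>2 = 4 S\<^sup>2 = 4 R (1 - R)\<close>, and the range of
      \<open>R\<close> is contained in the domain of \<open>Q\<close>.\<close>
    have "v = R (4 *\<^sub>R (x - R x))"
      by (simp add: v_def Q.K_apply Q.SS blinfun.diff_right blinfun.scaleR_right)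
    then show ?thesis using Q.RQ by metis
  qed
  moreover have "\<exists>q. (w v, q) \<in> Q"
    unfolding v_def by (rule Q.stein_domain[OF a w(2)])
  ultimately obtain c where c: "\<And>z. adj w z = c *\<^sub>C z"
    using modular_adj_scalar[OF U Ut Q _ w(1) comm] modular by (metis converse_iff)
  have "w z = cnj c *\<^sub>C z" for z
    by (rule cinner_eqI_right)
      (simp add: c cinner_scaleC_left cinner_scaleC_right flip: cinner_adj[OF w(1)])
  then have "a = cnj c *\<^sub>C id_blinfun"
    by (rule Q.stein_scalar[OF a w(3)])
  then show ?thesis using eq by blast
qed

section \<open>C*-algebras\<close>

lemma star_zero [simp]: "star (0 :: 'a::cstar_algebra) = 0"
  using star_add[of "0 :: 'a" 0] by simp

lemma star_minus: "star (- x) = - star x" for x :: "'a::cstar_algebra"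
  using star_add[of x "- x"] by (simp add: eq_neg_iff_add_eq_0 add.commute)

lemma star_diff: "star (x - y) = star x - star y" for x :: "'a::cstar_algebra"
  using star_add[of x "- y"] by (simp add: star_minus)

lemma star_scaleR: "star (r *\<^sub>R x) = r *\<^sub>R star x" for x :: "'a::cstar_algebra"
  by (simp add: scaleR_scaleC star_scaleC)

lemma norm_star: "norm (star x) = norm x" for x :: "'a::cstar_algebra"
proof -
  have le: "norm x \<le> norm (star x)" for x :: 'a
  proof (cases "x = 0")
    case False
    have "norm x * norm x \<le> norm (star x) * norm x"
      using norm_mult_ineq[of "star x" x] by (simp add: cstar_identity power2_eq_square)
    then show ?thesis using False by simp
  qed simp
  show ?thesis using le[of x] le[of "star x"] by (simp add: star_star)
qed

lemma bounded_linear_star: "bounded_linear (star :: 'a::cstar_algebra \<Rightarrow> 'a)"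
  by (rule bounded_linear_intro[of _ 1]) (simp_all add: star_add star_scaleR norm_star)

text \<open>In the unitization, \<open>1 - w\<close> is the square root of \<open>1 - z\<close>. The iteration for \<open>w\<close> is dominated
  by the corresponding iteration \<open>r\<close> for \<open>z = 1\<close> in the real numbers, whence it converges even for
  \<open>norm z = 1\<close>.\<close>

lemma sqrt_unit_minus:
  fixes z :: "'a::cstar_algebra"
  assumes z: "star z = z" "norm z \<le> 1"
  obtains w where "star w = w" "norm w \<le> 1" "2 *\<^sub>R w = z + w * w"
    "\<And>x. x * z = z * x \<Longrightarrow> x * w = w * x"
proof -
  define W where "W = rec_nat (0 :: 'a) (\<lambda>_ w. (1 / 2) *\<^sub>R (z + w * w))"
  define r where "r = rec_nat (0 :: real) (\<lambda>_ w. (1 / 2) * (1 + w * w))"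
  have W: "W 0 = 0" "W (Suc n) = (1 / 2) *\<^sub>R (z + W n * W n)" for n
    by (simp_all add: W_def)
  have r: "r 0 = 0" "r (Suc n) = (1 / 2) * (1 + r n * r n)" for n
    by (simp_all add: r_def)
  have r01: "0 \<le> r n \<and> r n \<le> 1" for n
    by (induction n) (auto simp: r mult_le_one)
  have r_mono: "r n \<le> r (Suc n)" for n
    using zero_le_power2[of "1 - r n"] by (simp add: r power2_eq_square algebra_simps)
  have W_le: "norm (W n) \<le> r n" for n
  proof (induction n)
    case (Suc n)
    have "norm (W n * W n) \<le> r n * r n"
      by (rule order_trans[OF norm_mult_ineq]) (intro mult_mono Suc; simp add: r01)
    then show ?case
      using norm_triangle_ineq[of z "W n * W n"] z(2) by (simp add: W r)
  qed (simp add: W r)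
  have W_diff: "norm (W (Suc n) - W n) \<le> r (Suc n) - r n" for n
  proof (induction n)
    case 0
    show ?case using z by (simp add: W r)
  next
    case (Suc n)
    have "W (Suc (Suc n)) - W (Suc n)
        = (1 / 2) *\<^sub>R (z + W (Suc n) * W (Suc n)) - (1 / 2) *\<^sub>R (z + W n * W n)"
      by (rule arg_cong2[where f = "(-)", OF W(2) W(2)])
    also have "\<dots> = (1 / 2) *\<^sub>R (W (Suc n) * W (Suc n) - W n * W n)"
      by (simp flip: scaleR_diff_right)
    \<comment> \<open>This splitting avoids commutativity, and its norm estimate is exactly the
      recursion for the differences of \<open>r\<close>.\<close>
    also have "W (Suc n) * W (Suc n) - W n * W n
        = W (Suc n) * (W (Suc n) - W n) + (W (Suc n) - W n) * W n"
      by (simp add: algebra_simps)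
    also have "norm ((1 / 2) *\<^sub>R \<dots>) \<le> (1 / 2) * (norm (W (Suc n)) * norm (W (Suc n) - W n)
        + norm (W (Suc n) - W n) * norm (W n))"
      using norm_triangle_ineq[of "W (Suc n) * (W (Suc n) - W n)" "(W (Suc n) - W n) * W n"]
        norm_mult_ineq[of "W (Suc n)" "W (Suc n) - W n"] norm_mult_ineq[of "W (Suc n) - W n" "W n"]
      by simp
    also have "\<dots> \<le> (1 / 2) * (r (Suc n) * (r (Suc n) - r n) + (r (Suc n) - r n) * r n)"
      by (intro mult_left_mono add_mono mult_mono W_le Suc) (simp_all add: r01 r_mono)
    also have "\<dots> = (1 / 2) * (1 + r (Suc n) * r (Suc n)) - (1 / 2) * (1 + r n * r n)"
      by (simp add: algebra_simps)
    also have "\<dots> = r (Suc (Suc n)) - r (Suc n)"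
      by (rule arg_cong2[where f = "(-)", OF r(2)[symmetric] r(2)[symmetric]])
    finally show ?case .
  qed
  have W_diff': "norm (W (n + m) - W n) \<le> r (n + m) - r n" for n m
  proof (induction m)
    case (Suc m)
    then show ?case
      using W_diff[of "n + m"] norm_triangle_ineq[of "W (n + Suc m) - W (n + m)" "W (n + m) - W n"]
      by simp
  qed simp
  have "incseq r" by (rule incseq_SucI) (rule r_mono)
  then have "Cauchy r"
    using r01 incseq_convergent[of r 1] by (metis LIMSEQ_imp_Cauchy)
  have "Cauchy W"
    unfolding Cauchy_altdef2
  proof (intro allI impI)
    fix e :: real assume "0 < e"
    then obtain N where "\<And>n. n \<ge> N \<Longrightarrow> dist (r n) (r N) < e"
      using \<open>Cauchy r\<close> unfolding Cauchy_altdef2 by blast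
    moreover have "dist (W n) (W N) \<le> dist (r n) (r N)" if "n \<ge> N" for n
      using W_diff'[of N "n - N"] that by (simp add: dist_norm)
    ultimately show "\<exists>N. \<forall>n\<ge>N. dist (W n) (W N) < e"
      using le_less_trans by blast
  qed
  then obtain w where w: "W \<longlonglongrightarrow> w"
    using Cauchy_convergent convergent_def by blast
  show ?thesis
  proof
    have "star (W n) = W n" for n
      by (induction n) (simp_all add: W star_scaleR star_add star_mult z)
    then show "star w = w"
      using bounded_linear.tendsto[OF bounded_linear_star w] w by (simp add: LIMSEQ_unique)
    show "norm w \<le> 1"
      by (rule LIMSEQ_le_const2[OF tendsto_norm[OF w]]) (meson W_le order_trans r01)
    have "(\<lambda>n. W (Suc n)) \<longlonglongrightarrow> (1 / 2) *\<^sub>R (z + w * w)"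
      unfolding W(2) by (intro tendsto_intros w)
    then have "w = (1 / 2) *\<^sub>R (z + w * w)"
      using LIMSEQ_Suc[OF w] LIMSEQ_unique by blast
    then have "2 *\<^sub>R w = 2 *\<^sub>R (1 / 2) *\<^sub>R (z + w * w)" by simp
    then show "2 *\<^sub>R w = z + w * w" by simp
    fix x assume x: "x * z = z * x"
    have "x * W n = W n * x" for n
    proof (induction n)
      case (Suc n)
      have "x * (W n * W n) = (W n * W n) * x"
        by (metis Suc mult.assoc)
      then show ?case by (simp add: W distrib_left distrib_right x)
    qed (simp add: W)
    then have "(\<lambda>n. x * W n) \<longlonglongrightarrow> w * x"
      using tendsto_mult_right[OF w, of x] by simp
    then show "x * w = w * x"
      using tendsto_mult_left[OF w, of x] LIMSEQ_unique by blast
  qed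
qed

text \<open>If \<open>t\<close> is identified with a number in \<open>[-\<surd>2, \<surd>2]\<close>, then \<open>t\<^sup>2 - 1\<close> and \<open>g\<close> are the real and
  imaginary part of a unitary in the unitization, where \<open>g\<^sup>2 = 2 t\<^sup>2 - t\<^sup>4\<close>.\<close>

lemma norm_logistic_le_1:
  fixes t :: "'a::cstar_algebra"
  assumes t: "star t = t" "(norm t)\<^sup>2 \<le> 2"
  shows "norm (2 *\<^sub>R (t * t) - (t * t) * (t * t)) \<le> 1"
proof -
  define h where "h = (1 / sqrt 2) *\<^sub>R t"
  define k where "k = t * t"
  have hh: "k = 2 *\<^sub>R (h * h)"
    by (simp add: h_def k_def)
  have h: "star h = h" by (simp add: h_def star_scaleR t)
  have "norm (h * h) \<le> norm h * norm h" by (rule norm_mult_ineq)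
  also have "\<dots> \<le> 1" using t(2) by (simp add: h_def power2_eq_square)
  finally obtain w where w: "star w = w" "2 *\<^sub>R w = h * h + w * w"
    "\<And>x. x * (h * h) = (h * h) * x \<Longrightarrow> x * w = w * x"
    using sqrt_unit_minus[of "h * h"] h by (metis star_mult)
  have hw: "h * w = w * h"
    by (rule w(3)) (simp add: mult.assoc)
  \<comment> \<open>Since \<open>(1 - w)\<^sup>2 = 1 - h\<^sup>2\<close>, the square of
    \<open>g = 2 h (1 - w)\<close> is
    \<open>4 h\<^sup>2 (1 - h\<^sup>2) = 2 k - k\<^sup>2\<close>.\<close>
  define g where "g = 2 *\<^sub>R (h - h * w)"
  have g: "star g = g"
    by (simp add: g_def star_scaleR star_diff star_mult h w hw)
  have gg: "g * g = 2 *\<^sub>R k - k * k"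
  proof -
    have "h * w * (h * w) = h * h * (w * w)" "h * (h * w) = h * h * w" "h * w * h = h * h * w"
      by (metis hw mult.assoc)+
    then have "(h - h * w) * (h - h * w) = h * h - 2 *\<^sub>R (h * h * w) + h * h * (w * w)"
      by (simp add: algebra_simps scaleR_2)
    also have "\<dots> = h * h - h * h * (h * h)"
    proof -
      have "2 *\<^sub>R (h * h * w) = h * h * (h * h) + h * h * (w * w)"
        by (metis distrib_left mult_scaleR_right w(2))
      then show ?thesis by simp
    qed
    finally have "g * g = 2 *\<^sub>R 2 *\<^sub>R (h * h - h * h * (h * h))"
      by (simp only: g_def mult_scaleR_left mult_scaleR_right)
    then show ?thesis
      by (simp add: hh scaleR_diff_right)
  qed
  have kg: "k * g = g * k"
  proof -
    have "h * h * (h * w) = h * w * (h * h)"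
      by (metis hw mult.assoc)
    then show ?thesis
      by (simp add: hh g_def algebra_simps)
  qed
  have k: "star k = k" by (simp add: k_def star_mult t)
  \<comment> \<open>Left multiplication by \<open>k - 1 + c g\<close> is isometric, because
    \<open>(k - 1)\<^sup>2 + g\<^sup>2 = 1\<close> and \<open>g\<close> commutes with
    \<open>k\<close>.\<close>
  have iso: "norm (k * y - y + c *\<^sub>C (g * y)) = norm y" if c: "c = \<i> \<or> c = - \<i>" for c y
  proof -
    define p q where "p = k * y - y" and "q = g * y"
    have "k * k * y + g * g * y = 2 *\<^sub>R (k * y)"
      by (simp add: gg left_diff_distrib)
    then have *: "star y * (k * k * y) + star y * (g * g * y) = 2 *\<^sub>R (star y * (k * y))"
      by (metis distrib_left mult_scaleR_right)
    have pq: "star p * q = star q * p"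
    proof -
      have "star y * (k * (g * y)) = star y * (g * (k * y))"
        by (metis kg mult.assoc)
      then show ?thesis
        by (simp add: p_def q_def star_mult star_diff k g algebra_simps)
    qed
    have pp: "star p * p + star q * q = star y * y"
      using * by (simp add: p_def q_def star_mult star_diff k g algebra_simps scaleR_2)
    have c': "cnj c * c = 1" "cnj c = - c" using c by auto
    have "star (p + c *\<^sub>C q) * (p + c *\<^sub>C q)
        = star p * p + (cnj c * c) *\<^sub>C (star q * q) + c *\<^sub>C (star p * q) + cnj c *\<^sub>C (star q * p)"
      by (simp add: star_add star_scaleC distrib_left distrib_right mult_scaleC_left
          mult_scaleC_right scaleC_add_right scaleC_scaleC ac_simps)
    also have "\<dots> = star p * p + star q * q"
      unfolding c'(1) unfolding c'(2) pq by (simp add: scaleC_one)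
    finally have "star (p + c *\<^sub>C q) * (p + c *\<^sub>C q) = star y * y"
      by (simp only: pp)
    then have "(norm (p + c *\<^sub>C q))\<^sup>2 = (norm y)\<^sup>2"
      by (metis cstar_identity)
    then show ?thesis
      unfolding p_def q_def by simp
  qed
  \<comment> \<open>The two isometries differ by left multiplication with \<open>2 \<i> g\<close>;
    apply both to \<open>g\<close> itself.\<close>
  have "norm (g * g) \<le> norm g"
  proof -
    have "(k * g - g + \<i> *\<^sub>C (g * g)) - (k * g - g + (- \<i>) *\<^sub>C (g * g)) = 2 *\<^sub>R \<i> *\<^sub>C (g * g)"
      by (simp add: scaleR_2)
    then have "norm (2 *\<^sub>R \<i> *\<^sub>C (g * g)) \<le> norm g + norm g"
      using norm_triangle_ineq4[of "k * g - g + \<i> *\<^sub>C (g * g)" "k * g - g + (- \<i>) *\<^sub>C (g * g)"]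
        iso[of \<i> g] iso[of "- \<i>" g] by simp
    then show ?thesis by (simp add: norm_scaleC)
  qed
  then have "norm g * norm g \<le> 1 * norm g"
    using cstar_identity[of g] by (simp add: g power2_eq_square)
  then have "norm g \<le> 1" by (cases "g = 0") simp_all
  then have "norm (g * g) \<le> 1"
    using \<open>norm (g * g) \<le> norm g\<close> by linarith
  then show ?thesis by (simp add: gg k_def)
qed

section \<open>Injective star representations are isometric\<close>

locale star_representation =
  fixes \<pi> :: "'d::cstar_algebra \<Rightarrow> ('l::chilbert_space \<Rightarrow>\<^sub>L 'l)"
  assumes bounded_ops [simp]: "\<pi> x \<in> bounded_ops"
    and add: "\<pi> (x + y) = \<pi> x + \<pi> y"
    and scaleC: "\<pi> (c *\<^sub>C x) = c *\<^sub>C \<pi> x"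
    and mult: "\<pi> (x * y) = \<pi> x o\<^sub>L \<pi> y"
    and star: "\<pi> (star x) = adj (\<pi> x)"
begin

lemma zero [simp]: "\<pi> 0 = 0"
  using add[of 0 0] by simp

lemma scaleR: "\<pi> (r *\<^sub>R x) = r *\<^sub>R \<pi> x"
  by (simp add: scaleR_scaleC scaleC)

lemma cinner_selfadjoint: "star x = x \<Longrightarrow> cinner (\<pi> x u) v = cinner u (\<pi> x v)"
  using cinner_adj[of "\<pi> x" u v] by (simp flip: star)

text \<open>With \<open>(1 - w)\<^sup>2 = 1 - x\<^sup>2\<close>, the squared norm of
  \<open>\<pi> x u\<close> is that of \<open>u\<close> minus that of
  \<open>u - \<pi> w u\<close>.\<close>

lemma selfadjoint_contraction:
  assumes x: "star x = x" "norm x \<le> 1"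
  shows "norm (\<pi> x u) \<le> norm u"
proof -
  have "norm (x * x) \<le> 1"
    using norm_mult_ineq[of x x] mult_le_one[OF x(2) norm_ge_zero x(2)] by linarith
  then obtain w where w: "star w = w" "2 *\<^sub>R w = x * x + w * w"
    using sqrt_unit_minus[of "x * x"] x by (metis star_mult)
  have "2 *\<^sub>R \<pi> w u = \<pi> x (\<pi> x u) + \<pi> w (\<pi> w u)"
    using arg_cong[OF w(2), of "\<lambda>y. \<pi> y u"]
    by (simp add: scaleR add mult blinfun.add_left blinfun.scaleR_left)
  then have "cinner u (2 *\<^sub>R \<pi> w u) = cinner u (\<pi> x (\<pi> x u) + \<pi> w (\<pi> w u))" by simp
  then have "cinner (\<pi> x u) (\<pi> x u) = cinner u u - cinner (u - \<pi> w u) (u - \<pi> w u)"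
    by (simp add: cinner_selfadjoint x w cinner_add_right cinner_diff_left cinner_diff_right
        scaleR_scaleC cinner_scaleC_right algebra_simps)
  then have "complex_of_real ((norm (\<pi> x u))\<^sup>2)
      = complex_of_real ((norm u)\<^sup>2 - (norm (u - \<pi> w u))\<^sup>2)"
    by (simp add: cinner_self)
  then have "(norm (\<pi> x u))\<^sup>2 = (norm u)\<^sup>2 - (norm (u - \<pi> w u))\<^sup>2"
    by (simp only: of_real_eq_iff)
  then have "(norm (\<pi> x u))\<^sup>2 \<le> (norm u)\<^sup>2" by simp
  then show ?thesis by (rule power2_le_imp_le) simp
qed

lemma norm_le: "norm (\<pi> x) \<le> norm x"
proof (rule norm_blinfun_bound)
  have sa: "norm (\<pi> x u) \<le> norm x * norm u" if x: "star x = x" for x u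
  proof (cases "x = 0")
    case False
    have "norm (\<pi> ((1 / norm x) *\<^sub>R x) u) \<le> norm u"
      by (rule selfadjoint_contraction) (simp_all add: star_scaleR x False)
    then show ?thesis using False by (simp add: scaleR blinfun.scaleR_left field_simps)
  qed simp
  show "norm (\<pi> x u) \<le> norm x * norm u" for u
  proof (rule power2_le_imp_le)
    have "(norm (\<pi> x u))\<^sup>2 = norm (cinner (\<pi> x u) (\<pi> x u))"
      by (simp add: cinner_self norm_power)
    also have "cinner (\<pi> x u) (\<pi> x u) = cinner u (\<pi> (star x * x) u)"
      by (simp add: mult star cinner_adj_right)
    also have "norm \<dots> \<le> norm u * (norm (star x * x) * norm u)"
      by (rule order_trans[OF cinner_Cauchy_Schwarz])
        (intro mult_left_mono sa; simp add: star_mult star_star)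
    finally show "(norm (\<pi> x u))\<^sup>2 \<le> (norm x * norm u)\<^sup>2"
      by (simp add: cstar_identity power2_eq_square mult_ac)
  qed simp
qed simp

text \<open>With \<open>k = t\<^sup>2\<close>, the element \<open>1 - w\<close> is a square root of \<open>(1 - k)\<^sup>2\<close>; the representation cannot
  distinguish it from \<open>1 - k\<close>.\<close>

lemma selfadjoint_norm_le_1:
  assumes inj: "inj \<pi>" and t: "star t = t" "(norm t)\<^sup>2 \<le> 2" and less: "norm (\<pi> t) < 1"
  shows "norm t \<le> 1"
proof -
  define k where "k = t * t"
  define z where "z = 2 *\<^sub>R k - k * k"
  have k: "star k = k" by (simp add: k_def star_mult t)
  have "star z = z" by (simp add: z_def star_diff star_scaleR star_mult k)
  moreover have "norm z \<le> 1"
    unfolding z_def k_def by (rule norm_logistic_le_1[OF t])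
  ultimately obtain w where w: "norm w \<le> 1" "2 *\<^sub>R w = z + w * w"
    "\<And>x. x * z = z * x \<Longrightarrow> x * w = w * x"
    using sqrt_unit_minus by metis
  have kw: "k * w = w * k"
    by (rule w(3)) (simp add: z_def algebra_simps)
  \<comment> \<open>Both \<open>k\<close> and \<open>w\<close> solve
    \<open>2 s - s\<^sup>2 = z\<close>, and they commute.\<close>
  have "2 *\<^sub>R (k - w) = (k + w) * (k - w)"
    using w(2) by (simp add: z_def algebra_simps kw)
  then have eq: "2 *\<^sub>R \<pi> (k - w) u = \<pi> (k + w) (\<pi> (k - w) u)" for u
    by (metis blinfun.scaleR_left blinfun_apply_blinfun_compose mult scaleR)
  have "norm (\<pi> t) * norm (\<pi> t) < 1"
    using mult_strict_mono[OF less less] by simp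
  then have "norm (\<pi> k) < 1"
    using norm_blinfun_compose[of "\<pi> t" "\<pi> t"] by (simp add: k_def mult)
  moreover have "norm (\<pi> w) \<le> 1"
    using norm_le[of w] w(1) by simp
  ultimately have lt2: "norm (\<pi> (k + w)) < 2"
    using norm_triangle_ineq[of "\<pi> k" "\<pi> w"] by (simp add: add)
  \<comment> \<open>A nonzero value would be an eigenvector of \<open>\<pi> (k + w)\<close> with
    eigenvalue 2, which exceeds the norm of that operator.\<close>
  have "\<pi> (k - w) u = 0" for u
  proof (rule ccontr)
    assume "\<pi> (k - w) u \<noteq> 0"
    then have "norm (\<pi> (k + w)) * norm (\<pi> (k - w) u) < 2 * norm (\<pi> (k - w) u)"
      using lt2 by simp
    also have "\<dots> = norm (\<pi> (k + w) (\<pi> (k - w) u))"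
      by (simp flip: eq)
    also have "\<dots> \<le> norm (\<pi> (k + w)) * norm (\<pi> (k - w) u)"
      by (rule norm_blinfun)
    finally show False by simp
  qed
  then have "\<pi> (k - w) = \<pi> 0"
    by (intro blinfun_eqI) simp
  then have "k - w = 0"
    using inj by (simp only: inj_eq)
  then have "(norm t)\<^sup>2 \<le> 1"
    using w(1) cstar_identity[of t] by (simp add: t k_def)
  then show ?thesis by (simp add: power2_le_iff_abs_le[of 1, simplified])
qed

lemma norm_eq:
  assumes inj: "inj \<pi>"
  shows "norm (\<pi> x) = norm x"
proof (rule antisym[OF norm_le])
  have sa: "norm x \<le> norm (\<pi> x)" if x: "star x = x" for x
  proof (rule ccontr)
    assume "\<not> norm x \<le> norm (\<pi> x)"
    then have lt: "norm (\<pi> x) < norm x" by simp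
    then have "0 < norm x" using norm_ge_zero le_less_trans by blast
    \<comment> \<open>The bound 4/5 keeps the norm of \<open>x / r\<close> below 5/4, whose square
      25/16 is within the limit 2 of \<open>selfadjoint_norm_le_1\<close>.\<close>
    with lt have "max (norm (\<pi> x)) (4 / 5 * norm x) < norm x" by simp
    then obtain r where r: "norm (\<pi> x) < r" "4 / 5 * norm x < r" "r < norm x"
      using dense by (metis max_less_iff_conj)
    have r0: "0 < r" using r(1) norm_ge_zero le_less_trans by blast
    have "norm ((1 / r) *\<^sub>R x) \<le> 1"
    proof (rule selfadjoint_norm_le_1[OF inj])
      show "star ((1 / r) *\<^sub>R x) = (1 / r) *\<^sub>R x" by (simp add: star_scaleR x)
      have "norm ((1 / r) *\<^sub>R x) \<le> 5 / 4" using r r0 by (simp add: field_simps)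
      then have "(norm ((1 / r) *\<^sub>R x))\<^sup>2 \<le> (5 / 4)\<^sup>2" by (rule power_mono) simp
      also have "(5 / 4 :: real)\<^sup>2 \<le> 2" by (simp add: power2_eq_square)
      finally show "(norm ((1 / r) *\<^sub>R x))\<^sup>2 \<le> 2" .
      show "norm (\<pi> ((1 / r) *\<^sub>R x)) < 1" using r r0 by (simp add: scaleR)
    qed
    then show False using r r0 by simp
  qed
  have "(norm x)\<^sup>2 = norm (star x * x)" by (simp add: cstar_identity)
  also have "\<dots> \<le> norm (adj (\<pi> x) o\<^sub>L \<pi> x)"
    using sa[of "star x * x"] by (simp add: star_mult star_star mult star)
  also have "\<dots> \<le> norm (adj (\<pi> x)) * norm (\<pi> x)" by (rule norm_blinfun_compose)
  also have "\<dots> \<le> norm (\<pi> x) * norm (\<pi> x)"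
    by (intro mult_right_mono norm_adj_le) simp_all
  finally have "(norm x)\<^sup>2 \<le> (norm (\<pi> x))\<^sup>2"
    by (simp only: power2_eq_square)
  then show "norm x \<le> norm (\<pi> x)"
    by (rule power2_le_imp_le) simp
qed

text \<open>An isometric image of a complete space is complete. Closedness ensures that slices of
  the closed spatial tensor product stay in the range.\<close>

lemma closed_range:
  assumes "inj \<pi>"
  shows "closed (range \<pi>)"
proof -
  have "bounded_linear \<pi>"
    by (rule bounded_linear_intro[of _ 1]) (simp_all add: add scaleR norm_le)
  then have "complete (range \<pi>)"
    by (rule complete_isometric_image[of 1, rotated 2])
      (simp_all add: norm_eq[OF assms] complete_UNIV)
  then show ?thesis by (rule complete_imp_closed)
qed

lemma csubspace_range: "csubspace (range \<pi>)"
  by (rule complex_vector.subspaceI) (metis rangeI zero, auto simp flip: add scaleC)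

end

section \<open>Multipliers of spatial tensor products\<close>

text \<open>The image of the unit ball lies in the image of a closed disc of radius
  \<open>norm e\<close>, which is compact.\<close>

lemma compact_rank_one:
  fixes e :: "'h::chilbert_space"
  obtains T :: "'h \<Rightarrow>\<^sub>L 'h" where "T \<in> compact_ops" "\<And>x. T x = cinner e x *\<^sub>C e"
proof -
  define f where "f x = cinner e x *\<^sub>C e" for x
  have f_norm: "norm (f x) \<le> norm x * (norm e * norm e)" for x
    using mult_right_mono[OF cinner_Cauchy_Schwarz[of e x], of "norm e"]
    by (simp add: f_def norm_scaleC mult_ac)
  have 1: "Blinfun f \<in> bounded_ops" "blinfun_apply (Blinfun f) = f"
    using bounded_ops_Blinfun[of f, OF _ _ f_norm]
    by (simp_all add: f_def cinner_add_right cinner_scaleC_right scaleC_add_left scaleC_scaleC)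
  have "bounded_linear (\<lambda>c. c *\<^sub>C e)"
    by (rule bounded_linear_intro[of _ "norm e"])
      (simp_all add: scaleC_add_left norm_scaleC scaleR_scaleC scaleC_scaleC)
  then have K: "compact ((\<lambda>c. c *\<^sub>C e) ` cball 0 (norm e))"
    by (intro compact_continuous_image linear_continuous_on compact_cball)
  have "f ` cball 0 1 \<subseteq> (\<lambda>c. c *\<^sub>C e) ` cball 0 (norm e)"
  proof clarify
    fix x :: 'h assume "x \<in> cball 0 1"
    then have "norm e * norm x \<le> norm e"
      by (simp add: mult_left_le)
    then show "f x \<in> (\<lambda>c. c *\<^sub>C e) ` cball 0 (norm e)"
      using cinner_Cauchy_Schwarz[of e x] unfolding f_def by (intro imageI) simp
  qed
  then have "closure (f ` cball 0 1) \<subseteq> (\<lambda>c. c *\<^sub>C e) ` cball 0 (norm e)"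
    by (intro closure_minimal compact_imp_closed K)
  then have "compact (closure (f ` cball 0 1))"
    by (metis K closed_closure compact_Int_closed inf.absorb_iff2)
  then have "Blinfun f \<in> compact_ops"
    by (simp add: compact_ops_def 1)
  then show ?thesis
    by (rule that) (simp add: 1 f_def)
qed

text \<open>The slice of \<open>S \<otimes>\<^sub>o T\<close> is the multiple
  \<open>cinner e (S e)\<close> of \<open>T\<close>; linearity and continuity of slicing extend this
  to the closed span.\<close>

lemma slice_spatial_tensor:
  fixes A :: "('h::chilbert_space \<Rightarrow>\<^sub>L 'h) set" and B :: "('l::chilbert_space \<Rightarrow>\<^sub>L 'l) set"
  assumes A: "A \<subseteq> bounded_ops" and B: "B \<subseteq> bounded_ops" "csubspace B" "closed B"
    and T: "T \<in> spatial_tensor A B"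
  shows "adj (tensor_l e) o\<^sub>L T o\<^sub>L tensor_l e \<in> B"
proof -
  define M where "M = {T. adj (tensor_l e) o\<^sub>L T o\<^sub>L tensor_l e \<in> B}"
  have M: "csubspace M"
  proof (rule complex_vector.subspaceI)
    note app = blinfun_eqI[of "adj (tensor_l e) o\<^sub>L _ o\<^sub>L tensor_l e"]
    have "adj (tensor_l e) o\<^sub>L 0 o\<^sub>L tensor_l e = (0 :: 'l \<Rightarrow>\<^sub>L 'l)"
      by (rule app) simp
    then show "0 \<in> M" unfolding M_def by (simp add: complex_vector.subspace_0[OF B(2)])
    fix S T :: "'h \<otimes>\<^sub>H 'l \<Rightarrow>\<^sub>L 'h \<otimes>\<^sub>H 'l" and c
    assume ST: "S \<in> M" "T \<in> M"
    have "adj (tensor_l e) o\<^sub>L (S + T) o\<^sub>L tensor_l e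
        = (adj (tensor_l e) o\<^sub>L S o\<^sub>L tensor_l e) + (adj (tensor_l e) o\<^sub>L T o\<^sub>L tensor_l e)"
      by (rule app) (simp add: blinfun.add_left blinfun.add_right)
    then show "S + T \<in> M"
      using ST unfolding M_def by (simp add: complex_vector.subspace_add[OF B(2)])
    have "adj (tensor_l e) o\<^sub>L (c *\<^sub>C S) o\<^sub>L tensor_l e = c *\<^sub>C (adj (tensor_l e) o\<^sub>L S o\<^sub>L tensor_l e)"
      by (rule app) (simp add: scaleC_blinfun.rep_eq bounded_opsD)
    then show "c *\<^sub>C S \<in> M"
      using ST unfolding M_def by (simp add: complex_vector.subspace_scale[OF B(2)])
  qed
  have "closed ((\<lambda>T. adj (tensor_l e) o\<^sub>L T o\<^sub>L tensor_l e) -` B)"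
    by (intro continuous_closed_vimage B)
      (intro bounded_bilinear.continuous[OF bounded_bilinear_blinfun_compose] continuous_intros)
  then have "closed M" by (simp add: M_def vimage_def)
  moreover have "{S \<otimes>\<^sub>o T | S T. S \<in> A \<and> T \<in> B} \<subseteq> M"
  proof clarify
    fix S T assume ST: "S \<in> A" "T \<in> B"
    have "adj (tensor_l e) o\<^sub>L (S \<otimes>\<^sub>o T) o\<^sub>L tensor_l e = cinner e (S e) *\<^sub>C T"
    proof (rule blinfun_eqI, rule cinner_eqI_right)
      show "cinner v ((adj (tensor_l e) o\<^sub>L (S \<otimes>\<^sub>o T) o\<^sub>L tensor_l e) y)
          = cinner v ((cinner e (S e) *\<^sub>C T) y)" for v y
        using ST A B by (simp add: subset_iff cinner_adj_right op_tensor_tensor cinner_tensor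
            scaleC_blinfun.rep_eq cinner_scaleC_right)
    qed
    then show "S \<otimes>\<^sub>o T \<in> M"
      using ST by (simp add: M_def complex_vector.subspace_scale[OF B(2)])
  qed
  ultimately have "spatial_tensor A B \<subseteq> M"
    unfolding spatial_tensor_def by (intro closure_minimal complex_vector.span_minimal M)
  then show ?thesis using T by (auto simp: M_def)
qed

text \<open>For the projection \<open>P\<close> onto the line of \<open>e\<close>,
  \<open>(1 \<otimes> m) (P \<otimes> d) = P \<otimes> m d\<close>, and slicing at \<open>e\<close>
  recovers \<open>m d\<close>; likewise for \<open>d m\<close>.\<close>

lemma multiplier_algebra_slice:
  fixes m :: "'l::chilbert_space \<Rightarrow>\<^sub>L 'l" and B :: "('l \<Rightarrow>\<^sub>L 'l) set"
  assumes B: "B \<subseteq> bounded_ops" "csubspace B" "closed B"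
    and e: "norm (e :: 'h::chilbert_space) = 1" and m: "m \<in> bounded_ops"
    and mult: "id_blinfun \<otimes>\<^sub>o m \<in> multiplier_algebra (spatial_tensor (compact_ops :: ('h \<Rightarrow>\<^sub>L 'h) set) B)"
  shows "m \<in> multiplier_algebra B"
proof -
  obtain P :: "'h \<Rightarrow>\<^sub>L 'h" where P: "P \<in> compact_ops" "\<And>x. P x = cinner e x *\<^sub>C e"
    using compact_rank_one by blast
  have ee: "cinner e e = 1" using e by (simp add: cinner_self)
  have Pe: "P e = e" by (simp add: P ee scaleC_one)
  have compact: "compact_ops \<subseteq> (bounded_ops :: ('h \<Rightarrow>\<^sub>L 'h) set)"
    by (auto simp: compact_ops_def)
  then have Pb: "P \<in> bounded_ops" using P(1) by blast
  have slice: "adj (tensor_l e) o\<^sub>L (P \<otimes>\<^sub>o T) o\<^sub>L tensor_l e = T"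
    if "T \<in> bounded_ops" for T :: "'l \<Rightarrow>\<^sub>L 'l"
    by (rule blinfun_eqI, rule cinner_eqI_right)
      (simp add: that Pb Pe ee cinner_adj_right op_tensor_tensor cinner_tensor)
  have "m o\<^sub>L d \<in> B \<and> d o\<^sub>L m \<in> B" if d: "d \<in> B" for d
  proof -
    have db: "d \<in> bounded_ops" using d B by blast
    have "P \<otimes>\<^sub>o d \<in> spatial_tensor compact_ops B"
      unfolding spatial_tensor_def
      by (rule subsetD[OF closure_subset], rule complex_vector.span_base) (use P d in blast)
    then have "(id_blinfun \<otimes>\<^sub>o m) o\<^sub>L (P \<otimes>\<^sub>o d) \<in> spatial_tensor compact_ops B"
      "(P \<otimes>\<^sub>o d) o\<^sub>L (id_blinfun \<otimes>\<^sub>o m) \<in> spatial_tensor compact_ops B"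
      using mult by (auto simp: multiplier_algebra_def)
    then have "P \<otimes>\<^sub>o (m o\<^sub>L d) \<in> spatial_tensor compact_ops B"
      "P \<otimes>\<^sub>o (d o\<^sub>L m) \<in> spatial_tensor compact_ops B"
      by (simp_all add: op_tensor_compose Pb db m)
    from this[THEN slice_spatial_tensor[OF compact B, of _ e]] show ?thesis
      by (simp add: slice db m)
  qed
  then show ?thesis by (simp add: multiplier_algebra_def m)
qed

section \<open>Reduction of the case with coefficients\<close>

lemma intertwiner_slices:
  fixes W :: "'h::chilbert_space \<otimes>\<^sub>H 'h \<Rightarrow>\<^sub>L 'h \<otimes>\<^sub>H 'h"
    and a b :: "'h \<otimes>\<^sub>H 'l::chilbert_space \<Rightarrow>\<^sub>L 'h \<otimes>\<^sub>H 'l"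
  assumes W: "W \<in> bounded_ops" and a: "a \<in> bounded_ops" and b: "b \<in> bounded_ops"
    and ab: "leg12 W o\<^sub>L leg13 a = leg23 b o\<^sub>L leg12 W"
  shows "W o\<^sub>L ((adj (tensor_r p) o\<^sub>L a o\<^sub>L tensor_r q) \<otimes>\<^sub>o id_blinfun)
    = (id_blinfun \<otimes>\<^sub>o (adj (tensor_r p) o\<^sub>L b o\<^sub>L tensor_r q)) o\<^sub>L W"
proof (rule blinfun_eqI)
  fix z
  \<comment> \<open>\<open>W\<close> acts on the first two legs only, so it passes through both the
    slice of the third leg and \<open>tensor_r q\<close>.\<close>
  have 1: "adj (tensor_r p) (leg12 W u) = W (adj (tensor_r p) u)" for u
    unfolding leg12_def by (rule slice_r_op_tensor[OF W])
  have 2: "leg12 W (tensor_r q u) = tensor_r q (W u)" for u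
    by (simp add: leg12_def op_tensor_tensor W)
  have "(W o\<^sub>L ((adj (tensor_r p) o\<^sub>L a o\<^sub>L tensor_r q) \<otimes>\<^sub>o id_blinfun)) z
      = adj (tensor_r p) ((leg12 W o\<^sub>L leg13 a) (tensor_r q z))"
    unfolding slice_leg13[OF a, symmetric] by (simp add: 1)
  also have "\<dots> = ((id_blinfun \<otimes>\<^sub>o (adj (tensor_r p) o\<^sub>L b o\<^sub>L tensor_r q)) o\<^sub>L W) z"
    unfolding ab slice_leg23[OF b, symmetric] blinfun_apply_blinfun_compose 2 ..
  finally show "(W o\<^sub>L ((adj (tensor_r p) o\<^sub>L a o\<^sub>L tensor_r q) \<otimes>\<^sub>o id_blinfun)) z
      = ((id_blinfun \<otimes>\<^sub>o (adj (tensor_r p) o\<^sub>L b o\<^sub>L tensor_r q)) o\<^sub>L W) z" .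
qed

text \<open>The coefficient of \<open>a\<close> between \<open>x \<otimes> p\<close> and
  \<open>z \<otimes> q\<close> is \<open>c p q * cinner x z\<close>; putting
  \<open>x = z = e\<close> identifies \<open>c p q\<close> as a coefficient of the slice at
  \<open>e\<close>.\<close>

lemma scalar_slices:
  fixes a :: "'h::chilbert_space \<otimes>\<^sub>H 'l::chilbert_space \<Rightarrow>\<^sub>L 'h \<otimes>\<^sub>H 'l"
  assumes a: "a \<in> bounded_ops" and e: "norm e = 1"
    and c: "\<And>p q. adj (tensor_r p) o\<^sub>L a o\<^sub>L tensor_r q = c p q *\<^sub>C id_blinfun"
  shows "a = id_blinfun \<otimes>\<^sub>o (adj (tensor_l e) o\<^sub>L a o\<^sub>L tensor_l e)"
proof (rule bounded_ops_eq_on_tensors)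
  have *: "cinner (x \<otimes> p) (a (z \<otimes> q)) = c p q * cinner x z" for x p z q
  proof -
    have "cinner (x \<otimes> p) (a (z \<otimes> q)) = cinner x ((adj (tensor_r p) o\<^sub>L a o\<^sub>L tensor_r q) z)"
      by (simp add: cinner_adj_right)
    then show ?thesis
      unfolding c by (simp add: scaleC_blinfun.rep_eq cinner_scaleC_right)
  qed
  have ee: "cinner e e = 1" using e by (simp add: cinner_self)
  show "a (z \<otimes> q) = (id_blinfun \<otimes>\<^sub>o (adj (tensor_l e) o\<^sub>L a o\<^sub>L tensor_l e)) (z \<otimes> q)" for z q
    by (rule tensor_cinner_eqI)
      (simp add: * a op_tensor_tensor cinner_tensor cinner_adj_right ee)
qed (simp_all add: a)

text \<open>Slices of \<open>a\<close> and \<open>b\<close> over the coefficient leg are equal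
  scalars by the scalar case. This yields both \<open>a = b\<close> and the form
  \<open>1 \<otimes> m\<close>, and \<open>m\<close> is a multiplier because
  \<open>1 \<otimes> m\<close> is one.\<close>

lemma intertwiner_multiplier:
  fixes W :: "'h::chilbert_space \<otimes>\<^sub>H 'h \<Rightarrow>\<^sub>L 'h \<otimes>\<^sub>H 'h"
    and a b :: "'h \<otimes>\<^sub>H 'l::chilbert_space \<Rightarrow>\<^sub>L 'h \<otimes>\<^sub>H 'l"
  assumes W: "modular_multiplicative_unitary W"
    and B: "B \<subseteq> bounded_ops" "csubspace B" "closed B"
    and a: "a \<in> multiplier_algebra (spatial_tensor (compact_ops :: ('h \<Rightarrow>\<^sub>L 'h) set) B)"
    and b: "b \<in> bounded_ops"
    and ab: "leg12 W o\<^sub>L leg13 a = leg23 b o\<^sub>L leg12 W"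
  shows "a = b \<and> (\<exists>m\<in>multiplier_algebra B. a = id_blinfun \<otimes>\<^sub>o m)"
proof (cases "\<exists>x :: 'h. x \<noteq> 0")
  \<comment> \<open>If the first factor is zero, so is the tensor product; all operators on it agree
    and \<open>m = 0\<close> serves.\<close>
  case False
  then have "x \<otimes> y = 0" for x :: 'h and y :: 'l
    by (metis tensor_zero_left)
  then have "v = 0" for v :: "'h \<otimes>\<^sub>H 'l"
    by (intro tensor_cinner_eqI) simp
  then have "S = T" for S T :: "'h \<otimes>\<^sub>H 'l \<Rightarrow>\<^sub>L 'h \<otimes>\<^sub>H 'l"
    by (intro blinfun_eqI) metis
  moreover have "0 \<in> multiplier_algebra B"
  proof -
    have "0 o\<^sub>L S = 0" "S o\<^sub>L 0 = 0" for S :: "'l \<Rightarrow>\<^sub>L 'l"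
      by (rule blinfun_eqI, simp)+
    then show ?thesis
      using complex_vector.subspace_0[OF B(2)] by (simp add: multiplier_algebra_def)
  qed
  ultimately show ?thesis by blast
next
  case True
  then obtain x :: 'h where "x \<noteq> 0" by blast
  define e where "e = (1 / norm x) *\<^sub>R x"
  have e: "norm e = 1" using \<open>x \<noteq> 0\<close> by (simp add: e_def)
  have ab': "a \<in> bounded_ops" using a by (simp add: multiplier_algebra_def)
  have Wb: "W \<in> bounded_ops"
    using W by (simp add: modular_multiplicative_unitary_def multiplicative_unitary_def unitary_def)
  have "\<exists>c. adj (tensor_r p) o\<^sub>L a o\<^sub>L tensor_r q = c *\<^sub>C id_blinfun
      \<and> adj (tensor_r p) o\<^sub>L b o\<^sub>L tensor_r q = c *\<^sub>C id_blinfun" for p q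
    by (rule modular_intertwiner_scalar[OF W _ _ intertwiner_slices[OF Wb ab' b ab]])
      (simp_all add: ab' b)
  then obtain c where c: "\<And>p q. adj (tensor_r p) o\<^sub>L a o\<^sub>L tensor_r q = c p q *\<^sub>C id_blinfun"
    "\<And>p q. adj (tensor_r p) o\<^sub>L b o\<^sub>L tensor_r q = c p q *\<^sub>C id_blinfun" by metis
  have "a = b"
  proof (rule bounded_ops_eq_on_tensors[OF ab' b])
    fix z q
    have "cinner (y \<otimes> p) (a (z \<otimes> q)) = cinner (y \<otimes> p) (b (z \<otimes> q))" for y p
    proof -
      have "(adj (tensor_r p) o\<^sub>L a o\<^sub>L tensor_r q) z = (adj (tensor_r p) o\<^sub>L b o\<^sub>L tensor_r q) z"
        by (simp only: c)
      then show ?thesis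
        using cinner_adj_right[of "tensor_r p" y "a (z \<otimes> q)"]
          cinner_adj_right[of "tensor_r p" y "b (z \<otimes> q)"] by simp
    qed
    then show "a (z \<otimes> q) = b (z \<otimes> q)" by (rule tensor_cinner_eqI)
  qed
  define m where "m = adj (tensor_l e) o\<^sub>L a o\<^sub>L tensor_l e"
  have am: "a = id_blinfun \<otimes>\<^sub>o m"
    unfolding m_def by (rule scalar_slices[OF ab' e c(1)])
  have "m \<in> multiplier_algebra B"
  proof (rule multiplier_algebra_slice[OF B])
    show "norm e = 1" by (rule e)
    show "m \<in> bounded_ops" by (simp add: m_def ab')
    show "id_blinfun \<otimes>\<^sub>o m \<in> multiplier_algebra (spatial_tensor (compact_ops :: ('h \<Rightarrow>\<^sub>L 'h) set) B)"
      using a by (simp flip: am)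
  qed
  then show ?thesis using \<open>a = b\<close> am by blast
qed

theorem theorem2p6:
  fixes W :: "'h::chilbert_space \<otimes>\<^sub>H 'h \<Rightarrow>\<^sub>L 'h \<otimes>\<^sub>H 'h"
    and \<pi> :: "'d::cstar_algebra \<Rightarrow> ('l::chilbert_space \<Rightarrow>\<^sub>L 'l)"
  assumes "modular_multiplicative_unitary W"
  shows "(\<forall>a\<in>bounded_ops. \<forall>b\<in>bounded_ops.
        W o\<^sub>L (a \<otimes>\<^sub>o id_blinfun) = (id_blinfun \<otimes>\<^sub>o b) o\<^sub>L W \<longrightarrow>
        (\<exists>c. a = c *\<^sub>C id_blinfun \<and> b = c *\<^sub>C id_blinfun)) \<and>
    (faithful_nondegenerate_rep \<pi> \<longrightarrow>
      (\<forall>a\<in>multiplier_algebra (spatial_tensor (compact_ops :: ('h \<Rightarrow>\<^sub>L 'h) set) (range \<pi>)).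
       \<forall>b\<in>multiplier_algebra (spatial_tensor (compact_ops :: ('h \<Rightarrow>\<^sub>L 'h) set) (range \<pi>)).
        leg12 W o\<^sub>L leg13 a = leg23 b o\<^sub>L leg12 W \<longrightarrow>
        a = b \<and> (\<exists>m\<in>multiplier_algebra (range \<pi>). a = id_blinfun \<otimes>\<^sub>o m)))"
proof (intro conjI ballI impI)
  show "\<exists>c. a = c *\<^sub>C id_blinfun \<and> b = c *\<^sub>C id_blinfun"
    if "a \<in> bounded_ops" "b \<in> bounded_ops"
      "W o\<^sub>L (a \<otimes>\<^sub>o id_blinfun) = (id_blinfun \<otimes>\<^sub>o b) o\<^sub>L W" for a b
    by (rule modular_intertwiner_scalar[OF assms that])
next
  fix a b :: "'h \<otimes>\<^sub>H 'l \<Rightarrow>\<^sub>L 'h \<otimes>\<^sub>H 'l"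
  assume \<pi>: "faithful_nondegenerate_rep \<pi>"
    and a: "a \<in> multiplier_algebra (spatial_tensor (compact_ops :: ('h \<Rightarrow>\<^sub>L 'h) set) (range \<pi>))"
    and b: "b \<in> multiplier_algebra (spatial_tensor (compact_ops :: ('h \<Rightarrow>\<^sub>L 'h) set) (range \<pi>))"
    and ab: "leg12 W o\<^sub>L leg13 a = leg23 b o\<^sub>L leg12 W"
  interpret star_representation \<pi>
    using \<pi> unfolding faithful_nondegenerate_rep_def by unfold_locales auto
  \<comment> \<open>Injectivity makes the range norm closed, as the slicing argument
    requires.\<close>
  have "inj \<pi>" using \<pi> by (simp add: faithful_nondegenerate_rep_def)
  then have *: "a = b \<and> (\<exists>m\<in>multiplier_algebra (range \<pi>). a = id_blinfun \<otimes>\<^sub>o m)"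
    using b by (intro intertwiner_multiplier[OF assms _ csubspace_range closed_range a _ ab])
      (auto simp: multiplier_algebra_def)
  show "a = b" by (rule conjunct1[OF *])
  show "\<exists>m\<in>multiplier_algebra (range \<pi>). a = id_blinfun \<otimes>\<^sub>o m" by (rule conjunct2[OF *])
qed

end
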